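(* Let $n\ge 2$ and let $L$ be a projection body in $\mathbb{R}^n$. Then the surface area of $L$ satisfies $$S(L)\ \ge\ \frac{n}{n-1}\, c_n\, \Big(\min_{\xi\in S^{n-1}} S(L\vert\xi^\perp)\Big)\, |L|^{\frac1n},$$ where $c_n = |B_2^n|^{\frac{n-1}{n}}/|B_2^{n-1}|$.
   Context: A convex body in $\mathbb{R}^n$ is a compact convex set with nonempty interior; it is origin-symmetric if $K=-K$. $|\cdot|$ denotes volume (Lebesgue measure) in the appropriate dimension: for a set in $\mathbb{R}^n$ it is $n$-dimensional volume, and for a subset of a hyperplane it is $(n-1)$-dimensional volume. $B_2^m$ is the Euclidean unit ball in $\mathbb{R}^m$ and $S^{n-1}$ is the Euclidean unit sphere in $\mathbb{R}^n$. For $\xi\in S^{n-1}$, $\xi^\perp$ is the hyperplane through the origin orthogonal to $\xi$, and $L\vert\xi^\perp$ is the orthogonal projection of $L$ onto $\xi^\perp$. The support function of a convex body $K$ is $h_K(x)=\max_{y\in K}(x,y)$, $x\in\mathbb{R}^n$. For an origin-symmetric convex body $M$ in $\mathbb{R}^n$, its projection body $\Pi M$ is the origin-symmetric convex body with $h_{\Pi M}(\theta)=|M\vert\theta^\perp|$ for every $\theta\in S^{n-1}$. A convex body $L$ in $\mathbb{R}^n$ is called a projection body if $L=\Pi M$ for some such $M$. The surface area of a convex body $L$ in $\mathbb{R}^n$ is $S(L)=\lim_{\varepsilon\to+0}\frac{|L+\varepsilon B_2^n|-|L|}{\varepsilon}$ (Minkowski sum). For the convex body $L\vert\xi^\perp$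 in the $(n-1)$-dimensional Euclidean space $\xi^\perp$, $S(L\vert\xi^\perp)$ is its surface area in that space, defined by the same formula with $(n-1)$-dimensional volume and the unit ball of $\xi^\perp$ (for $n=2$ this equals $2$). *)

theory Defs
  imports "HOL-Analysis.Analysis"
begin

section \<open>Lebesgue measure on a linear subspace\<close>

definition orthonormal_basis_of :: "'a::euclidean_space set \<Rightarrow> 'a set \<Rightarrow> bool" where
  "orthonormal_basis_of V B \<longleftrightarrow>
     pairwise orthogonal B \<and> (\<forall>b\<in>B. norm b = 1) \<and> independent B \<and> span B = V"

text \<open>
  The push-forward of the product Lebesgue measure on coordinates with respect to an
  orthonormal basis of \<open>V\<close>, as in the library's construction of \<^const>\<open>lborel\<close> itself.
  It is concentrated on \<open>V\<close> and does not depend on the choice of the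
  orthonormal basis, since a change of orthonormal basis is an isometry.
\<close>

definition lborel_on :: "'a::euclidean_space set \<Rightarrow> 'a measure" where
  "lborel_on V =
     (let B = (SOME B. orthonormal_basis_of V B)
      in distr (\<Pi>\<^sub>M b\<in>B. lborel) borel (\<lambda>f. \<Sum>b\<in>B. f b *\<^sub>R b))"

lemma orthonormal_basis_of_some:
  fixes V :: "'a::euclidean_space set"
  assumes "subspace V"
  shows "orthonormal_basis_of V (SOME B. orthonormal_basis_of V B)"
proof (rule someI_ex)
  obtain B where "pairwise orthogonal B" "\<And>x. x \<in> B \<Longrightarrow> norm x = 1" "independent B" "span B = V"
    using orthonormal_basis_subspace[OF assms] by blast
  then show "\<exists>B. orthonormal_basis_of V B"
    unfolding orthonormal_basis_of_def by blast
qed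

lemma emeasure_lborel_on_unit_ball:
  fixes V :: "'a::euclidean_space set"
  assumes "subspace V"
  shows "emeasure (lborel_on V) (cball 0 1 \<inter> V) = ennreal (unit_ball_vol (real (dim V)))"
proof -
  define B where "B = (SOME B. orthonormal_basis_of V B)"
  have B: "pairwise orthogonal B" "\<And>b. b \<in> B \<Longrightarrow> norm b = 1" "independent B" "span B = V"
    using orthonormal_basis_of_some[OF assms] unfolding B_def orthonormal_basis_of_def by auto
  have fin: "finite B" by (rule independent_imp_finite[OF B(3)])
  have card: "card B = dim V" using dim_span_eq_card_independent[OF B(3)] B(4) by simp
  let ?M = "\<Pi>\<^sub>M b\<in>B. (lborel :: real measure)"
  let ?h = "\<lambda>f. \<Sum>b\<in>B. f b *\<^sub>R b"
  have meas: "?h \<in> measurable ?M borel" by measurable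
  have inV: "?h f \<in> V" for f
    unfolding B(4)[symmetric] by (intro span_sum span_mul span_base)
  have nrm: "(norm (?h f))\<^sup>2 = (\<Sum>b\<in>B. (f b)\<^sup>2)" for f
  proof -
    have "(norm (?h f))\<^sup>2 = (\<Sum>b\<in>B. (norm (f b *\<^sub>R b))\<^sup>2)"
      by (rule norm_sum_Pythagorean[OF fin])
         (use B(1) in \<open>auto simp: pairwise_def orthogonal_def\<close>)
    also have "\<dots> = (\<Sum>b\<in>B. (f b)\<^sup>2)" using B(2) by (intro sum.cong) auto
    finally show ?thesis .
  qed
  have "emeasure (lborel_on V) (cball 0 1 \<inter> V) =
        emeasure ?M (?h -` (cball 0 1 \<inter> V) \<inter> space ?M)"
    unfolding lborel_on_def Let_def B_def[symmetric]
    by (rule emeasure_distr[OF meas]) (use assms closed_subspace in \<open>auto intro!: borel_closed\<close>)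
  also have "?h -` (cball 0 1 \<inter> V) \<inter> space ?M =
             {f. sqrt (\<Sum>i\<in>B. (f i)\<^sup>2) \<le> 1} \<inter> space ?M"
  proof -
    have "sqrt (\<Sum>i\<in>B. (f i)\<^sup>2) = norm (?h f)" for f
      unfolding nrm[symmetric] by simp
    then show ?thesis using inV by auto
  qed
  also have "emeasure ?M \<dots> = ennreal (unit_ball_vol (real (dim V)))"
    using emeasure_cball_aux[OF fin, of 1] card by simp
  finally show ?thesis .
qed


section \<open>Convex bodies and projection bodies\<close>

definition convex_body :: "'a::euclidean_space set \<Rightarrow> bool" where
  "convex_body K \<longleftrightarrow> compact K \<and> convex K \<and> interior K \<noteq> {}"

definition origin_symmetric :: "'a::euclidean_space set \<Rightarrow> bool" where
  "origin_symmetric K \<longleftrightarrow> uminus ` K = K"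

definition support_fun :: "'a::euclidean_space set \<Rightarrow> 'a \<Rightarrow> real" where
  "support_fun K x = (SUP y\<in>K. x \<bullet> y)"

text \<open>For a unit vector \<open>\<xi>\<close>, this is the orthogonal projection of \<open>A\<close> onto \<open>{\<xi>}\<^sup>\<bottom>\<close>.\<close>

definition hyperplane_proj :: "'a::euclidean_space set \<Rightarrow> 'a \<Rightarrow> 'a set" where
  "hyperplane_proj A \<xi> = (\<lambda>x. x - (x \<bullet> \<xi>) *\<^sub>R \<xi>) ` A"

text \<open>
  \<open>L = \<Pi> M\<close>, as a relation: a convex body is determined by its support function, which in
  turn, being positively homogeneous, is determined by its values on the unit sphere.
\<close>

definition is_projection_body_of :: "'a::euclidean_space set \<Rightarrow> 'a set \<Rightarrow> bool" where
  "is_projection_body_of L M \<longleftrightarrow>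
     convex_body L \<and> origin_symmetric L \<and>
     (\<forall>\<theta>\<in>sphere 0 1.
        support_fun L \<theta> = measure (lborel_on ({\<theta>}\<^sup>\<bottom>)) (hyperplane_proj M \<theta>))"

definition projection_body :: "'a::euclidean_space set \<Rightarrow> bool" where
  "projection_body L \<longleftrightarrow>
     (\<exists>M. convex_body M \<and> origin_symmetric M \<and> is_projection_body_of L M)"


section \<open>Surface area\<close>

definition surface_area :: "'a::euclidean_space set \<Rightarrow> real" where
  "surface_area L =
     Lim (at_right 0)
       (\<lambda>\<epsilon>. (measure lebesgue (L + (*\<^sub>R) \<epsilon> ` cball 0 1) - measure lebesgue L) / \<epsilon>)"

definition surface_area_on :: "'a::euclidean_space set \<Rightarrow> 'a set \<Rightarrow> real" where
  "surface_area_on V A =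
     Lim (at_right 0)
       (\<lambda>\<epsilon>. (measure (lborel_on V) (A + (*\<^sub>R) \<epsilon> ` (cball 0 1 \<inter> V))
              - measure (lborel_on V) A) / \<epsilon>)"

definition ball_const :: "nat \<Rightarrow> real" where
  "ball_const n =
     unit_ball_vol (real n) powr ((real n - 1) / real n) / unit_ball_vol (real n - 1)"

end

theory Submission
  imports Defs
begin

text \<open>
  Write \<open>n\<close> for the dimension. By Cauchy's formula for projections, a projection body \<open>L = \<Pi> M\<close> is a
  limit of zonotopes \<open>Z\<close>, sums of segments \<open>[-v/2, v/2]\<close>; the segments come from the gradient of a \<open>C\<^sup>1\<close>
  approximation of the indicator function of \<open>M\<close>. Sweeping a convex body along a segment adds to its
  volume the length of the segment times the volume of a projection. Building up \<open>L\<close> and \<open>L + t B\<close>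
  segment by segment, through the dilates \<open>r L\<close> with \<open>0 < r \<le> 1\<close>, therefore gives
  \<open>|L + t B| - |L| \<ge> t W m / (n - 1)\<close>, where \<open>m\<close> is the least surface area of a projection of \<open>L\<close>
  and \<open>W\<close> the total length of the segments. Finally \<open>W \<ge> n c\<^sub>n |L|\<^bsup>1/n\<^esup>\<close> follows from the
  Brunn--Minkowski inequality, applied to the unit ball and \<open>Z\<close>.

  The same sweeping argument, with the zonoid \<open>B\<close> in place of \<open>L\<close>, shows that \<open>(|K + t B| - |K|) / t\<close>
  is nondecreasing in \<open>t\<close>, so the limits defining the surface areas exist and are infima.
\<close>

section \<open>Lebesgue measure in orthonormal coordinates\<close>

text \<open>In mixed volumes the estimate is short: S(L) = n V(L,...,L,B), and writing one copy of L
  as a sum of segments v turns this into the sum of |v| S(L|v^perp) / (n - 1), which is at least W m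
  / (n - 1). Likewise n V(B,...,B,Z) = W |B_2^(n-1)|, and Minkowski's first inequality bounds W from
  below. Here finite increments |K + A| - |K| take the place of mixed volumes: each segment added to
  K raises the increment by its length times an increment of projected volume. For the dilate r L
  and A = t B the latter is at least r^(n-2) t m, and integrating r^(n-2) over [0,1] produces the
  factor 1/(n - 1). Zonotopes approximate multiplicatively, between (1 - \<eta>) A and (1 + \<eta>)
  A, so that homogeneity turns errors into powers of 1 - \<eta> and 1 + \<eta>. For L this uses a
  ball around the origin inside L, which symmetry provides. Monotonicity of the quotients matters
  twice: it gives \<open>Lim\<close> a meaning, and it lets the surface area of a projection bound
  the increment for every t > 0.\<close>

lemma nn_integral_lborel_translation:
  fixes f :: "'a::euclidean_space \<Rightarrow> ennreal"
  assumes [measurable]: "f \<in> borel_measurable borel"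
  shows "(\<integral>\<^sup>+x. f (x + a) \<partial>lborel) = (\<integral>\<^sup>+x. f x \<partial>lborel)"
proof -
  have "(\<integral>\<^sup>+x. f x \<partial>lborel) = (\<integral>\<^sup>+x. f x \<partial>distr lborel borel ((+) a))"
    by (simp add: lborel_distr_plus)
  also have "\<dots> = (\<integral>\<^sup>+x. f (a + x) \<partial>lborel)"
    by (subst nn_integral_distr) auto
  finally show ?thesis by (simp add: add.commute)
qed

lemma orthogonal_transformation_borel_measurable:
  fixes T :: "'a::euclidean_space \<Rightarrow> 'a"
  assumes "orthogonal_transformation T"
  shows "T \<in> borel_measurable borel"
  using assms by (intro borel_measurable_continuous_onI linear_continuous_on)
    (simp add: orthogonal_transformation_linear linear_conv_bounded_linear[symmetric])

text \<open>Comparing \<open>\<integral>\<integral> f (T x) g y\<close> with \<open>g\<close> the indicator of the unit ball, translation invariance alone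
  shows that the push-forward is a multiple of Lebesgue measure; the ball, being invariant
  under \<open>T\<close>, fixes the constant.\<close>

lemma nn_integral_orthogonal_transformation:
  fixes T :: "'a::euclidean_space \<Rightarrow> 'a"
  assumes T: "orthogonal_transformation T" and [measurable]: "f \<in> borel_measurable borel"
  shows "(\<integral>\<^sup>+x. f (T x) \<partial>lborel) = (\<integral>\<^sup>+x. f x \<partial>lborel)"
proof -
  have [measurable]: "T \<in> borel_measurable borel"
    by (rule orthogonal_transformation_borel_measurable[OF T])
  have lin: "linear T" using T by (rule orthogonal_transformation_linear)
  have nT: "norm (T x) = norm x" for x using T by (simp add: orthogonal_transformation)
  have inv: "\<exists>z. T z = y" for y
    using orthogonal_transformation_surj[OF T] by (metis surjD)
  define g :: "'a \<Rightarrow> ennreal" where "g = indicator (cball 0 1)"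
  have [measurable]: "g \<in> borel_measurable borel" unfolding g_def by (intro borel_measurable_indicator) simp
  have g: "g x = g y" if "norm x = norm y" for x y
    using that by (simp add: g_def indicator_def)
  have gint: "(\<integral>\<^sup>+x. g x \<partial>lborel) = emeasure lborel (cball 0 1 :: 'a set)"
    by (simp add: g_def)
  have fin: "(\<integral>\<^sup>+x. g x \<partial>lborel) \<noteq> \<infinity>" "(\<integral>\<^sup>+x. g x \<partial>lborel) \<noteq> 0"
    unfolding gint using emeasure_lborel_cball_finite[of 0 1]
    using unit_ball_vol_pos[of "real DIM('a)"] by (auto simp: emeasure_cball less_top[symmetric] simp del: unit_ball_vol_pos)
  have "(\<integral>\<^sup>+x. f (T x) \<partial>lborel) * (\<integral>\<^sup>+y. g y \<partial>lborel) =
        (\<integral>\<^sup>+y. (\<integral>\<^sup>+x. f (T x) * g y \<partial>lborel) \<partial>lborel)"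
    by (simp add: nn_integral_multc nn_integral_cmult)
  also have "\<dots> = (\<integral>\<^sup>+y. (\<integral>\<^sup>+x. f (T x + y) * g y \<partial>lborel) \<partial>lborel)"
  proof (rule nn_integral_cong)
    fix y
    obtain z where z: "T z = y" using inv by blast
    have "(\<integral>\<^sup>+x. f (T x) * g y \<partial>lborel) = (\<integral>\<^sup>+x. f (T (x + z)) * g y \<partial>lborel)"
      by (rule nn_integral_lborel_translation[symmetric]) measurable
    then show "(\<integral>\<^sup>+x. f (T x) * g y \<partial>lborel) = (\<integral>\<^sup>+x. f (T x + y) * g y \<partial>lborel)"
      by (simp add: linear_add[OF lin] z)
  qed
  also have "\<dots> = (\<integral>\<^sup>+x. (\<integral>\<^sup>+y. f (T x + y) * g y \<partial>lborel) \<partial>lborel)"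
    by (rule lborel_pair.Fubini') measurable
  also have "\<dots> = (\<integral>\<^sup>+x. (\<integral>\<^sup>+y. f y * g (y - T x) \<partial>lborel) \<partial>lborel)"
  proof (rule nn_integral_cong)
    fix x
    show "(\<integral>\<^sup>+y. f (T x + y) * g y \<partial>lborel) = (\<integral>\<^sup>+y. f y * g (y - T x) \<partial>lborel)"
      using nn_integral_lborel_translation[of "\<lambda>y. f y * g (y - T x)" "T x"]
      by (simp add: add.commute)
  qed
  also have "\<dots> = (\<integral>\<^sup>+y. (\<integral>\<^sup>+x. f y * g (y - T x) \<partial>lborel) \<partial>lborel)"
    by (rule lborel_pair.Fubini') measurable
  also have "\<dots> = (\<integral>\<^sup>+y. f y * (\<integral>\<^sup>+x. g x \<partial>lborel) \<partial>lborel)"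
  proof (rule nn_integral_cong)
    fix y
    obtain z where z: "T z = y" using inv by blast
    have "(\<integral>\<^sup>+x. g (y - T x) \<partial>lborel) = (\<integral>\<^sup>+x. g (x + - z) \<partial>lborel)"
      by (intro nn_integral_cong g)
         (metis z nT linear_diff[OF lin] norm_minus_commute diff_conv_add_uminus)
    also have "\<dots> = (\<integral>\<^sup>+x. g x \<partial>lborel)"
      by (rule nn_integral_lborel_translation) measurable
    finally show "(\<integral>\<^sup>+x. f y * g (y - T x) \<partial>lborel) = f y * (\<integral>\<^sup>+x. g x \<partial>lborel)"
      by (subst nn_integral_cmult) auto
  qed
  also have "\<dots> = (\<integral>\<^sup>+y. f y \<partial>lborel) * (\<integral>\<^sup>+x. g x \<partial>lborel)"
    by (simp add: nn_integral_multc)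
  finally have "(\<integral>\<^sup>+y. g y \<partial>lborel) * (\<integral>\<^sup>+x. f (T x) \<partial>lborel) = (\<integral>\<^sup>+y. g y \<partial>lborel) * (\<integral>\<^sup>+x. f x \<partial>lborel)"
    by (simp add: mult.commute)
  then show ?thesis using fin by (simp add: ennreal_mult_cancel_left)
qed

lemma orthonormal_basis_of_props:
  assumes "orthonormal_basis_of V B"
  shows "finite B" "card B = dim V" "\<And>b. b \<in> B \<Longrightarrow> norm b = 1" "independent B"
    "span B = V" "\<And>b c. b \<in> B \<Longrightarrow> c \<in> B \<Longrightarrow> b \<noteq> c \<Longrightarrow> b \<bullet> c = 0"
  using assms independent_imp_finite dim_span_eq_card_independent[of B]
  by (auto simp: orthonormal_basis_of_def pairwise_def orthogonal_def)

lemma norm_orthonormal_sum: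
  assumes "orthonormal_basis_of V B"
  shows "(norm (\<Sum>b\<in>B. f b *\<^sub>R b))\<^sup>2 = (\<Sum>b\<in>B. (f b)\<^sup>2)"
proof -
  note B = orthonormal_basis_of_props[OF assms]
  have "(norm (\<Sum>b\<in>B. f b *\<^sub>R b))\<^sup>2 = (\<Sum>b\<in>B. (norm (f b *\<^sub>R b))\<^sup>2)"
    by (rule norm_sum_Pythagorean[OF B(1)]) (use B(6) in \<open>auto simp: pairwise_def orthogonal_def\<close>)
  also have "\<dots> = (\<Sum>b\<in>B. (f b)\<^sup>2)" using B(3) by (intro sum.cong) auto
  finally show ?thesis .
qed

text \<open>A bijection \<open>\<sigma>\<close> from \<open>C\<close> to \<open>Basis\<close>
  defines the isometry \<open>T\<close> that carries \<open>\<sigma> c\<close> to \<open>c\<close>,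
  and \<open>lborel\<close> is invariant under it. \<open>T\<close> factors through the coordinate
  map \<open>R\<close>, which pushes \<open>lborel\<close> to the product measure; this is checked
  on boxes.\<close>

lemma lborel_eq_distr_orthonormal:
  fixes C :: "'a::euclidean_space set"
  assumes C: "orthonormal_basis_of UNIV C"
  shows "lborel = distr (\<Pi>\<^sub>M c\<in>C. lborel) borel (\<lambda>f. \<Sum>c\<in>C. f c *\<^sub>R c)"
proof -
  note Cp = orthonormal_basis_of_props[OF C]
  have "card C = card (Basis :: 'a set)" using Cp(2) by simp
  then obtain \<sigma> where \<sigma>: "bij_betw \<sigma> C (Basis :: 'a set)"
    using finite_same_card_bij[OF Cp(1) finite_Basis] by blast
  define T where "T = (\<lambda>x. \<Sum>c\<in>C. (x \<bullet> \<sigma> c) *\<^sub>R c)"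
  have "linear T" unfolding T_def
    by (intro linear_compose_sum ballI) (auto intro!: linearI simp: inner_left_distrib algebra_simps)
  moreover have "norm (T x) = norm x" for x
  proof -
    have "(norm (T x))\<^sup>2 = (\<Sum>c\<in>C. (x \<bullet> \<sigma> c)\<^sup>2)"
      unfolding T_def by (rule norm_orthonormal_sum[OF C])
    also have "\<dots> = (\<Sum>b\<in>Basis. (x \<bullet> b)\<^sup>2)"
      by (rule sum.reindex_bij_betw[OF \<sigma>])
    also have "\<dots> = (norm x)\<^sup>2"
      by (simp add: power2_norm_eq_inner euclidean_inner[of x x]) (simp add: power2_eq_square)
    finally show ?thesis by simp
  qed
  ultimately have T: "orthogonal_transformation T" by (simp add: orthogonal_transformation)
  have Tm[measurable]: "T \<in> borel_measurable borel"
    by (rule orthogonal_transformation_borel_measurable[OF T])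
  define R where "R = (\<lambda>x. \<lambda>c\<in>C. x \<bullet> \<sigma> c)"
  have Rm[measurable]: "R \<in> measurable borel (\<Pi>\<^sub>M c\<in>C. lborel)"
    unfolding R_def by measurable
  interpret product_sigma_finite "\<lambda>c::'a. lborel :: real measure" by standard
  have PR: "(\<Pi>\<^sub>M c\<in>C. lborel) = distr lborel (\<Pi>\<^sub>M c\<in>C. lborel) R"
  proof (rule PiM_eqI[OF Cp(1), symmetric])
    fix A :: "'a \<Rightarrow> real set" assume A: "\<And>i. i \<in> C \<Longrightarrow> A i \<in> sets lborel"
    define \<tau> where "\<tau> = the_inv_into C \<sigma>"
    have \<tau>: "\<tau> (\<sigma> c) = c" if "c \<in> C" for c
      unfolding \<tau>_def using \<sigma> that by (simp add: bij_betw_def the_inv_into_f_f)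
    have \<tau>C: "\<tau> b \<in> C" if "b \<in> Basis" for b
      unfolding \<tau>_def using \<sigma> that by (metis bij_betw_def the_inv_into_into subset_refl)
    have PA: "(Pi\<^sub>E C A) \<in> sets (\<Pi>\<^sub>M c\<in>C. lborel)" using A Cp(1) by (intro sets_PiM_I_finite)
    have "emeasure (distr lborel (\<Pi>\<^sub>M c\<in>C. lborel) R) (Pi\<^sub>E C A) = (\<integral>\<^sup>+x. indicator (Pi\<^sub>E C A) (R x) \<partial>lborel)"
      using PA Rm nn_integral_distr[of R lborel "\<Pi>\<^sub>M c\<in>C. lborel" "indicator (Pi\<^sub>E C A)"] by simp
    also have "\<dots> = (\<integral>\<^sup>+x. (\<Prod>b\<in>Basis. indicator (A (\<tau> b)) (x \<bullet> b)) \<partial>lborel)"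
    proof (rule nn_integral_cong)
      fix x :: 'a
      have "(\<Prod>b\<in>Basis. indicator (A (\<tau> b)) (x \<bullet> b)) = (\<Prod>c\<in>C. indicator (A c) (x \<bullet> \<sigma> c) :: ennreal)"
        by (subst prod.reindex_bij_betw[OF \<sigma>, symmetric]) (simp add: \<tau> cong: prod.cong)
      also have "\<dots> = indicator (Pi\<^sub>E C A) (R x)"
        using Cp(1) by (auto simp: R_def indicator_def PiE_def Pi_def)
      finally show "indicator (Pi\<^sub>E C A) (R x) = (\<Prod>b\<in>Basis. indicator (A (\<tau> b)) (x \<bullet> b) :: ennreal)" by simp
    qed
    also have "\<dots> = (\<Prod>b\<in>Basis. (\<integral>\<^sup>+x. indicator (A (\<tau> b)) x \<partial>lborel))"
      using A \<tau>C by (intro nn_integral_lborel_prod) (auto intro!: borel_measurable_indicator)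
    also have "\<dots> = (\<Prod>b\<in>Basis. emeasure lborel (A (\<tau> b)))"
      using A \<tau>C by (intro prod.cong) auto
    also have "\<dots> = (\<Prod>c\<in>C. emeasure lborel (A c))"
      by (subst prod.reindex_bij_betw[OF \<sigma>, symmetric]) (simp add: \<tau> cong: prod.cong)
    finally show "emeasure (distr lborel (\<Pi>\<^sub>M c\<in>C. lborel) R) (Pi\<^sub>E C A) = (\<Prod>c\<in>C. emeasure lborel (A c))" .
  qed simp
  have "lborel = distr lborel borel T"
  proof (rule measure_eqI)
    fix A :: "'a set" assume "A \<in> sets lborel"
    then have [measurable]: "A \<in> sets borel" by simp
    have "emeasure (distr lborel borel T) A = (\<integral>\<^sup>+x. indicator A (T x) \<partial>lborel)"
      using nn_integral_distr[of T lborel borel "indicator A"] by simp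
    also have "\<dots> = emeasure lborel A"
      using nn_integral_orthogonal_transformation[OF T, of "indicator A"] by simp
    finally show "emeasure lborel A = emeasure (distr lborel borel T) A" by simp
  qed simp
  also have "\<dots> = distr (distr lborel (\<Pi>\<^sub>M c\<in>C. lborel) R) borel (\<lambda>f. \<Sum>c\<in>C. f c *\<^sub>R c)"
    by (subst distr_distr) (auto simp: T_def R_def comp_def intro!: distr_cong sum.cong)
  finally show ?thesis unfolding PR[symmetric] .
qed

section \<open>Fubini's theorem for a hyperplane and its normal\<close>

lemma mem_orthogonal_comp_singleton: "x \<in> {\<xi>}\<^sup>\<bottom> \<longleftrightarrow> x \<bullet> \<xi> = 0"
  by (simp add: orthogonal_comp_def orthogonal_def inner_commute)

lemma dim_orthogonal_comp_singleton:
  fixes \<xi> :: "'a::euclidean_space"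
  assumes "norm \<xi> = 1"
  shows "dim ({\<xi>}\<^sup>\<bottom>) = DIM('a) - 1"
proof -
  have "{\<xi>}\<^sup>\<bottom> = {x. \<xi> \<bullet> x = 0}" by (auto simp: mem_orthogonal_comp_singleton inner_commute)
  then show ?thesis using dim_hyperplane[of \<xi>] assms by force
qed

lemma sets_lborel_on [measurable_cong, simp]: "sets (lborel_on V) = sets borel"
  by (simp add: lborel_on_def Let_def)

lemma space_lborel_on [simp]: "space (lborel_on V) = UNIV"
  by (simp add: lborel_on_def Let_def)

lemma AE_lborel_on:
  fixes V :: "'a::euclidean_space set"
  assumes "subspace V"
  shows "AE x in lborel_on V. x \<in> V"
proof -
  note B = orthonormal_basis_of_props[OF orthonormal_basis_of_some[OF assms]]
  have [measurable]: "V \<in> sets borel" using assms by (intro borel_closed closed_subspace)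
  show ?thesis unfolding lborel_on_def Let_def
  proof (subst AE_distr_iff)
    show "AE x in \<Pi>\<^sub>M b\<in>(SOME B. orthonormal_basis_of V B). lborel.
      (\<Sum>b\<in>(SOME B. orthonormal_basis_of V B). x b *\<^sub>R b) \<in> V"
      by (rule AE_I2, subst (2) B(5)[symmetric]) (intro span_sum span_mul span_base)
  qed (use \<open>V \<in> sets borel\<close> in auto)
qed

text \<open>Adjoining \<open>\<xi>\<close> to the orthonormal basis that \<open>lborel_on\<close>
  selects for the hyperplane gives an orthonormal basis of the whole space, and the product measure
  splits off the coordinate along \<open>\<xi>\<close>. This is the link between
  \<open>lborel_on\<close> and volume.\<close>

lemma nn_integral_lborel_hyperplane:
  fixes \<xi> :: "'a::euclidean_space" and f :: "'a \<Rightarrow> ennreal"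
  assumes \<xi>: "norm \<xi> = 1" and [measurable]: "f \<in> borel_measurable borel"
  shows "(\<integral>\<^sup>+x. f x \<partial>lborel) = (\<integral>\<^sup>+w. (\<integral>\<^sup>+y. f (w + y *\<^sub>R \<xi>) \<partial>lborel) \<partial>lborel_on ({\<xi>}\<^sup>\<bottom>))"
proof -
  define B where "B = (SOME B. orthonormal_basis_of ({\<xi>}\<^sup>\<bottom>) B)"
  have ob: "orthonormal_basis_of ({\<xi>}\<^sup>\<bottom>) B"
    unfolding B_def by (intro orthonormal_basis_of_some subspace_orthogonal_comp)
  note B = orthonormal_basis_of_props[OF ob]
  have orth: "b \<bullet> \<xi> = 0" if "b \<in> B" for b
    using span_base[OF that] B(5) by (simp add: mem_orthogonal_comp_singleton)
  then have notin: "\<xi> \<notin> B" using \<xi> by (force simp: norm_eq_1)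
  have po: "pairwise orthogonal (insert \<xi> B)"
    using B(6) orth by (auto simp: pairwise_def orthogonal_def inner_commute)
  have "0 \<notin> insert \<xi> B" using \<xi> B(3) by fastforce
  then have ind: "independent (insert \<xi> B)" using po pairwise_orthogonal_independent by blast
  have "DIM('a) \<ge> 1" by simp
  then have "card (insert \<xi> B) = DIM('a)"
    using B(1,2) notin dim_orthogonal_comp_singleton[OF \<xi>] by simp
  then have "span (insert \<xi> B) = UNIV"
    using ind card_eq_dim[of "insert \<xi> B" UNIV] B(1) by auto
  then have C: "orthonormal_basis_of UNIV (insert \<xi> B)"
    using po ind \<xi> B(3) by (auto simp: orthonormal_basis_of_def)
  interpret product_sigma_finite "\<lambda>c::'a. lborel :: real measure" by standard
  have "(\<integral>\<^sup>+x. f x \<partial>lborel) = (\<integral>\<^sup>+x. f (\<Sum>c\<in>insert \<xi> B. x c *\<^sub>R c) \<partial>(\<Pi>\<^sub>M c\<in>insert \<xi> B. lborel))"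
    by (subst lborel_eq_distr_orthonormal[OF C], subst nn_integral_distr) auto
  also have "\<dots> = (\<integral>\<^sup>+x. (\<integral>\<^sup>+y. f (\<Sum>c\<in>insert \<xi> B. (x(\<xi> := y)) c *\<^sub>R c) \<partial>lborel) \<partial>(\<Pi>\<^sub>M c\<in>B. lborel))"
    by (rule product_nn_integral_insert[OF B(1) notin]) measurable
  also have "\<dots> = (\<integral>\<^sup>+x. (\<integral>\<^sup>+y. f ((\<Sum>c\<in>B. x c *\<^sub>R c) + y *\<^sub>R \<xi>) \<partial>lborel) \<partial>(\<Pi>\<^sub>M c\<in>B. lborel))"
  proof -
    have "(\<Sum>c\<in>insert \<xi> B. (x(\<xi> := y)) c *\<^sub>R c) = (\<Sum>c\<in>B. x c *\<^sub>R c) + y *\<^sub>R \<xi>" for x y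
    proof -
      have "(\<Sum>c\<in>B. (x(\<xi> := y)) c *\<^sub>R c) = (\<Sum>c\<in>B. x c *\<^sub>R c)"
        using notin by (intro sum.cong) auto
      then show ?thesis using B(1) notin by (simp add: add.commute)
    qed
    then show ?thesis by simp
  qed
  also have "\<dots> = (\<integral>\<^sup>+w. (\<integral>\<^sup>+y. f (w + y *\<^sub>R \<xi>) \<partial>lborel) \<partial>lborel_on ({\<xi>}\<^sup>\<bottom>))"
    unfolding lborel_on_def Let_def B_def[symmetric]
    by (subst nn_integral_distr) auto
  finally show ?thesis .
qed

section \<open>Projections and sweeping by segments\<close>

abbreviation shadow :: "'a::euclidean_space \<Rightarrow> 'a set \<Rightarrow> real" where
  "shadow \<xi> K \<equiv> measure (lborel_on ({\<xi>}\<^sup>\<bottom>)) (hyperplane_proj K \<xi>)"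

text \<open>Centred at the origin, so that its support function is half of |v . x|. The half matches
  Cauchy's formula, where a projected volume is half of an integral of |G . \<theta>|.\<close>

abbreviation central_segment :: "'a::real_vector \<Rightarrow> 'a set" where
  "central_segment v \<equiv> closed_segment (- (v /\<^sub>R 2)) (v /\<^sub>R 2)"

lemma compact_set_plus:
  fixes A B :: "'a::real_normed_vector set"
  assumes "compact A" "compact B"
  shows "compact (A + B)"
proof -
  have "A + B = (\<lambda>z. fst z + snd z) ` (A \<times> B)" by (force simp: set_plus_def)
  then show ?thesis
    using assms by (auto intro!: compact_continuous_image continuous_intros compact_Times)
qed

lemma image_set_plus_linear: "linear f \<Longrightarrow> f ` (A + B) = f ` A + f ` B"
  by (force simp: set_plus_def linear_add)

lemma linear_hyperplane_proj: "linear (\<lambda>x. x - (x \<bullet> \<xi>) *\<^sub>R \<xi>)"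
  by (rule linearI) (auto simp: algebra_simps)

lemma compact_hyperplane_proj: "compact K \<Longrightarrow> compact (hyperplane_proj K \<xi>)"
  unfolding hyperplane_proj_def by (intro compact_continuous_image continuous_intros)

lemma convex_hyperplane_proj: "convex K \<Longrightarrow> convex (hyperplane_proj K \<xi>)"
  unfolding hyperplane_proj_def by (intro convex_linear_image linear_hyperplane_proj)

lemma hyperplane_proj_subset: "norm \<xi> = 1 \<Longrightarrow> hyperplane_proj K \<xi> \<subseteq> {\<xi>}\<^sup>\<bottom>"
  by (auto simp: hyperplane_proj_def mem_orthogonal_comp_singleton inner_diff_left norm_eq_1)

lemma mem_hyperplane_proj_iff:
  assumes "norm \<xi> = 1" "w \<bullet> \<xi> = 0"
  shows "w \<in> hyperplane_proj K \<xi> \<longleftrightarrow> (\<exists>y. w + y *\<^sub>R \<xi> \<in> K)"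
proof
  assume "w \<in> hyperplane_proj K \<xi>"
  then obtain x where "x \<in> K" "w = x - (x \<bullet> \<xi>) *\<^sub>R \<xi>" by (auto simp: hyperplane_proj_def)
  then have "w + (x \<bullet> \<xi>) *\<^sub>R \<xi> \<in> K" by simp
  then show "\<exists>y. w + y *\<^sub>R \<xi> \<in> K" by blast
next
  assume "\<exists>y. w + y *\<^sub>R \<xi> \<in> K"
  then obtain y where y: "w + y *\<^sub>R \<xi> \<in> K" ..
  have "(w + y *\<^sub>R \<xi>) \<bullet> \<xi> = y" using assms by (simp add: inner_add_left norm_eq_1)
  then have "w = (w + y *\<^sub>R \<xi>) - ((w + y *\<^sub>R \<xi>) \<bullet> \<xi>) *\<^sub>R \<xi>" by simp
  then show "w \<in> hyperplane_proj K \<xi>" unfolding hyperplane_proj_def using y by blast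
qed

lemma emeasure_lborel_compact:
  assumes "compact (A :: 'a::euclidean_space set)"
  shows "emeasure lborel A = ennreal (measure lebesgue A)"
proof -
  have "A \<in> sets lborel" using assms by (simp add: borel_compact)
  moreover have "emeasure lborel A < \<infinity>" using assms by (rule emeasure_compact_finite)
  ultimately show ?thesis
    by (simp add: emeasure_eq_ennreal_measure measure_completion top.not_eq_extremum)
qed

lemma measure_compact_mono:
  assumes "compact A" "compact B" "A \<subseteq> (B :: 'a::euclidean_space set)"
  shows "measure lebesgue A \<le> measure lebesgue B"
  using assms by (intro measure_mono_fmeasurable lmeasurable_compact fmeasurableD) auto

lemma measure_lebesgue_scaleR_image:
  fixes S :: "'a::euclidean_space set"
  assumes "0 \<le> m"
  shows "measure lebesgue ((*\<^sub>R) m ` S) = m ^ DIM('a) * measure lebesgue S"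
  using measure_lebesgue_affine[of m 0 S] assms by (simp add: image_image)

text \<open>The prism of height 1 over \<open>A\<close> has the same volume as \<open>A\<close> in
  one dimension less. Through this prism, statements about volumes of sums in the whole space also
  apply to projections.\<close>

lemma emeasure_lborel_on_hyperplane:
  fixes \<xi> :: "'a::euclidean_space"
  assumes \<xi>: "norm \<xi> = 1" and A: "compact A" "A \<subseteq> {\<xi>}\<^sup>\<bottom>"
  shows "emeasure (lborel_on ({\<xi>}\<^sup>\<bottom>)) A = ennreal (measure lebesgue (A + closed_segment 0 \<xi>))"
proof -
  have c: "compact (A + closed_segment 0 \<xi>)" using A by (intro compact_set_plus) auto
  then have cb: "A + closed_segment 0 \<xi> \<in> sets borel" by (rule borel_compact)
  have Ab: "A \<in> sets borel" using A(1) by (rule borel_compact)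
  have "emeasure lborel (A + closed_segment 0 \<xi>) = (\<integral>\<^sup>+w. (\<integral>\<^sup>+y. indicator (A + closed_segment 0 \<xi>) (w + y *\<^sub>R \<xi>) \<partial>lborel) \<partial>lborel_on ({\<xi>}\<^sup>\<bottom>))"
    using cb nn_integral_lborel_hyperplane[OF \<xi>, of "indicator (A + closed_segment 0 \<xi>)"]
    by simp
  also have "\<dots> = (\<integral>\<^sup>+w. indicator A w \<partial>lborel_on ({\<xi>}\<^sup>\<bottom>))"
  proof (rule nn_integral_cong_AE, use AE_lborel_on[OF subspace_orthogonal_comp[of "{\<xi>}"]] in eventually_elim)
    fix w assume "w \<in> {\<xi>}\<^sup>\<bottom>"
    then have w: "w \<bullet> \<xi> = 0" by (simp add: mem_orthogonal_comp_singleton)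
    have "w + y *\<^sub>R \<xi> \<in> A + closed_segment 0 \<xi> \<longleftrightarrow> w \<in> A \<and> y \<in> {0..1}" for y
    proof
      assume "w + y *\<^sub>R \<xi> \<in> A + closed_segment 0 \<xi>"
      then obtain a u where au: "a \<in> A" "0 \<le> u" "u \<le> 1" "w + y *\<^sub>R \<xi> = a + u *\<^sub>R \<xi>"
        by (auto simp: set_plus_def closed_segment_def)
      have "a \<bullet> \<xi> = 0" using au(1) A(2) by (auto simp: mem_orthogonal_comp_singleton)
      moreover have "(w + y *\<^sub>R \<xi>) \<bullet> \<xi> = (a + u *\<^sub>R \<xi>) \<bullet> \<xi>" using au(4) by simp
      ultimately have "y = u" using w \<xi> by (auto simp: inner_add_left norm_eq_1)
      then show "w \<in> A \<and> y \<in> {0..1}" using au by simp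
    next
      assume "w \<in> A \<and> y \<in> {0..1}"
      then show "w + y *\<^sub>R \<xi> \<in> A + closed_segment 0 \<xi>"
        by (auto simp: closed_segment_def intro!: set_plus_intro)
    qed
    then have "(\<integral>\<^sup>+y. indicator (A + closed_segment 0 \<xi>) (w + y *\<^sub>R \<xi>) \<partial>lborel) =
      (\<integral>\<^sup>+y. indicator A w * indicator {0..1::real} y \<partial>lborel)"
      by (intro nn_integral_cong) (auto simp: indicator_def)
    also have "\<dots> = indicator A w" by (subst nn_integral_cmult_indicator) auto
    finally show "(\<integral>\<^sup>+y. indicator (A + closed_segment 0 \<xi>) (w + y *\<^sub>R \<xi>) \<partial>lborel) = (indicator A w :: ennreal)" .
  qed
  also have "\<dots> = emeasure (lborel_on ({\<xi>}\<^sup>\<bottom>)) A" using Ab by simp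
  finally show ?thesis using emeasure_lborel_compact[OF c] by simp
qed

lemma emeasure_hyperplane_proj:
  fixes \<xi> :: "'a::euclidean_space"
  assumes "norm \<xi> = 1" "compact K"
  shows "emeasure (lborel_on ({\<xi>}\<^sup>\<bottom>)) (hyperplane_proj K \<xi>) = ennreal (shadow \<xi> K)"
  using emeasure_lborel_on_hyperplane[OF assms(1) compact_hyperplane_proj[OF assms(2)] hyperplane_proj_subset[OF assms(1)]]
  by (simp add: measure_def)

lemma shadow_eq_vol:
  fixes \<xi> :: "'a::euclidean_space"
  assumes "norm \<xi> = 1" "compact K"
  shows "shadow \<xi> K = measure lebesgue (hyperplane_proj K \<xi> + closed_segment 0 \<xi>)"
  using emeasure_lborel_on_hyperplane[OF assms(1) compact_hyperplane_proj[OF assms(2)] hyperplane_proj_subset[OF assms(1)]]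
  by (simp add: measure_def)

lemma hyperplane_proj_mono: "K \<subseteq> K' \<Longrightarrow> hyperplane_proj K \<xi> \<subseteq> hyperplane_proj K' \<xi>"
  by (auto simp: hyperplane_proj_def)

lemma shadow_mono:
  fixes \<xi> :: "'a::euclidean_space"
  assumes "norm \<xi> = 1" "compact K" "compact K'" "K \<subseteq> K'"
  shows "shadow \<xi> K \<le> shadow \<xi> K'"
  unfolding shadow_eq_vol[OF assms(1,2)] shadow_eq_vol[OF assms(1,3)]
  using assms hyperplane_proj_mono[OF assms(4), of \<xi>]
  by (intro measure_compact_mono compact_set_plus compact_hyperplane_proj set_plus_mono2) auto

section \<open>Volume gained by sweeping along a segment\<close>

lemma compact_convex_real_cases:
  fixes S :: "real set"
  assumes "compact S" "convex S"
  obtains "S = {}" | a b where "a \<le> b" "S = {a..b}"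
proof (cases "S = {}")
  case False
  then obtain a b where "S = {a..b}"
    using assms connected_compact_interval_1[of S] by (auto simp: convex_connected cbox_interval)
  then show ?thesis using False that by force
qed

text \<open>A line parallel to \<open>\<xi>\<close> that meets \<open>K\<close> does so in a compact
  interval, by convexity, and the sum lengthens this interval by exactly \<open>t\<close>; a line
  that misses \<open>K\<close> misses the sum as well. Integration over the hyperplane gives the
  formula.\<close>

lemma vol_add_closed_segment:
  fixes \<xi> :: "'a::euclidean_space"
  assumes \<xi>: "norm \<xi> = 1" and K: "compact K" "convex K" and t: "0 \<le> t"
  shows "measure lebesgue (K + closed_segment 0 (t *\<^sub>R \<xi>)) = measure lebesgue K + t * shadow \<xi> K"
proof -
  let ?S = "K + closed_segment 0 (t *\<^sub>R \<xi>)"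
  have c: "compact ?S" using K by (intro compact_set_plus) auto
  have [measurable]: "?S \<in> sets borel" "K \<in> sets borel" "hyperplane_proj K \<xi> \<in> sets borel"
    using c K compact_hyperplane_proj[of K \<xi>] by (auto intro: borel_compact)
  have "emeasure lborel ?S = (\<integral>\<^sup>+w. (\<integral>\<^sup>+y. indicator ?S (w + y *\<^sub>R \<xi>) \<partial>lborel) \<partial>lborel_on ({\<xi>}\<^sup>\<bottom>))"
    using nn_integral_lborel_hyperplane[OF \<xi>, of "indicator ?S"] by simp
  also have "\<dots> = (\<integral>\<^sup>+w. (\<integral>\<^sup>+y. indicator K (w + y *\<^sub>R \<xi>) \<partial>lborel) + ennreal t * indicator (hyperplane_proj K \<xi>) w \<partial>lborel_on ({\<xi>}\<^sup>\<bottom>))"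
  proof (rule nn_integral_cong_AE, use AE_lborel_on[OF subspace_orthogonal_comp[of "{\<xi>}"]] in eventually_elim)
    fix w assume "w \<in> {\<xi>}\<^sup>\<bottom>"
    then have w: "w \<bullet> \<xi> = 0" by (simp add: mem_orthogonal_comp_singleton)
    define Y where "Y = {y. w + y *\<^sub>R \<xi> \<in> K}"
    have Yv: "Y = (\<lambda>y. w + y *\<^sub>R \<xi>) -` K" by (auto simp: Y_def)
    have "closed Y" unfolding Yv
      using K by (intro continuous_closed_vimage compact_imp_closed continuous_intros) auto
    moreover have "bounded Y"
    proof -
      obtain b where b: "\<And>x. x \<in> K \<Longrightarrow> norm x \<le> b"
        using compact_imp_bounded[OF K(1)] by (auto simp: bounded_iff)
      have "\<bar>y\<bar> \<le> b" if "y \<in> Y" for y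
      proof -
        have "y = (w + y *\<^sub>R \<xi>) \<bullet> \<xi>" using w \<xi> by (simp add: inner_add_left norm_eq_1)
        then have "\<bar>y\<bar> \<le> norm (w + y *\<^sub>R \<xi>)" using Cauchy_Schwarz_ineq2[of "w + y *\<^sub>R \<xi>" \<xi>] \<xi> by simp
        then show ?thesis using b that by (fastforce simp: Y_def)
      qed
      then show ?thesis by (auto simp: bounded_iff)
    qed
    ultimately have cY: "compact Y" by (simp add: compact_eq_bounded_closed)
    have vY: "convex Y"
    proof (rule convexI)
      fix x y u v :: real assume *: "x \<in> Y" "y \<in> Y" "0 \<le> u" "0 \<le> v" "u + v = 1"
      have "u *\<^sub>R (w + x *\<^sub>R \<xi>) + v *\<^sub>R (w + y *\<^sub>R \<xi>) \<in> K"
        using * K(2) by (intro convexD) (auto simp: Y_def)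
      also have "u *\<^sub>R (w + x *\<^sub>R \<xi>) + v *\<^sub>R (w + y *\<^sub>R \<xi>) = (u + v) *\<^sub>R w + (u * x + v * y) *\<^sub>R \<xi>"
        by (simp add: algebra_simps)
      finally show "u *\<^sub>R x + v *\<^sub>R y \<in> Y" using * by (simp add: Y_def)
    qed
    have mem: "w + y *\<^sub>R \<xi> \<in> ?S \<longleftrightarrow> (\<exists>s\<in>{0..t}. y - s \<in> Y)" for y
    proof
      assume "w + y *\<^sub>R \<xi> \<in> ?S"
      then obtain a u where au: "a \<in> K" "0 \<le> u" "u \<le> 1" "w + y *\<^sub>R \<xi> = a + (u * t) *\<^sub>R \<xi>"
        by (auto simp: set_plus_def closed_segment_def)
      then have "w + (y - u * t) *\<^sub>R \<xi> = a" by (simp add: algebra_simps)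
      then show "\<exists>s\<in>{0..t}. y - s \<in> Y" using au t
        by (intro bexI[of _ "u * t"]) (auto simp: Y_def mult_left_le_one_le)
    next
      assume "\<exists>s\<in>{0..t}. y - s \<in> Y"
      then obtain s where s: "0 \<le> s" "s \<le> t" "w + (y - s) *\<^sub>R \<xi> \<in> K" by (auto simp: Y_def)
      have "s *\<^sub>R \<xi> \<in> closed_segment 0 (t *\<^sub>R \<xi>)"
      proof (cases "t = 0")
        case False
        then show ?thesis using s t
          by (auto simp: closed_segment_def intro!: exI[of _ "s / t"])
      qed (use s in auto)
      then have "(w + (y - s) *\<^sub>R \<xi>) + s *\<^sub>R \<xi> \<in> ?S" using s by (intro set_plus_intro)
      then show "w + y *\<^sub>R \<xi> \<in> ?S" by (simp add: algebra_simps)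
    qed
    have ind: "(\<lambda>y. indicator K (w + y *\<^sub>R \<xi>)) = (indicator Y :: real \<Rightarrow> ennreal)"
      by (auto simp: Y_def indicator_def)
    have "(\<integral>\<^sup>+y. indicator ?S (w + y *\<^sub>R \<xi>) \<partial>lborel) =
      (\<integral>\<^sup>+y. indicator {y. \<exists>s\<in>{0..t}. y - s \<in> Y} y \<partial>lborel)"
      by (intro nn_integral_cong) (use mem in \<open>auto simp: indicator_def\<close>)
    also have "\<dots> = (\<integral>\<^sup>+y. indicator Y y \<partial>lborel) + ennreal t * indicator (hyperplane_proj K \<xi>) w"
      using cY vY
    proof (cases rule: compact_convex_real_cases)
      case 1
      then have "w \<notin> hyperplane_proj K \<xi>" using mem_hyperplane_proj_iff[OF \<xi> w] by (auto simp: Y_def)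
      then show ?thesis using 1 by simp
    next
      case (2 a b)
      then have "w \<in> hyperplane_proj K \<xi>" using mem_hyperplane_proj_iff[OF \<xi> w] by (force simp: Y_def)
      moreover have "{y. \<exists>s\<in>{0..t}. y - s \<in> Y} = {a..b + t}"
      proof safe
        fix y assume "y \<in> {a..b + t}"
        then show "\<exists>s\<in>{0..t}. y - s \<in> Y" using 2 t
          \<comment> \<open>Shift back by the overshoot of \<open>y\<close> beyond \<open>b\<close>,
            and not at all if there is none.\<close>
          by (intro bexI[of _ "max 0 (y - b)"]) auto
      qed (use 2 in auto)
      ultimately show ?thesis using 2 t by (simp add: ennreal_plus[symmetric] del: ennreal_plus)
    qed
    finally show "(\<integral>\<^sup>+y. indicator ?S (w + y *\<^sub>R \<xi>) \<partial>lborel) =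
      (\<integral>\<^sup>+y. indicator K (w + y *\<^sub>R \<xi>) \<partial>lborel) + ennreal t * indicator (hyperplane_proj K \<xi>) w"
      unfolding ind .
  qed
  also have "\<dots> = emeasure lborel K + ennreal t * emeasure (lborel_on ({\<xi>}\<^sup>\<bottom>)) (hyperplane_proj K \<xi>)"
    using nn_integral_lborel_hyperplane[OF \<xi>, of "indicator K"]
    by (subst nn_integral_add) (auto simp: nn_integral_cmult)
  finally have "ennreal (measure lebesgue ?S) = ennreal (measure lebesgue K) + ennreal t * ennreal (shadow \<xi> K)"
    using emeasure_lborel_compact[OF c] emeasure_lborel_compact[OF K(1)] emeasure_hyperplane_proj[OF \<xi> K(1)]
    by simp
  then show ?thesis using t
    by (simp add: ennreal_mult[symmetric] ennreal_plus[symmetric] del: ennreal_plus)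
qed

lemma vol_set_plus_singleton: "measure lebesgue (K + {a}) = measure lebesgue (K :: 'a::euclidean_space set)"
proof -
  have "K + {a} = (+) a ` K" by (auto simp: set_plus_def)
  then show ?thesis using measure_translation by metis
qed

lemma norm_scaleR_sgn: "norm v *\<^sub>R sgn v = (v :: 'a::real_normed_vector)"
  by (cases "v = 0") (auto simp: sgn_div_norm)

lemma central_segment_eq: "central_segment v = closed_segment 0 v + {- (v /\<^sub>R 2)}"
proof -
  have "closed_segment (- (v /\<^sub>R 2) + 0) (- (v /\<^sub>R 2) + v) = (+) (- (v /\<^sub>R 2)) ` closed_segment 0 v"
    by (rule closed_segment_translation)
  moreover have "- (v /\<^sub>R 2) + v = v /\<^sub>R 2" using scaleR_half_double[of v] 
    by (simp add: algebra_simps flip: scaleR_2)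
  ultimately show ?thesis by (auto simp: set_plus_def image_def)
qed

text \<open>Centring only translates the sum. With \<open>sgn v\<close> the formula covers v = 0
  too, where the shadow in the direction 0 is multiplied by 0.\<close>

lemma vol_add_central_segment:
  fixes v :: "'a::euclidean_space"
  assumes K: "compact K" "convex K"
  shows "measure lebesgue (K + central_segment v) = measure lebesgue K + norm v * shadow (sgn v) K"
proof -
  have "measure lebesgue (K + central_segment v) = measure lebesgue (K + closed_segment 0 v)"
    unfolding central_segment_eq add.assoc[symmetric] by (rule vol_set_plus_singleton)
  also have "\<dots> = measure lebesgue K + norm v * shadow (sgn v) K"
  proof (cases "v = 0")
    case False
    then show ?thesis
      using vol_add_closed_segment[of "sgn v" K "norm v"] K by (simp add: norm_sgn norm_scaleR_sgn)
  qed (simp flip: set_zero)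
  finally show ?thesis .
qed

lemma shadow_eq_diff:
  fixes \<xi> :: "'a::euclidean_space"
  assumes "norm \<xi> = 1" "compact K" "convex K"
  shows "shadow \<xi> K = measure lebesgue (K + central_segment \<xi>) - measure lebesgue K"
  using vol_add_central_segment[OF assms(2,3), of \<xi>] assms(1) by (simp add: sgn_div_norm)

text \<open>The gain is a length times a projected volume, and projections grow with the body. All
  later monotonicity rests on this case.\<close>

lemma vol_add_central_segment_mono:
  fixes v :: "'a::euclidean_space"
  assumes "compact K" "convex K" "compact K'" "convex K'" "K \<subseteq> K'"
  shows "measure lebesgue (K + central_segment v) - measure lebesgue K
       \<le> measure lebesgue (K' + central_segment v) - measure lebesgue K'"
proof (cases "v = 0")
  case False
  then have "shadow (sgn v) K \<le> shadow (sgn v) K'" using assms by (intro shadow_mono) (auto simp: norm_sgn)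
  then show ?thesis
    unfolding vol_add_central_segment[OF assms(1,2)] vol_add_central_segment[OF assms(3,4)]
    by (simp add: mult_left_mono)
qed (simp flip: set_zero)

lemma image_scaleR_set_plus: "(*\<^sub>R) c ` (A + B) = (*\<^sub>R) c ` A + (*\<^sub>R) c ` (B :: 'a::real_vector set)"
  by (intro image_set_plus_linear) simp

lemma image_scaleR_central_segment: "(*\<^sub>R) c ` central_segment v = central_segment (c *\<^sub>R v)"
  by (subst closed_segment_linear_image[symmetric]) (auto simp: mult.commute)

text \<open>Sweeping \<open>K\<close> along \<open>\<xi>\<close> and then dilating by
  \<open>r\<close> is sweeping the dilate along \<open>r *\<^sub>R \<xi>\<close>. Hence r times the
  shadow scales like a volume, with the exponent \<open>DIM('a)\<close>.\<close>

lemma shadow_scaleR: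
  fixes \<xi> :: "'a::euclidean_space"
  assumes \<xi>: "norm \<xi> = 1" and K: "compact K" "convex K" and r: "0 < r"
  shows "shadow \<xi> ((*\<^sub>R) r ` K) = r ^ (DIM('a) - 1) * shadow \<xi> K"
proof -
  have sr: "sgn (r *\<^sub>R \<xi>) = \<xi>" using r \<xi> by (simp add: sgn_div_norm)
  have rK: "compact ((*\<^sub>R) r ` K)" "convex ((*\<^sub>R) r ` K)"
    using K by (auto intro: compact_scaling convex_scaling)
  have "r * shadow \<xi> ((*\<^sub>R) r ` K) =
    measure lebesgue ((*\<^sub>R) r ` K + central_segment (r *\<^sub>R \<xi>)) - measure lebesgue ((*\<^sub>R) r ` K)"
    using vol_add_central_segment[OF rK, of "r *\<^sub>R \<xi>"] r \<xi> sr by simp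
  also have "\<dots> = r ^ DIM('a) * (measure lebesgue (K + central_segment \<xi>) - measure lebesgue K)"
    unfolding image_scaleR_central_segment[symmetric] image_scaleR_set_plus[symmetric]
    using r by (simp add: measure_lebesgue_scaleR_image algebra_simps)
  also have "\<dots> = r * (r ^ (DIM('a) - 1) * shadow \<xi> K)"
    unfolding shadow_eq_diff[OF \<xi> K] by (subst power_eq_if[of r "DIM('a)"]) simp
  finally show ?thesis using r by simp
qed

lemma hyperplane_proj_cball:
  assumes "norm \<xi> = 1"
  shows "hyperplane_proj (cball 0 r) \<xi> = cball 0 r \<inter> {\<xi>}\<^sup>\<bottom>"
proof
  show "cball 0 r \<inter> {\<xi>}\<^sup>\<bottom> \<subseteq> hyperplane_proj (cball 0 r) \<xi>"
  proof
    fix x assume x: "x \<in> cball 0 r \<inter> {\<xi>}\<^sup>\<bottom>"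
    then have "x = x - (x \<bullet> \<xi>) *\<^sub>R \<xi>" by (simp add: mem_orthogonal_comp_singleton)
    then show "x \<in> hyperplane_proj (cball 0 r) \<xi>" using x unfolding hyperplane_proj_def by blast
  qed
  have "norm (x - (x \<bullet> \<xi>) *\<^sub>R \<xi>) \<le> norm x" for x
  proof -
    have "(norm (x - (x \<bullet> \<xi>) *\<^sub>R \<xi>))\<^sup>2 = (norm x)\<^sup>2 - (x \<bullet> \<xi>)\<^sup>2"
      using assms unfolding power2_norm_eq_inner
      by (simp add: inner_diff inner_commute power2_eq_square norm_eq_1 algebra_simps)
    also have "\<dots> \<le> (norm x)\<^sup>2" by simp
    finally show ?thesis by (simp add: power2_le_iff_abs_le)
  qed
  then have "hyperplane_proj (cball 0 r) \<xi> \<subseteq> cball 0 r"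
    by (fastforce simp: hyperplane_proj_def intro: order_trans)
  then show "hyperplane_proj (cball 0 r) \<xi> \<subseteq> cball 0 r \<inter> {\<xi>}\<^sup>\<bottom>"
    using hyperplane_proj_subset[OF assms] by blast
qed

lemma shadow_unit_cball:
  fixes \<xi> :: "'a::euclidean_space"
  assumes "norm \<xi> = 1"
  shows "shadow \<xi> (cball 0 1) = unit_ball_vol (real DIM('a) - 1)"
proof -
  have "DIM('a) \<ge> 1" by simp
  then have "real (DIM('a) - 1) = real DIM('a) - 1" by linarith
  then show ?thesis
    using emeasure_lborel_on_unit_ball[OF subspace_orthogonal_comp[of "{\<xi>}"]] assms
    by (simp add: hyperplane_proj_cball dim_orthogonal_comp_singleton measure_def)
qed

section \<open>Zonotopes and zonoids\<close>

primrec zonotope :: "'a::real_vector list \<Rightarrow> 'a set" where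
  "zonotope [] = {0}"
| "zonotope (v # vs) = central_segment v + zonotope vs"

abbreviation total_length :: "'a::real_normed_vector list \<Rightarrow> real" where
  "total_length vs \<equiv> (\<Sum>v\<leftarrow>vs. norm v)"

text \<open>Zonoids are usually limits of zonotopes in the Hausdorff metric. Comparison with dilates
  about the origin turns approximation errors into factors, and it passes to linear images even when
  these are degenerate, such as the projection of the unit ball to a hyperplane.\<close>

definition zonoid :: "'a::euclidean_space set \<Rightarrow> bool" where
  "zonoid A \<longleftrightarrow> (\<forall>\<eta>\<in>{0<..<1}. \<exists>vs. (*\<^sub>R) (1 - \<eta>) ` A \<subseteq> zonotope vs \<and> zonotope vs \<subseteq> (*\<^sub>R) (1 + \<eta>) ` A)"

lemma set_plus_zero: "A + {0} = A" "{0} + A = (A :: 'a::comm_monoid_add set)"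
  by (auto simp: set_plus_def)

lemma zonoidE:
  assumes "zonoid A" "0 < \<eta>" "\<eta> < 1"
  obtains vs where "(*\<^sub>R) (1 - \<eta>) ` A \<subseteq> zonotope vs" "zonotope vs \<subseteq> (*\<^sub>R) (1 + \<eta>) ` A"
  using bspec[OF assms(1)[unfolded zonoid_def], of \<eta>] assms(2,3) that by auto

lemma compact_zonotope: "compact (zonotope vs :: 'a::real_normed_vector set)"
  by (induction vs) (auto intro!: compact_set_plus)

lemma convex_zonotope: "convex (zonotope vs)"
  by (induction vs) (auto intro!: convex_set_plus)

lemma zero_mem_central_segment: "0 \<in> central_segment v"
proof -
  have "midpoint (- (v /\<^sub>R 2)) (v /\<^sub>R 2) \<in> central_segment v" by simp
  then show ?thesis by (simp add: midpoint_def)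
qed

lemma zero_mem_zonotope: "0 \<in> zonotope vs"
proof (induction vs)
  case (Cons v vs)
  then show ?case using set_plus_intro[OF zero_mem_central_segment[of v], of 0 "zonotope vs"] by simp
qed simp

lemma zonotope_linear_image: "linear f \<Longrightarrow> f ` zonotope vs = zonotope (map f vs)"
  by (induction vs)
     (auto simp: image_set_plus_linear closed_segment_linear_image[symmetric] linear_scale linear_neg linear_0)

lemma zonotope_scaleR: "(*\<^sub>R) c ` zonotope vs = zonotope (map ((*\<^sub>R) c) vs)"
  by (intro zonotope_linear_image) simp

lemma subset_set_plus_right: "0 \<in> B \<Longrightarrow> A \<subseteq> A + (B :: 'a::monoid_add set)"
  by (force simp: set_plus_def)

section \<open>Volume growth under addition of a zonotope\<close>

lemmas cc_intros = compact_set_plus convex_set_plus compact_zonotope convex_zonotope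
  compact_segment convex_closed_segment compact_hyperplane_proj convex_hyperplane_proj
  compact_scaling convex_scaling compact_cball convex_cball

text \<open>Adding the same segment to both bodies preserves the inclusion, so the comparison for
  one segment can be summed over the list.\<close>

lemma vol_add_zonotope_mono:
  fixes K :: "'a::euclidean_space set"
  assumes "compact K" "convex K" "compact K'" "convex K'" "K \<subseteq> K'"
  shows "measure lebesgue (K + zonotope vs) - measure lebesgue K
       \<le> measure lebesgue (K' + zonotope vs) - measure lebesgue K'"
  using assms
proof (induction vs arbitrary: K K')
  case Nil
  then show ?case by (simp add: set_plus_zero)
next
  case (Cons v vs)
  have "measure lebesgue (K + central_segment v + zonotope vs) - measure lebesgue (K + central_segment v)
       \<le> measure lebesgue (K' + central_segment v + zonotope vs) - measure lebesgue (K' + central_segment v)"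
    using Cons.prems by (intro Cons.IH cc_intros set_plus_mono2) auto
  then show ?case using vol_add_central_segment_mono[OF Cons.prems, of v] by (simp add: add.assoc)
qed

text \<open>Monotonicity of (|K + t Z| - |K|) / t, with denominators cleared. For the first segment
  the quotient is constant (fact \<open>2\<close>); for the remaining ones the larger factor also
  enlarges the base from \<open>?Ks\<close> to \<open>?Kt\<close>, which can only increase their
  gain (fact \<open>1\<close>).\<close>

lemma vol_add_zonotope_scale_mono:
  fixes K :: "'a::euclidean_space set"
  assumes "compact K" "convex K" and st: "0 < s" "s \<le> t"
  shows "t * (measure lebesgue (K + (*\<^sub>R) s ` zonotope vs) - measure lebesgue K)
       \<le> s * (measure lebesgue (K + (*\<^sub>R) t ` zonotope vs) - measure lebesgue K)"
  using assms(1,2)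
proof (induction vs arbitrary: K)
  case Nil
  then show ?case by (simp add: vol_set_plus_singleton)
next
  case (Cons v vs)
  let ?Ks = "K + central_segment (s *\<^sub>R v)" and ?Kt = "K + central_segment (t *\<^sub>R v)"
  have "(*\<^sub>R) s ` central_segment v \<subseteq> (*\<^sub>R) t ` central_segment v"
  proof safe
    fix x assume x: "x \<in> central_segment v"
    have "(1 - s / t) *\<^sub>R 0 + (s / t) *\<^sub>R x \<in> central_segment v"
      using x st zero_mem_central_segment[of v] by (intro convexD[OF convex_closed_segment]) auto
    moreover have "s *\<^sub>R x = t *\<^sub>R ((1 - s / t) *\<^sub>R 0 + (s / t) *\<^sub>R x)" using st by simp
    ultimately show "s *\<^sub>R x \<in> (*\<^sub>R) t ` central_segment v" by blast
  qed
  then have sub: "?Ks \<subseteq> ?Kt"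
    unfolding image_scaleR_central_segment by (intro set_plus_mono2) auto
  have "t * (measure lebesgue (?Ks + (*\<^sub>R) s ` zonotope vs) - measure lebesgue ?Ks)
      \<le> s * (measure lebesgue (?Ks + (*\<^sub>R) t ` zonotope vs) - measure lebesgue ?Ks)"
    using Cons.prems by (intro Cons.IH cc_intros)
  also have "\<dots> \<le> s * (measure lebesgue (?Kt + (*\<^sub>R) t ` zonotope vs) - measure lebesgue ?Kt)"
    unfolding zonotope_scaleR using Cons.prems sub st
    by (intro mult_left_mono vol_add_zonotope_mono cc_intros) auto
  finally have 1: "t * (measure lebesgue (?Ks + (*\<^sub>R) s ` zonotope vs) - measure lebesgue ?Ks)
    \<le> s * (measure lebesgue (?Kt + (*\<^sub>R) t ` zonotope vs) - measure lebesgue ?Kt)" .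
  have 2: "t * (measure lebesgue ?Ks - measure lebesgue K) = s * (measure lebesgue ?Kt - measure lebesgue K)"
  proof (cases "v = 0")
    case False
    then have "sgn (s *\<^sub>R v) = sgn v" "sgn (t *\<^sub>R v) = sgn v" using st by (auto simp: sgn_div_norm)
    then show ?thesis unfolding vol_add_central_segment[OF Cons.prems] using st by simp
  qed (simp add: set_plus_zero)
  have "t * (measure lebesgue (K + ((*\<^sub>R) s ` central_segment v + (*\<^sub>R) s ` zonotope vs)) - measure lebesgue K)
    = t * (measure lebesgue (?Ks + (*\<^sub>R) s ` zonotope vs) - measure lebesgue ?Ks)
      + t * (measure lebesgue ?Ks - measure lebesgue K)"
    unfolding image_scaleR_central_segment by (simp add: add.assoc algebra_simps)
  also have "\<dots> \<le> s * (measure lebesgue (?Kt + (*\<^sub>R) t ` zonotope vs) - measure lebesgue ?Kt)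
      + s * (measure lebesgue ?Kt - measure lebesgue K)"
    using 1 2 by linarith
  also have "\<dots> = s * (measure lebesgue (K + ((*\<^sub>R) t ` central_segment v + (*\<^sub>R) t ` zonotope vs)) - measure lebesgue K)"
    unfolding image_scaleR_central_segment by (simp add: add.assoc algebra_simps)
  finally show ?case by (simp only: zonotope.simps image_scaleR_set_plus)
qed

text \<open>Every partial sum lies in \<open>C\<close>, because the segments still to be added
  contain 0. So each segment \<open>v\<close> adds at most \<open>c * norm v\<close>.\<close>

lemma vol_add_zonotope_upper:
  fixes K :: "'a::euclidean_space set"
  assumes "compact K" "convex K" "compact C" "K + zonotope vs \<subseteq> C"
    and "\<And>\<xi>. norm \<xi> = 1 \<Longrightarrow> shadow \<xi> C \<le> c"
  shows "measure lebesgue (K + zonotope vs) \<le> measure lebesgue K + c * total_length vs"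
  using assms(1,2,4)
proof (induction vs arbitrary: K)
  case Nil
  then show ?case by (simp add: set_plus_zero)
next
  case (Cons v vs)
  have eq: "K + zonotope (v # vs) = K + central_segment v + zonotope vs" by (simp add: add.assoc)
  have sub: "K \<subseteq> C"
    using Cons.prems(3) subset_set_plus_right[OF zero_mem_zonotope[of "v # vs"], of K] by blast
  have "measure lebesgue (K + central_segment v) \<le> measure lebesgue K + c * norm v"
  proof (cases "v = 0")
    case False
    then have "shadow (sgn v) K \<le> c"
      using shadow_mono[of "sgn v" K C] assms(3) assms(5)[of "sgn v"] sub Cons.prems by (simp add: norm_sgn)
    then have "norm v * shadow (sgn v) K \<le> norm v * c" by (intro mult_left_mono) auto
    then show ?thesis unfolding vol_add_central_segment[OF Cons.prems(1,2)] by (simp add: mult.commute)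
  qed (simp add: set_plus_zero)
  moreover have "measure lebesgue (K + central_segment v + zonotope vs) \<le>
      measure lebesgue (K + central_segment v) + c * total_length vs"
    using Cons.prems(1,2) Cons.prems(3)[unfolded eq] by (intro Cons.IH cc_intros)
  ultimately show ?case unfolding eq by (simp add: algebra_simps)
qed

section \<open>Increments of volume and of projected volume\<close>

lemma hyperplane_proj_set_plus: "hyperplane_proj (A + B) \<xi> = hyperplane_proj A \<xi> + hyperplane_proj B \<xi>"
  unfolding hyperplane_proj_def by (rule image_set_plus_linear[OF linear_hyperplane_proj])

text \<open>The unit segment is grouped with the projection of \<open>A\<close>, so that the
  projection of \<open>B\<close> is added to one fixed body.\<close>

lemma shadow_set_plus:
  fixes \<xi> :: "'a::euclidean_space"
  assumes "norm \<xi> = 1" "compact A" "compact B"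
  shows "shadow \<xi> (A + B) = measure lebesgue (hyperplane_proj A \<xi> + closed_segment 0 \<xi> + hyperplane_proj B \<xi>)"
  by (rule trans[OF shadow_eq_vol[OF assms(1) compact_set_plus[OF assms(2,3)]]])
    (simp add: hyperplane_proj_set_plus add_ac)

lemma hyperplane_proj_zonotope: "\<exists>ws. hyperplane_proj (zonotope vs) \<xi> = zonotope ws"
  unfolding hyperplane_proj_def using zonotope_linear_image[OF linear_hyperplane_proj] by blast

lemma zero_mem_hyperplane_proj: "0 \<in> A \<Longrightarrow> 0 \<in> hyperplane_proj A \<xi>"
  using imageI[of 0 A "\<lambda>x. x - (x \<bullet> \<xi>) *\<^sub>R \<xi>"] by (simp add: hyperplane_proj_def)

text \<open>The second difference in question is symmetric in \<open>A\<close> and the zonotope. It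
  is therefore enough to know that the gain from the zonotope grows when the base is enlarged by
  \<open>A\<close>, and only the zonotope has to be a sum of segments.\<close>

lemma shadow_add_zonotope_mono:
  fixes \<xi> :: "'a::euclidean_space"
  assumes \<xi>: "norm \<xi> = 1" and K: "compact K" "convex K" and A: "compact A" "convex A" "0 \<in> A"
  shows "shadow \<xi> (K + A) - shadow \<xi> K \<le> shadow \<xi> (K + zonotope vs + A) - shadow \<xi> (K + zonotope vs)"
proof -
  obtain ws where ws: "hyperplane_proj (zonotope vs) \<xi> = zonotope ws"
    using hyperplane_proj_zonotope by blast
  let ?K = "hyperplane_proj K \<xi> + closed_segment 0 \<xi>" and ?A = "hyperplane_proj A \<xi>"
  have "measure lebesgue (?K + zonotope ws) - measure lebesgue ?K
    \<le> measure lebesgue (?K + ?A + zonotope ws) - measure lebesgue (?K + ?A)"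
    using K A by (intro vol_add_zonotope_mono cc_intros subset_set_plus_right zero_mem_hyperplane_proj)
  moreover have "shadow \<xi> (K + zonotope vs) = measure lebesgue (?K + zonotope ws)"
    using shadow_set_plus[OF \<xi> K(1) compact_zonotope[of vs]] unfolding ws .
  moreover have "shadow \<xi> (K + zonotope vs + A) = measure lebesgue (?K + ?A + zonotope ws)"
    unfolding shadow_eq_vol[OF \<xi> compact_set_plus[OF compact_set_plus[OF K(1) compact_zonotope] A(1)]]
    by (simp only: hyperplane_proj_set_plus ws add_ac)
  ultimately show ?thesis
    unfolding shadow_set_plus[OF \<xi> K(1) A(1)] shadow_eq_vol[OF \<xi> K(1)] by linarith
qed

text \<open>A segment \<open>v\<close> raises |K + A| - |K| by \<open>norm v\<close> times the
  difference of the shadows of \<open>K + A\<close> and \<open>K\<close>, hence by at least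
  \<open>c * norm v\<close>. The bound on shadows is inherited by
  \<open>K + central_segment v\<close>, by \<open>shadow_add_zonotope_mono\<close>, so the induction
  continues.\<close>

lemma vol_increment_add_zonotope:
  fixes K :: "'a::euclidean_space set"
  assumes "compact K" "convex K" and A: "compact A" "convex A" "0 \<in> A"
    and "\<And>\<xi>. norm \<xi> = 1 \<Longrightarrow> c \<le> shadow \<xi> (K + A) - shadow \<xi> K"
  shows "measure lebesgue (K + A) - measure lebesgue K + c * total_length vs
       \<le> measure lebesgue (K + zonotope vs + A) - measure lebesgue (K + zonotope vs)"
  using assms(1,2,6)
proof (induction vs arbitrary: K)
  case Nil
  then show ?case by (simp add: set_plus_zero)
next
  case (Cons v vs)
  have eq: "K + zonotope (v # vs) = K + central_segment v + zonotope vs" by (simp add: add.assoc)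
  have cs: "central_segment v = zonotope [v]" by (simp add: set_plus_zero)
  have "measure lebesgue (K + central_segment v + A) - measure lebesgue (K + central_segment v) + c * total_length vs
       \<le> measure lebesgue (K + central_segment v + zonotope vs + A) - measure lebesgue (K + central_segment v + zonotope vs)"
  proof (rule Cons.IH)
    fix \<xi> :: 'a assume "norm \<xi> = 1"
    then show "c \<le> shadow \<xi> (K + central_segment v + A) - shadow \<xi> (K + central_segment v)"
      using shadow_add_zonotope_mono[of \<xi> K A "[v]"] Cons.prems A unfolding cs by force
  qed (intro cc_intros Cons.prems)+
  moreover have "c * norm v \<le> (measure lebesgue (K + central_segment v + A) - measure lebesgue (K + A))
     - (measure lebesgue (K + central_segment v) - measure lebesgue K)"
  proof (cases "v = 0")
    case False
    have e: "K + central_segment v + A = K + A + central_segment v" by (simp add: add_ac)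
    have KA: "compact (K + A)" "convex (K + A)" using Cons.prems A by (auto intro: cc_intros)
    have "c \<le> shadow (sgn v) (K + A) - shadow (sgn v) K" using False by (intro Cons.prems) (simp add: norm_sgn)
    then have "norm v * c \<le> norm v * (shadow (sgn v) (K + A) - shadow (sgn v) K)"
      by (intro mult_left_mono) auto
    then show ?thesis
      unfolding e vol_add_central_segment[OF KA] vol_add_central_segment[OF Cons.prems(1,2)]
      by (simp add: algebra_simps)
  qed (simp add: set_plus_zero)
  moreover have "c * total_length (v # vs) = c * norm v + c * total_length vs" by (simp add: distrib_left)
  ultimately show ?case unfolding eq by linarith
qed

lemma scaleR_image_mono:
  fixes K :: "'a::real_vector set"
  assumes "convex K" "0 \<in> K" "0 \<le> s" "s \<le> t"
  shows "(*\<^sub>R) s ` K \<subseteq> (*\<^sub>R) t ` K"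
proof (cases "t = 0")
  case False
  show ?thesis
  proof safe
    fix x assume "x \<in> K"
    then have "(1 - s / t) *\<^sub>R 0 + (s / t) *\<^sub>R x \<in> K"
      using assms False by (intro convexD) auto
    moreover have "s *\<^sub>R x = t *\<^sub>R ((1 - s / t) *\<^sub>R 0 + (s / t) *\<^sub>R x)" using False by simp
    ultimately show "s *\<^sub>R x \<in> (*\<^sub>R) t ` K" by blast
  qed
next
  case True
  then have "s = 0" using assms by simp
  then show ?thesis using True by simp
qed

lemma scaleR_image_mono_set: "A \<subseteq> B \<Longrightarrow> (*\<^sub>R) c ` A \<subseteq> (*\<^sub>R) c ` B"
  by blast

lemma scaleR_image_scaleR: "(*\<^sub>R) a ` (*\<^sub>R) b ` A = (*\<^sub>R) (a * b) ` (A :: 'a::real_vector set)"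
  by (simp add: image_image)

lemma zonoid_linear_image:
  assumes "linear f" "zonoid A"
  shows "zonoid (f ` A)"
  unfolding zonoid_def
proof
  fix \<eta> :: real assume "\<eta> \<in> {0<..<1}"
  then obtain vs where vs: "(*\<^sub>R) (1 - \<eta>) ` A \<subseteq> zonotope vs" "zonotope vs \<subseteq> (*\<^sub>R) (1 + \<eta>) ` A"
    using zonoidE[OF assms(2), of \<eta>] by auto
  have comm: "(*\<^sub>R) c ` f ` A = f ` (*\<^sub>R) c ` A" for c
    by (simp add: image_image linear_scale[OF assms(1)])
  show "\<exists>vs. (*\<^sub>R) (1 - \<eta>) ` f ` A \<subseteq> zonotope vs \<and> zonotope vs \<subseteq> (*\<^sub>R) (1 + \<eta>) ` f ` A"
    unfolding comm using vs
    by (intro exI[of _ "map f vs"]) (simp add: zonotope_linear_image[OF assms(1), symmetric] image_mono)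
qed

text \<open>As 0 lies in \<open>K\<close>, also \<open>K\<close> itself is caught between its
  dilates by 1 - \<eta> and 1 + \<eta>. The sums with a zonotope then lie between dilates of the
  sums with \<open>A\<close>, and \<eta> tends to 0.\<close>

lemma vol_add_zonoid_scale_mono:
  fixes K :: "'a::euclidean_space set"
  assumes K: "compact K" "convex K" "0 \<in> K" and A: "zonoid A" "compact A" "convex A"
    and st: "0 < s" "s \<le> t"
  shows "t * (measure lebesgue (K + (*\<^sub>R) s ` A) - measure lebesgue K)
       \<le> s * (measure lebesgue (K + (*\<^sub>R) t ` A) - measure lebesgue K)"
proof -
  let ?n = "DIM('a)"
  have *: "t * ((1 - \<eta>) ^ ?n * measure lebesgue (K + (*\<^sub>R) s ` A) - measure lebesgue K)
       \<le> s * ((1 + \<eta>) ^ ?n * measure lebesgue (K + (*\<^sub>R) t ` A) - measure lebesgue K)"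
    if \<eta>: "0 < \<eta>" "\<eta> < 1" for \<eta>
  proof -
    obtain vs where vs: "(*\<^sub>R) (1 - \<eta>) ` A \<subseteq> zonotope vs" "zonotope vs \<subseteq> (*\<^sub>R) (1 + \<eta>) ` A"
      by (rule zonoidE[OF A(1) \<eta>])
    have K1: "(*\<^sub>R) (1 - \<eta>) ` K \<subseteq> K" using scaleR_image_mono[of K "1 - \<eta>" 1] K \<eta> by simp
    have K2: "K \<subseteq> (*\<^sub>R) (1 + \<eta>) ` K" using scaleR_image_mono[of K 1 "1 + \<eta>"] K \<eta> by simp
    have sub1: "(*\<^sub>R) (1 - \<eta>) ` (K + (*\<^sub>R) s ` A) \<subseteq> K + (*\<^sub>R) s ` zonotope vs"
      using scaleR_image_mono_set[OF vs(1), of s] K1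
      unfolding image_scaleR_set_plus scaleR_image_scaleR mult.commute[of s] by (intro set_plus_mono2)
    have sub2: "K + (*\<^sub>R) t ` zonotope vs \<subseteq> (*\<^sub>R) (1 + \<eta>) ` (K + (*\<^sub>R) t ` A)"
      using scaleR_image_mono_set[OF vs(2), of t] K2
      unfolding image_scaleR_set_plus scaleR_image_scaleR mult.commute[of t] by (intro set_plus_mono2)
    have "(1 - \<eta>) ^ ?n * measure lebesgue (K + (*\<^sub>R) s ` A) \<le> measure lebesgue (K + (*\<^sub>R) s ` zonotope vs)"
      using measure_compact_mono[OF _ _ sub1] K A \<eta>
      by (simp add: measure_lebesgue_scaleR_image cc_intros)
    moreover have "measure lebesgue (K + (*\<^sub>R) t ` zonotope vs) \<le> (1 + \<eta>) ^ ?n * measure lebesgue (K + (*\<^sub>R) t ` A)"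
      using measure_compact_mono[OF _ _ sub2] K A \<eta>
      by (simp add: measure_lebesgue_scaleR_image cc_intros)
    ultimately have
      "t * ((1 - \<eta>) ^ ?n * measure lebesgue (K + (*\<^sub>R) s ` A) - measure lebesgue K)
        \<le> t * (measure lebesgue (K + (*\<^sub>R) s ` zonotope vs) - measure lebesgue K)"
      "s * (measure lebesgue (K + (*\<^sub>R) t ` zonotope vs) - measure lebesgue K)
        \<le> s * ((1 + \<eta>) ^ ?n * measure lebesgue (K + (*\<^sub>R) t ` A) - measure lebesgue K)"
      using st by (intro mult_left_mono; simp)+
    then show ?thesis using vol_add_zonotope_scale_mono[OF K(1,2) st, of vs] by linarith
  qed
  have ev: "\<forall>\<^sub>F \<eta> in at_right 0. t * ((1 - \<eta>) ^ ?n * measure lebesgue (K + (*\<^sub>R) s ` A) - measure lebesgue K)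
       \<le> s * ((1 + \<eta>) ^ ?n * measure lebesgue (K + (*\<^sub>R) t ` A) - measure lebesgue K)"
    using eventually_at_right_real[OF zero_less_one] by (rule eventually_mono) (use * in auto)
  have "((\<lambda>\<eta>. t * ((1 - \<eta>) ^ ?n * measure lebesgue (K + (*\<^sub>R) s ` A) - measure lebesgue K)) \<longlongrightarrow>
      t * ((1 - 0) ^ ?n * measure lebesgue (K + (*\<^sub>R) s ` A) - measure lebesgue K)) (at_right 0)"
    by (intro tendsto_intros)
  moreover have "((\<lambda>\<eta>. s * ((1 + \<eta>) ^ ?n * measure lebesgue (K + (*\<^sub>R) t ` A) - measure lebesgue K)) \<longlongrightarrow>
      s * ((1 + 0) ^ ?n * measure lebesgue (K + (*\<^sub>R) t ` A) - measure lebesgue K)) (at_right 0)"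
    by (intro tendsto_intros)
  ultimately show ?thesis
    using tendsto_le[OF trivial_limit_at_right_real _ _ ev] by fastforce
qed

section \<open>Existence of the surface area\<close>

lemma tendsto_at_right_Inf_mono:
  fixes q :: "real \<Rightarrow> real"
  assumes mono: "\<And>s t. 0 < s \<Longrightarrow> s \<le> t \<Longrightarrow> q s \<le> q t" and pos: "\<And>t. 0 < t \<Longrightarrow> 0 \<le> q t"
  shows "(q \<longlongrightarrow> Inf (q ` {0<..})) (at_right 0)"
proof (rule decreasing_tendsto)
  have bdd: "bdd_below (q ` {0<..})" using pos by (intro bdd_belowI2[of _ 0]) auto
  show "\<forall>\<^sub>F t in at_right 0. Inf (q ` {0<..}) \<le> q t"
    using bdd by (auto intro!: cINF_lower simp: eventually_at_right_field intro: exI[of _ 1])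
  fix x assume "Inf (q ` {0<..}) < x"
  then obtain t where "0 < t" "q t < x" using bdd by (subst (asm) cINF_less_iff) auto
  then show "\<forall>\<^sub>F n in at_right 0. q n < x"
    using mono by (auto simp: eventually_at_right_field intro!: exI[of _ t] intro: le_less_trans less_imp_le)
qed

text \<open>\<open>Lim\<close> is informative only where a limit exists. A nondecreasing nonnegative
  quotient converges to its infimum at 0, so the limit bounds the quotient at every positive
  \<open>t\<close>, not just asymptotically.\<close>

lemma Lim_vol_add_zonoid:
  fixes K :: "'a::euclidean_space set"
  assumes K: "compact K" "convex K" "0 \<in> K" and A: "zonoid A" "compact A" "convex A" "0 \<in> A"
  defines "q \<equiv> \<lambda>t. (measure lebesgue (K + (*\<^sub>R) t ` A) - measure lebesgue K) / t"
  shows "(q \<longlongrightarrow> Lim (at_right 0) q) (at_right 0)" and "0 \<le> Lim (at_right 0) q"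
    and "\<And>t. 0 < t \<Longrightarrow> Lim (at_right 0) q \<le> q t"
proof -
  have mono: "q s \<le> q t" if "0 < s" "s \<le> t" for s t
    using vol_add_zonoid_scale_mono[OF K A(1-3) that] that by (simp add: q_def field_simps)
  have pos: "0 \<le> q t" if "0 < t" for t
  proof -
    have "0 \<in> (*\<^sub>R) t ` A" using A(4) by force
    then have "measure lebesgue K \<le> measure lebesgue (K + (*\<^sub>R) t ` A)"
      using K A by (intro measure_compact_mono cc_intros subset_set_plus_right)
    then show ?thesis using that by (simp add: q_def)
  qed
  have lim: "(q \<longlongrightarrow> Inf (q ` {0<..})) (at_right 0)"
    using mono pos by (rule tendsto_at_right_Inf_mono)
  then have eq: "Lim (at_right 0) q = Inf (q ` {0<..})" by (intro tendsto_Lim) auto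
  show "(q \<longlongrightarrow> Lim (at_right 0) q) (at_right 0)" unfolding eq by (rule lim)
  show "0 \<le> Lim (at_right 0) q" unfolding eq using pos by (intro cINF_greatest) auto
  show "Lim (at_right 0) q \<le> q t" if "0 < t" for t
    unfolding eq using pos that by (intro cINF_lower bdd_belowI[of _ 0]) auto
qed

text \<open>\<open>?K\<close> is the prism of height 1 over the projection of \<open>L\<close>. This
  turns the quotient in the hyperplane into one between volumes in the whole space, with the
  projected unit ball as the zonoid that is added.\<close>

lemma surface_area_on_shadow:
  fixes \<xi> :: "'a::euclidean_space"
  assumes \<xi>: "norm \<xi> = 1" and L: "compact L" "convex L" "0 \<in> L"
    and B: "zonoid (cball 0 1 :: 'a set)"
  shows "0 \<le> surface_area_on ({\<xi>}\<^sup>\<bottom>) (hyperplane_proj L \<xi>)" (is ?pos)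
    and "\<And>t. 0 < t \<Longrightarrow> shadow \<xi> L + t * surface_area_on ({\<xi>}\<^sup>\<bottom>) (hyperplane_proj L \<xi>)
       \<le> shadow \<xi> (L + cball 0 t)" (is "\<And>t. 0 < t \<Longrightarrow> ?le t")
proof -
  let ?K = "hyperplane_proj L \<xi> + closed_segment 0 \<xi>"
  let ?B = "hyperplane_proj (cball 0 1) \<xi>"
  define q where "q = (\<lambda>t. (measure lebesgue (?K + (*\<^sub>R) t ` ?B) - measure lebesgue ?K) / t)"
  have ball: "(*\<^sub>R) t ` cball 0 1 = (cball 0 t :: 'a set)" if "0 < t" for t
    using that by (simp add: cball_scale)
  have proj: "(*\<^sub>R) t ` ?B = hyperplane_proj ((*\<^sub>R) t ` cball 0 1) \<xi>" for t
    by (simp add: hyperplane_proj_def image_image scaleR_diff_right)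
  have vol: "measure lebesgue (?K + (*\<^sub>R) t ` ?B) = shadow \<xi> (L + (*\<^sub>R) t ` cball 0 1)" for t
    unfolding proj using L by (simp add: shadow_set_plus[OF \<xi>] compact_scaling)
  have vol0: "measure lebesgue ?K = shadow \<xi> L" using L by (simp add: shadow_eq_vol[OF \<xi>])
  have sa: "surface_area_on ({\<xi>}\<^sup>\<bottom>) (hyperplane_proj L \<xi>) = Lim (at_right 0) q"
    unfolding surface_area_on_def q_def vol vol0 hyperplane_proj_set_plus
    by (simp add: proj[symmetric] hyperplane_proj_cball[OF \<xi>])
  have K: "compact ?K" "convex ?K" "0 \<in> ?K"
    using L zero_mem_hyperplane_proj[OF L(3), of \<xi>] set_plus_intro[of 0 _ 0 "closed_segment 0 \<xi>"]
    by (auto intro!: cc_intros)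
  have B': "zonoid ?B" "compact ?B" "convex ?B" "0 \<in> ?B"
    using zonoid_linear_image[OF linear_hyperplane_proj B, of \<xi>]
    by (auto simp: hyperplane_proj_def[symmetric] intro!: cc_intros zero_mem_hyperplane_proj)
  show ?pos unfolding sa q_def by (rule Lim_vol_add_zonoid(2)[OF K B'])
  fix t :: real assume t: "0 < t"
  have "Lim (at_right 0) q \<le> q t" unfolding q_def by (rule Lim_vol_add_zonoid(3)[OF K B' t])
  also have "q t = (shadow \<xi> (L + cball 0 t) - shadow \<xi> L) / t"
    unfolding q_def vol vol0 ball[OF t] ..
  finally have "t * Lim (at_right 0) q \<le> shadow \<xi> (L + cball 0 t) - shadow \<xi> L"
    using t by (simp only: pos_le_divide_eq mult.commute)
  then show "?le t" unfolding sa by simp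
qed

lemma surface_area_lower_bound:
  fixes L :: "'a::euclidean_space set"
  assumes L: "compact L" "convex L" "0 \<in> L" and B: "zonoid (cball 0 1 :: 'a set)"
    and le: "\<And>t. 0 < t \<Longrightarrow> measure lebesgue L + t * c \<le> measure lebesgue (L + cball 0 t)"
  shows "c \<le> surface_area L"
proof -
  have "c \<le> Lim (at_right 0) (\<lambda>t. (measure lebesgue (L + (*\<^sub>R) t ` cball 0 1) - measure lebesgue L) / t)"
  proof (rule tendsto_lowerbound[OF Lim_vol_add_zonoid(1)[OF L B]])
    show "\<forall>\<^sub>F t in at_right 0. c \<le> (measure lebesgue (L + (*\<^sub>R) t ` cball 0 1) - measure lebesgue L) / t"
      using eventually_at_right_less
    proof (rule eventually_mono)
      fix t :: real assume t: "0 < t"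
      have "(*\<^sub>R) t ` cball 0 1 = (cball 0 t :: 'a set)" using t by (simp add: cball_scale)
      then show "c \<le> (measure lebesgue (L + (*\<^sub>R) t ` cball 0 1) - measure lebesgue L) / t"
        using le[OF t] t by (simp add: field_simps)
    qed
  qed auto
  then show ?thesis by (simp add: surface_area_def)
qed

section \<open>The Prekopa--Leindler and Brunn--Minkowski inequalities for midpoints\<close>

lemma emeasure_lborel_inner_compact:
  fixes A :: "'a::euclidean_space set"
  assumes A: "A \<in> sets borel" "A \<noteq> {}"
  shows "emeasure lborel A = (SUP K\<in>{K. compact K \<and> K \<noteq> {} \<and> K \<subseteq> A}. emeasure lborel K)"
proof (rule antisym)
  let ?S = "SUP K\<in>{K. compact K \<and> K \<noteq> {} \<and> K \<subseteq> A}. emeasure lborel K"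
  obtain a where a: "a \<in> A" using A(2) by blast
  have "emeasure lborel (A \<inter> cball 0 (real k)) \<le> ?S" for k
  proof (rule ennreal_le_epsilon)
    fix e :: real assume e: "0 < e"
    let ?A = "A \<inter> cball 0 (real k)"
    have Ab: "?A \<in> sets borel" using A(1) by auto
    then have "?A \<in> sets lebesgue" by (simp add: sets_completionI_sets)
    then obtain T where T: "closed T" "T \<subseteq> ?A" "emeasure lebesgue (?A - T) < ennreal e"
      by (rule sets_lebesgue_inner_closed[OF _ e])
    have "bounded T" using T(2) bounded_cball by (meson bounded_subset inf.boundedE)
    then have "compact T" using T(1) by (simp add: compact_eq_bounded_closed)
    \<comment> \<open>The inner sets must be nonempty because their extreme points are used below;
      the extra point keeps them inside \<open>A\<close>.\<close>
    then have Ta: "compact (insert a T)" by simp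
    have Tb: "T \<in> sets borel" using T(1) by simp
    have "emeasure lborel ?A \<le> emeasure lborel (insert a T) + emeasure lborel (?A - T)"
      using Ab Tb by (intro order_trans[OF emeasure_mono emeasure_subadditive]) auto
    also have "emeasure lborel (?A - T) \<le> ennreal e"
      using T(3) Ab Tb by simp
    also have "emeasure lborel (insert a T) \<le> ?S"
      using Ta a T(2) by (intro SUP_upper) auto
    finally show "emeasure lborel ?A \<le> ?S + ennreal e" by (simp add: add_mono)
  qed
  moreover have "emeasure lborel A = (SUP k. emeasure lborel (A \<inter> cball 0 (real k)))"
  proof -
    have "(\<Union>k. A \<inter> cball 0 (real k)) = A"
      by (auto simp: dist_norm intro: real_arch_simple)
    moreover have "incseq (\<lambda>k. A \<inter> cball 0 (real k))" by (auto simp: incseq_def)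
    ultimately show ?thesis
      using SUP_emeasure_incseq[of "\<lambda>k. A \<inter> cball 0 (real k)" lborel] A(1)
      by (simp add: image_subset_iff)
  qed
  ultimately show "emeasure lborel A \<le> ?S" by (simp add: SUP_le_iff)
  show "?S \<le> emeasure lborel A"
    using A(1) by (intro SUP_least emeasure_mono) auto
qed

lemma emeasure_lborel_midpoint_shift:
  fixes C :: "real set"
  assumes "compact C"
  shows "2 * emeasure lborel ((\<lambda>x. (x + b) / 2) ` C) = emeasure lborel C"
proof -
  have eq: "(\<lambda>x. (x + b) / 2) = (\<lambda>x. (1 / 2) *\<^sub>R x + b / 2)" by (auto simp: field_simps)
  have "emeasure lebesgue ((\<lambda>x. (x + b) / 2) ` C) = ennreal (1 / 2) * emeasure lebesgue C"
    unfolding eq using emeasure_lebesgue_affine[of "1 / 2" "b / 2" C] by simp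
  moreover have "compact ((\<lambda>x. (x + b) / 2) ` C)"
    using assms by (intro compact_continuous_image continuous_intros) auto
  ultimately have e: "emeasure lborel ((\<lambda>x. (x + b) / 2) ` C) = ennreal (1 / 2) * emeasure lborel C"
    using assms by (simp add: borel_compact)
  have "2 * ennreal (1 / 2) = ennreal (2 * (1 / 2))"
    by (subst ennreal_mult) auto
  then have "2 * ennreal (1 / 2) = 1" by simp
  then show ?thesis unfolding e by (simp flip: mult.assoc)
qed

text \<open>For compact sets, take the largest point \<open>a\<close> of \<open>C\<close> and the
  smallest point \<open>b\<close> of \<open>D\<close>. The midpoints of \<open>C\<close> with
  \<open>b\<close> lie to the left of (a + b)/2 and those of \<open>D\<close> with \<open>a\<close>
  to the right, so these two half-size copies overlap in at most one point of \<open>H\<close>.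
  Inner regularity covers Borel sets.\<close>

lemma emeasure_lborel_midpoints:
  fixes A B H :: "real set"
  assumes [simp]: "A \<in> sets borel" "B \<in> sets borel" "H \<in> sets borel" and ne: "A \<noteq> {}" "B \<noteq> {}"
    and mid: "\<And>a b. a \<in> A \<Longrightarrow> b \<in> B \<Longrightarrow> (a + b) / 2 \<in> H"
  shows "emeasure lborel A + emeasure lborel B \<le> 2 * emeasure lborel H"
proof -
  have *: "emeasure lborel C + emeasure lborel D \<le> 2 * emeasure lborel H"
    if C: "compact C" "C \<noteq> {}" "C \<subseteq> A" and D: "compact D" "D \<noteq> {}" "D \<subseteq> B" for C D
  proof -
    obtain a where a: "a \<in> C" "\<And>x. x \<in> C \<Longrightarrow> x \<le> a"
      using compact_attains_sup[OF C(1,2)] by blast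
    obtain b where b: "b \<in> D" "\<And>x. x \<in> D \<Longrightarrow> b \<le> x"
      using compact_attains_inf[OF D(1,2)] by blast
    let ?C = "(\<lambda>x. (x + b) / 2) ` C" and ?D = "(\<lambda>x. (x + a) / 2) ` D"
    have cC: "compact ?C" and cD: "compact ?D"
      using C D by (intro compact_continuous_image continuous_intros; auto)+
    then have [simp]: "?C \<in> sets borel" "?D \<in> sets borel" by (auto intro: borel_compact)
    have "emeasure lborel C + emeasure lborel D = 2 * (emeasure lborel ?C + emeasure lborel ?D)"
      using emeasure_lborel_midpoint_shift[OF C(1), of b] emeasure_lborel_midpoint_shift[OF D(1), of a]
      by (simp add: distrib_left)
    also have "emeasure lborel ?C + emeasure lborel ?D = emeasure lborel (?C \<union> ?D)"
    proof (rule emeasure_Un'[symmetric])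
      have "?C \<inter> ?D \<subseteq> {(a + b) / 2}" using a b by (auto simp: field_simps) (smt (verit))
      then have "?C \<inter> ?D \<in> null_sets lborel"
        by (meson finite.emptyI finite.insertI finite_imp_null_set_lborel finite_subset)
      then show "?C \<inter> ?D \<in> null_sets lborel" .
    qed auto
    also have "emeasure lborel (?C \<union> ?D) \<le> emeasure lborel H"
    proof (rule emeasure_mono)
      have "(x + a) / 2 \<in> H" if "x \<in> D" for x using mid[of a x] a(1) C(3) D(3) that by (auto simp: add.commute)
      moreover have "(x + b) / 2 \<in> H" if "x \<in> C" for x using mid[of x b] b(1) C(3) D(3) that by auto
      ultimately show "?C \<union> ?D \<subseteq> H" by auto
    qed simp
    finally show ?thesis by (simp add: mult_left_mono)
  qed
  let ?SA = "{K. compact K \<and> K \<noteq> {} \<and> K \<subseteq> A}" and ?SB = "{K. compact K \<and> K \<noteq> {} \<and> K \<subseteq> B}"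
  have neS: "?SA \<noteq> {}" "?SB \<noteq> {}"
  proof -
    obtain a b where "a \<in> A" "b \<in> B" using ne by blast
    then have "{a} \<in> ?SA" "{b} \<in> ?SB" by auto
    then show "?SA \<noteq> {}" "?SB \<noteq> {}" by blast+
  qed
  have "emeasure lborel A + emeasure lborel D \<le> 2 * emeasure lborel H" if "D \<in> ?SB" for D
    unfolding emeasure_lborel_inner_compact[OF assms(1) ne(1)]
    using that * neS(1) by (simp add: ennreal_SUP_add_left[symmetric] SUP_le_iff)
  then have "emeasure lborel A + (SUP D\<in>?SB. emeasure lborel D) \<le> 2 * emeasure lborel H"
    using neS(2) by (subst ennreal_SUP_add_right) (simp_all add: SUP_le_iff)
  then show ?thesis unfolding emeasure_lborel_inner_compact[OF assms(2) ne(2)] .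
qed

text \<open>Fubini's theorem on the region below the graph of \<open>f\<close>. The indicator of
  \<open>{0..}\<close> is there because \<open>ennreal\<close> sends negative numbers to 0.\<close>

lemma nn_integral_layer_cake:
  fixes f :: "real \<Rightarrow> ennreal"
  assumes [measurable]: "f \<in> borel_measurable borel"
  shows "(\<integral>\<^sup>+x. f x \<partial>lborel) = (\<integral>\<^sup>+t. indicator {0..} t * emeasure lborel {x. ennreal t < f x} \<partial>lborel)"
proof -
  have lc: "(\<integral>\<^sup>+t. indicator {t. 0 \<le> t \<and> ennreal t < y} t \<partial>lborel) = y" for y
  proof (cases y)
    case (real r)
    then have "{t. 0 \<le> t \<and> ennreal t < y} = {0..<r}" by (auto simp: ennreal_less_iff)
    then show ?thesis using real by simp
  next
    case top
    then have "{t. 0 \<le> t \<and> ennreal t < y} = {0..}" by auto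
    moreover have "emeasure lborel {0::real..} = \<infinity>"
    proof (rule ccontr)
      assume "emeasure lborel {0::real..} \<noteq> \<infinity>"
      then obtain n where n: "emeasure lborel {0::real..} < of_nat n"
        using ennreal_Ex_less_of_nat by (auto simp: less_top)
      have "of_nat n \<le> emeasure lborel {0::real..}"
        using emeasure_mono[of "{0..real n}" "{0..}" lborel] by (simp add: ennreal_of_nat_eq_real_of_nat)
      then show False using n by simp
    qed
    ultimately show ?thesis using top by simp
  qed
  have "(\<integral>\<^sup>+x. f x \<partial>lborel) = (\<integral>\<^sup>+x. (\<integral>\<^sup>+t. indicator {t. 0 \<le> t \<and> ennreal t < f x} t \<partial>lborel) \<partial>lborel)"
    by (simp only: lc)
  also have "\<dots> = (\<integral>\<^sup>+x. (\<integral>\<^sup>+t. indicator {p. 0 \<le> snd p \<and> ennreal (snd p) < f (fst p)} (x, t) \<partial>lborel) \<partial>lborel)"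
    by (intro nn_integral_cong) (auto simp: indicator_def)
  also have "\<dots> = (\<integral>\<^sup>+t. (\<integral>\<^sup>+x. indicator {p. 0 \<le> snd p \<and> ennreal (snd p) < f (fst p)} (x, t) \<partial>lborel) \<partial>lborel)"
    by (rule lborel_pair.Fubini'[symmetric]) measurable
  also have "\<dots> = (\<integral>\<^sup>+t. indicator {0..} t * emeasure lborel {x. ennreal t < f x} \<partial>lborel)"
  proof (rule nn_integral_cong)
    fix t :: real
    have "(\<integral>\<^sup>+x. indicator {p. 0 \<le> snd p \<and> ennreal (snd p) < f (fst p)} (x, t) \<partial>lborel)
      = (\<integral>\<^sup>+x. indicator {0..} t * indicator {x. ennreal t < f x} x \<partial>lborel)"
      by (intro nn_integral_cong) (auto simp: indicator_def)
    also have "\<dots> = indicator {0..} t * emeasure lborel {x. ennreal t < f x}"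
      by (subst nn_integral_cmult) auto
    finally show "(\<integral>\<^sup>+x. indicator {p. 0 \<le> snd p \<and> ennreal (snd p) < f (fst p)} (x, t) \<partial>lborel)
      = indicator {0..} t * emeasure lborel {x. ennreal t < f x}" .
  qed
  finally show ?thesis .
qed

lemma ennreal_AM_GM: "4 * (x * y) \<le> (x + y)\<^sup>2" for x y :: ennreal
proof (cases x; cases y)
  fix r s assume [simp]: "0 \<le> r" "x = ennreal r" "0 \<le> s" "y = ennreal s"
  have "4 * (r * s) \<le> (r + s)\<^sup>2"
    using sum_squares_bound[of r s] by (simp add: power2_sum)
  then have "ennreal (4 * (r * s)) \<le> ennreal ((r + s)\<^sup>2)" by (rule ennreal_leI)
  then show "4 * (x * y) \<le> (x + y)\<^sup>2"
    by (simp add: ennreal_mult ennreal_power[symmetric] ennreal_plus)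
qed (auto simp: power2_eq_square ennreal_mult_top ennreal_top_mult)

text \<open>Once both suprema equal \<open>1\<close>, the superlevel sets of \<open>f\<close> and \<open>g\<close> are simultaneously nonempty.\<close>

lemma prekopa_leindler_normalized:
  fixes f g h :: "real \<Rightarrow> ennreal"
  assumes [measurable]: "f \<in> borel_measurable borel" "g \<in> borel_measurable borel" "h \<in> borel_measurable borel"
    and mid: "\<And>x y. f x * g y \<le> (h ((x + y) / 2))\<^sup>2"
    and sup: "(SUP x. f x) = 1" "(SUP x. g x) = 1"
  shows "(\<integral>\<^sup>+x. f x \<partial>lborel) + (\<integral>\<^sup>+x. g x \<partial>lborel) \<le> 2 * (\<integral>\<^sup>+x. h x \<partial>lborel)"
proof -
  have le1: "f x \<le> 1" "g x \<le> 1" for x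
    using SUP_upper[of x UNIV f] SUP_upper[of x UNIV g] sup by auto
  have "emeasure lborel {x. ennreal t < f x} + emeasure lborel {x. ennreal t < g x}
      \<le> 2 * emeasure lborel {x. ennreal t < h x}" if t: "0 \<le> t" for t
  proof (cases "t < 1")
    case True
    then have "ennreal t < (SUP x. f x)" "ennreal t < (SUP x. g x)"
      using t unfolding sup by (simp_all add: ennreal_less_one_iff)
    then have ne: "{x. ennreal t < f x} \<noteq> {}" "{x. ennreal t < g x} \<noteq> {}"
      by (auto simp: less_SUP_iff)
    show ?thesis
    proof (rule emeasure_lborel_midpoints[OF _ _ _ ne])
      fix a b assume ab: "a \<in> {x. ennreal t < f x}" "b \<in> {x. ennreal t < g x}"
      have "f a \<noteq> top" "g b \<noteq> top" using le1[of a] le1[of b] by (auto simp: top_unique)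
      then obtain u v where uv: "0 \<le> u" "f a = ennreal u" "0 \<le> v" "g b = ennreal v"
        by (metis ennreal_cases infinity_ennreal_def)
      have "t < u" "t < v" using ab t uv by (auto simp: ennreal_less_iff)
      then have "t * t < u * v" using t by (intro mult_strict_mono') auto
      then have "ennreal t * ennreal t < f a * g b"
        using uv t by (simp add: ennreal_mult[symmetric] ennreal_less_iff)
      also have "\<dots> \<le> (h ((a + b) / 2))\<^sup>2" by (rule mid)
      finally have lt: "ennreal t * ennreal t < h ((a + b) / 2) * h ((a + b) / 2)"
        by (simp add: power2_eq_square)
      have "\<not> h ((a + b) / 2) \<le> ennreal t"
      proof
        assume "h ((a + b) / 2) \<le> ennreal t"
        then have "h ((a + b) / 2) * h ((a + b) / 2) \<le> ennreal t * ennreal t" by (intro mult_mono) auto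
        then show False using lt by simp
      qed
      then show "(a + b) / 2 \<in> {x. ennreal t < h x}" by simp
    qed measurable
  next
    case False
    then have "1 \<le> ennreal t" using ennreal_leI[of 1 t] by simp
    then have "f x \<le> ennreal t" "g x \<le> ennreal t" for x
      using le1[of x] order_trans by blast+
    then have "{x. ennreal t < f x} = {}" "{x. ennreal t < g x} = {}"
      by (auto simp: not_less)
    then show ?thesis by (simp only: emeasure_empty) simp
  qed
  then have "(\<integral>\<^sup>+t. indicator {0..} t * emeasure lborel {x. ennreal t < f x} + indicator {0..} t * emeasure lborel {x. ennreal t < g x} \<partial>lborel)
    \<le> (\<integral>\<^sup>+t. 2 * (indicator {0..} t * emeasure lborel {x. ennreal t < h x}) \<partial>lborel)"
    by (intro nn_integral_mono) (auto simp: indicator_def)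
  then show ?thesis
    unfolding nn_integral_layer_cake[OF assms(1)] nn_integral_layer_cake[OF assms(2)] nn_integral_layer_cake[OF assms(3)]
    by (subst (asm) nn_integral_add, measurable, subst (asm) nn_integral_cmult, measurable) 
qed

text \<open>Dividing \<open>f\<close>, \<open>g\<close> and \<open>h\<close> by a^2, b^2 and ab
  keeps the midpoint hypothesis and makes both suprema 1. The additive conclusion then becomes
  multiplicative by the inequality of arithmetic and geometric means. Writing the suprema as squares
  makes their geometric mean simply ab.\<close>

lemma prekopa_leindler_bounded:
  fixes f g h :: "real \<Rightarrow> ennreal"
  assumes [measurable]: "f \<in> borel_measurable borel" "g \<in> borel_measurable borel" "h \<in> borel_measurable borel"
    and mid: "\<And>x y. f x * g y \<le> (h ((x + y) / 2))\<^sup>2"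
    and sup: "(SUP x. f x) = ennreal (a\<^sup>2)" "(SUP x. g x) = ennreal (b\<^sup>2)" and ab: "0 < a" "0 < b"
  shows "(\<integral>\<^sup>+x. f x \<partial>lborel) * (\<integral>\<^sup>+x. g x \<partial>lborel) \<le> (\<integral>\<^sup>+x. h x \<partial>lborel)\<^sup>2"
proof -
  let ?F = "\<integral>\<^sup>+x. f x \<partial>lborel" and ?G = "\<integral>\<^sup>+x. g x \<partial>lborel" and ?H = "\<integral>\<^sup>+x. h x \<partial>lborel"
  define u where "u = ennreal (1 / a\<^sup>2)"
  define v where "v = ennreal (1 / b\<^sup>2)"
  define w where "w = ennreal (1 / (a * b))"
  have uv: "u * v = w\<^sup>2" using ab
    by (simp add: u_def v_def w_def ennreal_power flip: ennreal_mult) (simp add: power_mult_distrib power_divide)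
  have "u * ?F + v * ?G = (\<integral>\<^sup>+x. u * f x \<partial>lborel) + (\<integral>\<^sup>+x. v * g x \<partial>lborel)"
    by (simp add: nn_integral_cmult)
  also have "\<dots> \<le> 2 * (\<integral>\<^sup>+x. w * h x \<partial>lborel)"
  proof (rule prekopa_leindler_normalized)
    show "u * f x * (v * g y) \<le> (w * h ((x + y) / 2))\<^sup>2" for x y
    proof -
      have "u * f x * (v * g y) = w\<^sup>2 * (f x * g y)" unfolding uv[symmetric] by (simp add: mult_ac)
      also have "\<dots> \<le> w\<^sup>2 * (h ((x + y) / 2))\<^sup>2" by (intro mult_left_mono mid) auto
      finally show ?thesis by (simp add: power_mult_distrib)
    qed
    show "(SUP x. u * f x) = 1" "(SUP x. v * g x) = 1"
      unfolding SUP_mult_left_ennreal[symmetric] sup u_def v_def using ab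
      by (simp_all flip: ennreal_mult)
  qed measurable
  also have "\<dots> = 2 * (w * ?H)" by (simp add: nn_integral_cmult)
  finally have "(u * ?F + v * ?G)\<^sup>2 \<le> (2 * (w * ?H))\<^sup>2" by (intro power_mono) auto
  then have "4 * (u * ?F * (v * ?G)) \<le> (2 * (w * ?H))\<^sup>2"
    using ennreal_AM_GM[of "u * ?F" "v * ?G"] by (rule order_trans[rotated])
  moreover have "u * ?F * (v * ?G) = w\<^sup>2 * (?F * ?G)" unfolding uv[symmetric] by (simp add: mult_ac)
  ultimately have "4 * (w\<^sup>2 * (?F * ?G)) \<le> 4 * (w\<^sup>2 * ?H\<^sup>2)" by (simp add: power_mult_distrib)
  then have "w\<^sup>2 * (?F * ?G) \<le> w\<^sup>2 * ?H\<^sup>2"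
    by (simp add: ennreal_mult_le_mult_iff)
  moreover have "w\<^sup>2 \<noteq> 0" "w\<^sup>2 \<noteq> top"
    using ab by (auto simp: w_def ennreal_power)
  ultimately show ?thesis by (simp only: ennreal_mult_le_mult_iff not_False_eq_True)
qed

text \<open>Truncating \<open>f\<close> and \<open>g\<close> at natural heights keeps the hypothesis
  with the same \<open>h\<close> and makes the suprema finite; monotone convergence removes the
  truncation. If a supremum is 0, that function vanishes and so does the left-hand side.\<close>

lemma prekopa_leindler_real:
  fixes f g h :: "real \<Rightarrow> ennreal"
  assumes [measurable]: "f \<in> borel_measurable borel" "g \<in> borel_measurable borel" "h \<in> borel_measurable borel"
    and mid: "\<And>x y. f x * g y \<le> (h ((x + y) / 2))\<^sup>2"
  shows "(\<integral>\<^sup>+x. f x \<partial>lborel) * (\<integral>\<^sup>+x. g x \<partial>lborel) \<le> (\<integral>\<^sup>+x. h x \<partial>lborel)\<^sup>2"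
proof -
  have trunc: "(SUP j. min y (of_nat j)) = y" for y :: ennreal
  proof (cases "y = top")
    case True
    then show ?thesis by (simp add: ennreal_SUP_of_nat_eq_top)
  next
    case False
    then obtain n where "y < of_nat n" using ennreal_Ex_less_of_nat by (auto simp: less_top)
    then have "min y (of_nat n) = y" by simp
    then show ?thesis by (intro antisym SUP_least) (auto intro: SUP_upper2[of n])
  qed
  have inc: "incseq (\<lambda>j x. min (F x) (of_nat j))" for F :: "real \<Rightarrow> ennreal"
    by (auto simp: incseq_def le_fun_def intro: min.coboundedI2)
  have conv: "(\<integral>\<^sup>+x. F x \<partial>lborel) = (SUP j. \<integral>\<^sup>+x. min (F x) (of_nat j) \<partial>lborel)"
    if [measurable]: "F \<in> borel_measurable borel" for F :: "real \<Rightarrow> ennreal"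
    using nn_integral_monotone_convergence_SUP[OF inc[of F], of lborel] trunc by simp
  have root: "\<exists>a>0. (SUP x. min (F x) (of_nat j)) = ennreal (a\<^sup>2)"
    if "(SUP x. min (F x) (of_nat j)) \<noteq> 0" for F :: "real \<Rightarrow> ennreal" and j :: nat
  proof -
    have "(SUP x. min (F x) (of_nat j)) \<le> of_nat j" by (intro SUP_least) auto
    then have "(SUP x. min (F x) (of_nat j)) < top" using of_nat_less_top le_less_trans by blast
    then obtain r where r: "0 \<le> r" "(SUP x. min (F x) (of_nat j)) = ennreal r"
      by (metis ennreal_cases infinity_ennreal_def less_irrefl)
    then show ?thesis using that by (intro exI[of _ "sqrt r"]) auto
  qed
  have "(\<integral>\<^sup>+x. min (f x) (of_nat j) \<partial>lborel) * (\<integral>\<^sup>+x. min (g x) (of_nat k) \<partial>lborel) \<le> (\<integral>\<^sup>+x. h x \<partial>lborel)\<^sup>2" for j k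
  proof (cases "(SUP x. min (f x) (of_nat j)) = 0 \<or> (SUP x. min (g x) (of_nat k)) = 0")
    case True
    then have "(\<forall>x. min (f x) (of_nat j) = 0) \<or> (\<forall>x. min (g x) (of_nat k) = 0)"
      by (simp add: SUP_eq_iff bot_ennreal flip: bot_ennreal)
    then show ?thesis by (elim disjE) simp_all
  next
    case False
    then obtain a b where "0 < a" "0 < b" "(SUP x. min (f x) (of_nat j)) = ennreal (a\<^sup>2)"
      "(SUP x. min (g x) (of_nat k)) = ennreal (b\<^sup>2)" using root[of f j] root[of g k] by blast
    moreover have "min (f x) (of_nat j) * min (g y) (of_nat k) \<le> (h ((x + y) / 2))\<^sup>2" for x y
      by (rule order_trans[OF mult_mono mid[of x y]]) auto
    ultimately show ?thesis by (intro prekopa_leindler_bounded[where a=a and b=b]) measurable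
  qed
  then show ?thesis
    unfolding conv[OF assms(1)] conv[OF assms(2)]
    by (simp add: SUP_mult_left_ennreal SUP_mult_right_ennreal SUP_le_iff)
qed

text \<open>The inequality on one line is exactly the midpoint hypothesis for the functions obtained
  by integrating out coordinate \<open>i\<close>, so the statement reproduces itself under induction
  on the coordinates. Points are taken in \<open>extensional I\<close>, as in the product
  space.\<close>

lemma prekopa_leindler_PiM:
  fixes f g h :: "('i \<Rightarrow> real) \<Rightarrow> ennreal"
  assumes "finite I"
    and "f \<in> borel_measurable (\<Pi>\<^sub>M i\<in>I. lborel)" "g \<in> borel_measurable (\<Pi>\<^sub>M i\<in>I. lborel)"
      "h \<in> borel_measurable (\<Pi>\<^sub>M i\<in>I. lborel)"
    and "\<And>x y. x \<in> extensional I \<Longrightarrow> y \<in> extensional I \<Longrightarrow> f x * g y \<le> (h (\<lambda>i\<in>I. (x i + y i) / 2))\<^sup>2"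
  shows "(\<integral>\<^sup>+x. f x \<partial>(\<Pi>\<^sub>M i\<in>I. lborel)) * (\<integral>\<^sup>+x. g x \<partial>(\<Pi>\<^sub>M i\<in>I. lborel)) \<le> (\<integral>\<^sup>+x. h x \<partial>(\<Pi>\<^sub>M i\<in>I. lborel))\<^sup>2"
  using assms
proof (induction I arbitrary: f g h)
  case empty
  interpret product_sigma_finite "\<lambda>i::'i. lborel :: real measure" by standard
  have "f (\<lambda>_. undefined) * g (\<lambda>_. undefined) \<le> (h (\<lambda>i\<in>{}. ((\<lambda>_. undefined) i + (\<lambda>_. undefined) i) / 2))\<^sup>2"
    by (rule empty.prems) auto
  then show ?case by (simp add: nn_integral_empty restrict_def)
next
  case (insert i I)
  interpret product_sigma_finite "\<lambda>i::'i. lborel :: real measure" by standard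
  note [measurable] = insert.prems(1-3)
  have eq: "(\<integral>\<^sup>+x. F x \<partial>(\<Pi>\<^sub>M i\<in>insert i I. lborel)) = (\<integral>\<^sup>+x. (\<integral>\<^sup>+t. F (x(i := t)) \<partial>lborel) \<partial>(\<Pi>\<^sub>M i\<in>I. lborel))"
    if "F \<in> borel_measurable (\<Pi>\<^sub>M i\<in>insert i I. lborel)" for F :: "('i \<Rightarrow> real) \<Rightarrow> ennreal"
    by (rule product_nn_integral_insert[OF insert.hyps that])
  have meas: "(\<lambda>x. \<integral>\<^sup>+t. F (x(i := t)) \<partial>lborel) \<in> borel_measurable (\<Pi>\<^sub>M i\<in>I. lborel)"
    if [measurable]: "F \<in> borel_measurable (\<Pi>\<^sub>M i\<in>insert i I. lborel)" for F :: "('i \<Rightarrow> real) \<Rightarrow> ennreal"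
    by measurable
  have meas1: "(\<lambda>t. F (x(i := t))) \<in> borel_measurable borel"
    if [measurable]: "F \<in> borel_measurable (\<Pi>\<^sub>M i\<in>insert i I. lborel)" and "x \<in> extensional I"
    for F :: "('i \<Rightarrow> real) \<Rightarrow> ennreal" and x
  proof -
    have "x \<in> space (\<Pi>\<^sub>M i\<in>I. (lborel :: real measure))" using that(2) by (simp add: space_PiM PiE_def)
    from measurable_comp[OF measurable_component_update[OF this insert.hyps(2)] that(1)]
    show ?thesis by (simp add: comp_def)
  qed
  show ?case
    unfolding eq[OF insert.prems(1)] eq[OF insert.prems(2)] eq[OF insert.prems(3)]
  proof (rule insert.IH)
    fix x y :: "'i \<Rightarrow> real" assume x: "x \<in> extensional I" and y: "y \<in> extensional I"
    let ?z = "\<lambda>i\<in>I. (x i + y i) / 2"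
    show "(\<integral>\<^sup>+t. f (x(i := t)) \<partial>lborel) * (\<integral>\<^sup>+t. g (y(i := t)) \<partial>lborel)
      \<le> (\<integral>\<^sup>+t. h (?z(i := t)) \<partial>lborel)\<^sup>2"
    proof (rule prekopa_leindler_real)
      fix s t
      have "f (x(i := s)) * g (y(i := t)) \<le> (h (\<lambda>j\<in>insert i I. ((x(i := s)) j + (y(i := t)) j) / 2))\<^sup>2"
        using x y by (intro insert.prems(4)) (auto simp: extensional_def)
      also have "(\<lambda>j\<in>insert i I. ((x(i := s)) j + (y(i := t)) j) / 2) = ?z(i := (s + t) / 2)"
        using insert.hyps(2) by (auto simp: fun_eq_iff)
      finally show "f (x(i := s)) * g (y(i := t)) \<le> (h (?z(i := (s + t) / 2)))\<^sup>2" .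
    qed (use x y in \<open>auto intro: meas1 insert.prems\<close>)
  qed (intro meas insert.prems)+
qed

text \<open>Apply the functional inequality to the indicators of \<open>A\<close>, \<open>B\<close>
  and the set of midpoints.\<close>

lemma brunn_minkowski_midpoint:
  fixes A B :: "'a::euclidean_space set"
  assumes A: "compact A" and B: "compact B"
  shows "measure lebesgue A * measure lebesgue B \<le> (measure lebesgue ((*\<^sub>R) (1/2) ` (A + B)))\<^sup>2"
proof -
  let ?H = "(*\<^sub>R) (1/2) ` (A + B)"
  let ?\<phi> = "\<lambda>f. \<Sum>b\<in>Basis. f b *\<^sub>R (b :: 'a)"
  have H: "compact ?H" using A B by (intro compact_scaling compact_set_plus)
  have m: "(\<lambda>f. indicator S (?\<phi> f) :: ennreal) \<in> borel_measurable (\<Pi>\<^sub>M b\<in>Basis. lborel)" if "compact S" for S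
  proof -
    have [measurable]: "S \<in> sets borel" using that by (rule borel_compact)
    show ?thesis by measurable
  qed
  have e: "(\<integral>\<^sup>+f. indicator S (?\<phi> f) \<partial>(\<Pi>\<^sub>M b\<in>Basis. lborel)) = ennreal (measure lebesgue S)" if "compact S" for S
  proof -
    have [measurable]: "S \<in> sets borel" using that by (rule borel_compact)
    have "ennreal (measure lebesgue S) = (\<integral>\<^sup>+x. indicator S x \<partial>lborel)"
      using emeasure_lborel_compact[OF that] by simp
    also have "\<dots> = (\<integral>\<^sup>+f. indicator S (?\<phi> f) \<partial>(\<Pi>\<^sub>M b\<in>Basis. lborel))"
      by (subst lborel_eq, subst nn_integral_distr) measurable
    finally show ?thesis ..
  qed
  have "ennreal (measure lebesgue A) * ennreal (measure lebesgue B) \<le> (ennreal (measure lebesgue ?H))\<^sup>2"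
    unfolding e[OF A, symmetric] e[OF B, symmetric] e[OF H, symmetric]
  proof (rule prekopa_leindler_PiM[OF finite_Basis m[OF A] m[OF B] m[OF H]])
    fix x y :: "'a \<Rightarrow> real"
    have "?\<phi> (\<lambda>i\<in>Basis. (x i + y i) / 2) = (\<Sum>b\<in>Basis. (1/2) *\<^sub>R (x b *\<^sub>R b + y b *\<^sub>R b))"
      by (intro sum.cong) (auto simp: algebra_simps add_divide_distrib)
    also have "\<dots> = (1/2) *\<^sub>R (?\<phi> x + ?\<phi> y)"
      by (simp only: scaleR_sum_right[symmetric] sum.distrib)
    finally have "?\<phi> (\<lambda>i\<in>Basis. (x i + y i) / 2) = (1/2) *\<^sub>R (?\<phi> x + ?\<phi> y)" .
    then show "indicator A (?\<phi> x) * indicator B (?\<phi> y) \<le> ((indicator ?H (?\<phi> (\<lambda>i\<in>Basis. (x i + y i) / 2)))\<^sup>2 :: ennreal)"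
      by (auto simp: indicator_def)
  qed
  then show ?thesis by (simp add: ennreal_power flip: ennreal_mult)
qed

lemma convex_scaleR_set_plus:
  fixes K :: "'a::real_vector set"
  assumes "convex K" "0 \<le> a" "0 \<le> b"
  shows "(*\<^sub>R) a ` K + (*\<^sub>R) b ` K = (*\<^sub>R) (a + b) ` K"
proof
  show "(*\<^sub>R) (a + b) ` K \<subseteq> (*\<^sub>R) a ` K + (*\<^sub>R) b ` K"
    by (force simp: set_plus_def scaleR_left_distrib)
  show "(*\<^sub>R) a ` K + (*\<^sub>R) b ` K \<subseteq> (*\<^sub>R) (a + b) ` K"
  proof (cases "a + b = 0")
    case True
    then have "a = 0" "b = 0" using assms by auto
    then show ?thesis by (auto simp: set_plus_def)
  next
    case False
    show ?thesis
    proof (clarsimp simp: set_plus_def)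
      fix x y assume "x \<in> K" "y \<in> K"
      then have "(a / (a + b)) *\<^sub>R x + (b / (a + b)) *\<^sub>R y \<in> K"
        using assms False by (intro convexD) (auto simp: add_divide_distrib[symmetric])
      moreover have "a *\<^sub>R x + b *\<^sub>R y = (a + b) *\<^sub>R ((a / (a + b)) *\<^sub>R x + (b / (a + b)) *\<^sub>R y)"
        using False by (simp add: scaleR_right_distrib)
      ultimately show "a *\<^sub>R x + b *\<^sub>R y \<in> (*\<^sub>R) (a + b) ` K" by blast
    qed
  qed
qed

text \<open>The midpoint of \<open>K\<close> with one combination is the next combination, so the
  midpoint inequality can be iterated. Dyadic weights are enough because only weights tending to 0
  are used later.\<close>

lemma brunn_minkowski_dyadic:
  fixes K Z :: "'a::euclidean_space set"
  assumes K: "compact K" "convex K" and Z: "compact Z" and le: "measure lebesgue K \<le> measure lebesgue Z"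
  shows "measure lebesgue K \<le> measure lebesgue ((*\<^sub>R) (1 - 1 / 2 ^ k) ` K + (*\<^sub>R) (1 / 2 ^ k) ` Z)"
proof (induction k)
  case 0
  show ?case
  proof (cases "K = {}")
    case False
    then have "(*\<^sub>R) (0::real) ` K = {0}" by auto
    then show ?thesis using le by (simp add: set_plus_zero)
  qed simp
next
  case (Suc k)
  let ?Z = "\<lambda>k. (*\<^sub>R) (1 - 1 / 2 ^ k :: real) ` K + (*\<^sub>R) (1 / 2 ^ k) ` Z"
  have c: "compact (?Z k)" using K Z by (intro compact_set_plus compact_scaling)
  have eq: "(*\<^sub>R) (1/2) ` (K + ?Z k) = ?Z (Suc k)"
  proof -
    have "(*\<^sub>R) (1/2) ` (K + ?Z k) = ((*\<^sub>R) (1/2) ` K + (*\<^sub>R) (1/2 * (1 - 1 / 2 ^ k)) ` K) + (*\<^sub>R) (1/2 * (1 / 2 ^ k)) ` Z"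
      by (simp only: image_scaleR_set_plus scaleR_image_scaleR add.assoc)
    also have "(*\<^sub>R) (1/2) ` K + (*\<^sub>R) (1/2 * (1 - 1 / 2 ^ k)) ` K = (*\<^sub>R) (1/2 + 1/2 * (1 - 1 / 2 ^ k)) ` K"
      by (rule convex_scaleR_set_plus[OF K(2)]) auto
    finally show ?thesis by (simp add: field_simps)
  qed
  have "(measure lebesgue K)\<^sup>2 \<le> measure lebesgue K * measure lebesgue (?Z k)"
    unfolding power2_eq_square by (intro mult_left_mono Suc.IH) auto
  also have "\<dots> \<le> (measure lebesgue (?Z (Suc k)))\<^sup>2"
    using brunn_minkowski_midpoint[OF K(1) c] unfolding eq .
  finally show ?case by (rule power2_le_imp_le) simp
qed

section \<open>Total length and volume of a zonotope\<close>

lemma shadow_cball: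
  fixes \<xi> :: "'a::euclidean_space"
  assumes "norm \<xi> = 1" "0 < r"
  shows "shadow \<xi> (cball 0 r) = r ^ (DIM('a) - 1) * unit_ball_vol (real DIM('a) - 1)"
proof -
  have "cball 0 r = (*\<^sub>R) r ` (cball 0 1 :: 'a set)" using assms by (simp add: cball_scale)
  then show ?thesis using assms by (simp add: shadow_scaleR shadow_unit_cball)
qed

lemma vol_cball: "0 \<le> r \<Longrightarrow> measure lebesgue (cball 0 r :: 'a::euclidean_space set) = r ^ DIM('a) * unit_ball_vol (real DIM('a))"
  using content_cball[of r "0 :: 'a"] by (simp add: measure_completion)

lemma real_DIM_ge_1: "1 \<le> real DIM('a::euclidean_space)"
proof -
  have "DIM('a) \<ge> 1" by simp
  then show ?thesis by linarith
qed

text \<open>Compare \<open>(1 - \<lambda>) B + \<lambda> Z\<close> with the unit ball \<open>B\<close>, for \<open>Z\<close> scaled to the volume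
  of \<open>B\<close>, to first order in \<open>\<lambda>\<close>: this is Urysohn's inequality for zonotopes.\<close>

lemma total_length_lower_bound:
  fixes vs :: "'a::euclidean_space list"
  shows "real DIM('a) * ball_const DIM('a) * measure lebesgue (zonotope vs) powr (1 / real DIM('a)) \<le> total_length vs"
proof (cases "measure lebesgue (zonotope vs) = 0")
  case True
  have "0 \<le> total_length vs" by (intro sum_list_nonneg) auto
  then show ?thesis using True by simp
next
  case False
  let ?n = "DIM('a)"
  define V where "V = measure lebesgue (zonotope vs)"
  define b where "b = unit_ball_vol (real ?n - 1)"
  define \<beta> where "\<beta> = unit_ball_vol (real ?n)"
  define \<rho> where "\<rho> = (\<beta> / V) powr (1 / real ?n)"
  define W where "W = total_length vs"
  have n1: "1 \<le> real ?n" by (rule real_DIM_ge_1)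
  have pos: "0 < V" "0 < b" "0 < \<beta>" using False n1 by (auto simp: V_def b_def \<beta>_def zero_less_measure_iff)
  then have \<rho>: "0 < \<rho>" by (simp add: \<rho>_def)
  have \<rho>n: "\<rho> ^ ?n = \<beta> / V" using pos n1
    by (simp add: \<rho>_def powr_realpow[symmetric] powr_powr)
  obtain R where R: "0 < R" "zonotope vs \<subseteq> cball 0 R"
    using compact_imp_bounded[OF compact_zonotope[of vs]] unfolding bounded_pos subset_iff mem_cball_0 by blast
  have step: "\<beta> * (\<Sum>i<?n. (1 - 1 / 2 ^ k) ^ i) \<le> (1 - 1 / 2 ^ k + 1 / 2 ^ k * \<rho> * R) ^ (?n - 1) * b * (\<rho> * W)" for k
  proof -
    define l :: real where "l = 1 / 2 ^ k"
    have l: "0 < l" "l \<le> 1" by (simp_all add: l_def)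
    \<comment> \<open>The ball of radius \<open>r\<close> contains every partial sum, which bounds
      all their shadows at once; \<open>r\<close> tends to 1 with \<open>l\<close> tending to
      0.\<close>
    define r where "r = 1 - l + l * \<rho> * R"
    have r: "0 < r" using l \<rho> R(1) by (simp add: r_def add_nonneg_pos)
    have "measure lebesgue ((*\<^sub>R) \<rho> ` zonotope vs) = \<beta>"
      using \<rho> \<rho>n pos by (simp add: measure_lebesgue_scaleR_image V_def[symmetric])
    moreover have "measure lebesgue (cball 0 1 :: 'a set) = \<beta>" using vol_cball[of 1, where 'a='a] by (simp add: \<beta>_def)
    ultimately have "\<beta> \<le> measure lebesgue ((*\<^sub>R) (1 - l) ` cball 0 1 + (*\<^sub>R) l ` (*\<^sub>R) \<rho> ` zonotope vs)"
      unfolding l_def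
      using brunn_minkowski_dyadic[of "cball 0 1" "(*\<^sub>R) \<rho> ` zonotope vs" k]
      by (simp add: compact_scaling compact_zonotope)
    also have "(*\<^sub>R) (1 - l) ` cball 0 1 = (cball 0 (1 - l) :: 'a set)"
      using l cball_scale[of "1 - l" 0 "1::real"] by (cases "l = 1") (auto simp: image_constant_conv)
    also have "(*\<^sub>R) l ` (*\<^sub>R) \<rho> ` zonotope vs = zonotope (map ((*\<^sub>R) (l * \<rho>)) vs)"
      by (simp only: scaleR_image_scaleR flip: zonotope_scaleR)
    also have "measure lebesgue (cball 0 (1 - l) + zonotope (map ((*\<^sub>R) (l * \<rho>)) vs))
      \<le> measure lebesgue (cball 0 (1 - l) :: 'a set) + r ^ (?n - 1) * b * total_length (map ((*\<^sub>R) (l * \<rho>)) vs)"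
    proof (rule vol_add_zonotope_upper[where C = "cball 0 r"])
      show "cball 0 (1 - l) + zonotope (map ((*\<^sub>R) (l * \<rho>)) vs) \<subseteq> cball 0 r"
      proof
        fix x assume "x \<in> cball 0 (1 - l) + zonotope (map ((*\<^sub>R) (l * \<rho>)) vs)"
        then obtain y z where yz: "norm y \<le> 1 - l" "z \<in> zonotope vs" "x = y + (l * \<rho>) *\<^sub>R z"
          by (auto simp: set_plus_def zonotope_scaleR[symmetric])
        have "norm x \<le> norm y + l * \<rho> * norm z"
          unfolding yz using norm_triangle_ineq[of y "(l * \<rho>) *\<^sub>R z"] l \<rho> by simp
        also have "\<dots> \<le> (1 - l) + l * \<rho> * R"
          using yz R(2) l \<rho> by (intro add_mono mult_left_mono) auto
        finally show "x \<in> cball 0 r" by (simp add: r_def)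
      qed
      show "shadow \<xi> (cball 0 r) \<le> r ^ (?n - 1) * b" if "norm \<xi> = 1" for \<xi> :: 'a
        using that r by (simp add: shadow_cball b_def)
    qed auto
    also have "total_length (map ((*\<^sub>R) (l * \<rho>)) vs) = l * \<rho> * W"
      using l \<rho> by (simp add: W_def comp_def sum_list_const_mult abs_mult)
    also have "measure lebesgue (cball 0 (1 - l) :: 'a set) = (1 - l) ^ ?n * \<beta>"
      using l unfolding \<beta>_def by (intro vol_cball) simp
    finally have "\<beta> * (1 - (1 - l) ^ ?n) \<le> r ^ (?n - 1) * b * (l * \<rho> * W)" by (simp add: algebra_simps)
    \<comment> \<open>Factoring out \<open>l\<close> allows it to be cancelled, so that the
      first-order term is found by continuity at l = 0 instead of by differentiation.\<close>
    moreover have "1 - (1 - l) ^ ?n = l * (\<Sum>i<?n. (1 - l) ^ i)"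
      using one_diff_power_eq[of "1 - l" ?n] by simp
    ultimately have "l * (\<beta> * (\<Sum>i<?n. (1 - l) ^ i)) \<le> l * (r ^ (?n - 1) * b * (\<rho> * W))"
      by (simp add: mult_ac)
    then have "\<beta> * (\<Sum>i<?n. (1 - l) ^ i) \<le> r ^ (?n - 1) * b * (\<rho> * W)"
      using l by (simp only: mult_le_cancel_left_pos)
    then show ?thesis by (simp only: r_def l_def)
  qed
  have lim0: "(\<lambda>k. 1 / 2 ^ k :: real) \<longlonglongrightarrow> 0"
    using LIMSEQ_divide_realpow_zero[of 2 1] by simp
  have "(\<lambda>k. \<beta> * (\<Sum>i<?n. (1 - 1 / 2 ^ k) ^ i)) \<longlonglongrightarrow> \<beta> * (\<Sum>i<?n. (1 - 0) ^ i)"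
    by (intro tendsto_intros lim0)
  moreover have "(\<lambda>k. (1 - 1 / 2 ^ k + 1 / 2 ^ k * \<rho> * R) ^ (?n - 1) * b * (\<rho> * W))
      \<longlonglongrightarrow> (1 - 0 + 0 * \<rho> * R) ^ (?n - 1) * b * (\<rho> * W)"
    by (intro tendsto_intros lim0)
  ultimately have "\<beta> * (\<Sum>i<?n. (1 - 0) ^ i) \<le> (1 - 0 + 0 * \<rho> * R) ^ (?n - 1) * b * (\<rho> * W)"
    using step by (intro LIMSEQ_le) auto
  then have main: "real ?n * \<beta> \<le> b * \<rho> * W" by (simp add: mult_ac)
  \<comment> \<open>The constant emerges here: since \<open>\<rho>\<close> is the n-th root of
    \<beta>/V, the product of \<open>ball_const ?n\<close> and the n-th root of V equals \<beta>/(b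
    \<rho>).\<close>
  have "real ?n * ball_const ?n * V powr (1 / real ?n) = real ?n * \<beta> / (b * \<rho>)"
  proof -
    have "\<beta> powr ((real ?n - 1) / real ?n) = \<beta> / \<beta> powr (1 / real ?n)"
      using pos n1 by (simp add: diff_divide_distrib powr_diff)
    then show ?thesis using pos
      by (simp add: ball_const_def \<rho>_def powr_divide b_def[symmetric] \<beta>_def[symmetric] field_simps)
  qed
  also have "\<dots> \<le> W" using main pos \<rho> by (simp add: field_simps)
  finally show ?thesis unfolding V_def W_def .
qed

section \<open>Support functions\<close>

lemma support_fun_attained:
  assumes "compact K" "K \<noteq> {}"
  obtains k where "k \<in> K" "support_fun K x = x \<bullet> k"
proof -
  have "continuous_on K ((\<bullet>) x)" by (intro continuous_intros)
  then obtain k where k: "k \<in> K" "\<And>y. y \<in> K \<Longrightarrow> x \<bullet> y \<le> x \<bullet> k"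
    using continuous_attains_sup[OF assms] by blast
  have "support_fun K x = x \<bullet> k" unfolding support_fun_def
    using k by (intro cSup_eq_maximum) auto
  then show ?thesis using k(1) that by blast
qed

lemma support_fun_ge:
  assumes "compact K" "y \<in> K"
  shows "x \<bullet> y \<le> support_fun K x"
proof -
  have "compact ((\<bullet>) x ` K)" using assms by (intro compact_continuous_image continuous_intros)
  then show ?thesis unfolding support_fun_def
    using assms by (intro cSUP_upper bounded_imp_bdd_above compact_imp_bounded)
qed

lemma support_fun_set_plus:
  assumes "compact A" "A \<noteq> {}" "compact B" "B \<noteq> {}"
  shows "support_fun (A + B) x = support_fun A x + support_fun B x"
proof -
  have c: "compact (A + B)" using assms by (intro compact_set_plus)
  have ne: "A + B \<noteq> {}" using assms by (auto simp: set_plus_def)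
  obtain a where a: "a \<in> A" "support_fun A x = x \<bullet> a" using support_fun_attained assms by blast
  obtain b where b: "b \<in> B" "support_fun B x = x \<bullet> b" using support_fun_attained assms by blast
  obtain s where s: "s \<in> A + B" "support_fun (A + B) x = x \<bullet> s" using support_fun_attained[OF c ne] by blast
  obtain a' b' where ab: "a' \<in> A" "b' \<in> B" "s = a' + b'" using s(1) by (auto simp: set_plus_def)
  have "support_fun (A + B) x \<le> support_fun A x + support_fun B x"
    using support_fun_ge[OF assms(1) ab(1), of x] support_fun_ge[OF assms(3) ab(2), of x]
    by (simp add: s(2) ab(3) inner_add_right)
  moreover have "x \<bullet> (a + b) \<le> support_fun (A + B) x"
    using a b by (intro support_fun_ge[OF c] set_plus_intro)
  ultimately show ?thesis using a b by (simp add: inner_add_right)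
qed

lemma support_fun_scaleR:
  assumes "compact K" "K \<noteq> {}" "0 \<le> c"
  shows "support_fun ((*\<^sub>R) c ` K) x = c * support_fun K x"
proof -
  obtain k where k: "k \<in> K" "support_fun K x = x \<bullet> k" using support_fun_attained assms by blast
  have "support_fun ((*\<^sub>R) c ` K) x = c * (x \<bullet> k)"
    unfolding support_fun_def image_image
    using k assms support_fun_ge[OF assms(1), of _ x]
    by (intro cSup_eq_maximum) (auto intro!: mult_left_mono)
  then show ?thesis by (simp add: k)
qed

lemma support_fun_central_segment: "support_fun (central_segment v) x = \<bar>v \<bullet> x\<bar> / 2"
proof -
  have bound: "\<bar>x \<bullet> y\<bar> \<le> \<bar>v \<bullet> x\<bar> / 2" if "y \<in> central_segment v" for y
  proof -
    obtain u where u: "0 \<le> u" "u \<le> 1" "y = (1 - u) *\<^sub>R (- (v /\<^sub>R 2)) + u *\<^sub>R (v /\<^sub>R 2)"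
      using \<open>y \<in> central_segment v\<close> unfolding closed_segment_def by blast
    have "x \<bullet> y = (u - 1/2) * (v \<bullet> x)" unfolding u(3)
      by (simp add: inner_add_right inner_diff_right inner_commute field_simps)
    moreover have "\<bar>u - 1/2\<bar> \<le> 1/2" using u(1,2) unfolding abs_le_iff by linarith
    ultimately have "\<bar>x \<bullet> y\<bar> \<le> 1/2 * \<bar>v \<bullet> x\<bar>"
      unfolding abs_mult by (metis abs_ge_zero abs_mult mult_right_mono)
    then show ?thesis by simp
  qed
  obtain k where k: "k \<in> central_segment v" "support_fun (central_segment v) x = x \<bullet> k"
    using support_fun_attained[of "central_segment v"] by auto
  have "x \<bullet> (v /\<^sub>R 2) \<le> support_fun (central_segment v) x"
    "x \<bullet> (- (v /\<^sub>R 2)) \<le> support_fun (central_segment v) x"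
    by (intro support_fun_ge; simp)+
  then have "\<bar>v \<bullet> x\<bar> / 2 \<le> support_fun (central_segment v) x" by (simp add: inner_commute abs_if)
  then show ?thesis using bound[OF k(1)] k(2) by linarith
qed

lemma support_fun_zonotope: "support_fun (zonotope vs) x = (\<Sum>v\<leftarrow>vs. \<bar>v \<bullet> x\<bar>) / 2"
proof (induction vs)
  case Nil
  show ?case by (simp add: support_fun_def)
next
  case (Cons v vs)
  have "zonotope vs \<noteq> {}" using zero_mem_zonotope by blast
  then have "support_fun (zonotope (v # vs)) x = support_fun (central_segment v) x + support_fun (zonotope vs) x"
    unfolding zonotope.simps by (intro support_fun_set_plus) (auto simp: compact_zonotope)
  then show ?case by (simp only: support_fun_central_segment Cons.IH) (simp add: add_divide_distrib)
qed

lemma subset_of_support_fun_le: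
  fixes K K' :: "'a::euclidean_space set"
  assumes K: "compact K" and K': "compact K'" "convex K'" "K' \<noteq> {}"
    and le: "\<And>\<theta>. norm \<theta> = 1 \<Longrightarrow> support_fun K \<theta> \<le> support_fun K' \<theta>"
  shows "K \<subseteq> K'"
proof
  fix z assume z: "z \<in> K"
  show "z \<in> K'"
  proof (rule ccontr)
    assume "z \<notin> K'"
    then obtain a b where ab: "a \<bullet> z < b" "\<And>x. x \<in> K' \<Longrightarrow> b < a \<bullet> x"
      using separating_hyperplane_closed_point[OF K'(2) compact_imp_closed[OF K'(1)]] by blast
    have "a \<noteq> 0" using ab K'(3) by fastforce
    \<comment> \<open>The hyperplane has \<open>K'\<close> on its upper side, so the direction in
      which \<open>z\<close> lies beyond \<open>K'\<close> is -a; it is normalized because support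
      functions are compared only on unit vectors.\<close>
    define \<theta> where "\<theta> = - sgn a"
    have \<theta>: "norm \<theta> = 1" using \<open>a \<noteq> 0\<close> by (simp add: \<theta>_def norm_sgn)
    obtain k where k: "k \<in> K'" "support_fun K' \<theta> = \<theta> \<bullet> k" using support_fun_attained[OF K'(1,3)] by blast
    have "\<theta> \<bullet> z \<le> \<theta> \<bullet> k" using support_fun_ge[OF K z, of \<theta>] le[OF \<theta>] k(2) by linarith
    then have "norm a * (sgn a \<bullet> k) \<le> norm a * (sgn a \<bullet> z)" by (intro mult_left_mono) (auto simp: \<theta>_def)
    then have "a \<bullet> k \<le> a \<bullet> z" by (simp flip: inner_scaleR_left add: norm_scaleR_sgn)
    then show False using ab(1) ab(2)[OF k(1)] by linarith
  qed
qed

section \<open>The squared distance function\<close>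

text \<open>With this criterion the derivative of the squared distance follows from two inequalities
  about closest points, without differentiating the closest-point map.\<close>

lemma DERIV_of_quadratic_bound:
  fixes f :: "real \<Rightarrow> real"
  assumes "\<And>y. \<bar>f y - f x - c * (y - x)\<bar> \<le> K * (y - x)\<^sup>2"
  shows "(f has_real_derivative c) (at x)"
  unfolding DERIV_def LIM_zero_iff[symmetric, of _ c]
proof (rule Lim_null_comparison)
  show "\<forall>\<^sub>F h in at 0. norm ((f (x + h) - f x) / h - c) \<le> \<bar>K * h\<bar>"
  proof (rule eventually_at_topological[THEN iffD2], intro exI[of _ UNIV] conjI ballI impI)
    fix h :: real assume h: "h \<noteq> 0"
    have "(f (x + h) - f x) / h - c = (f (x + h) - f x - c * h) / h"
      using h by (simp add: field_simps)
    then have "\<bar>h\<bar> * \<bar>(f (x + h) - f x) / h - c\<bar> = \<bar>f (x + h) - f x - c * h\<bar>"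
      using h by (simp add: abs_divide)
    also have "\<dots> \<le> K * h\<^sup>2" using assms[of "x + h"] by simp
    also have "\<dots> \<le> \<bar>K\<bar> * h\<^sup>2" by (intro mult_right_mono) auto
    also have "\<dots> = \<bar>h\<bar> * \<bar>K * h\<bar>" by (simp add: abs_mult power2_eq_square abs_mult_self_eq mult_ac)
    finally show "norm ((f (x + h) - f x) / h - c) \<le> \<bar>K * h\<bar>" using h by simp
  qed auto
  show "((\<lambda>h. \<bar>K * h\<bar>) \<longlongrightarrow> 0) (at 0)" by (intro tendsto_eq_intros) auto
qed

text \<open>Squaring removes the kink of the positive part, which is why the cutoff below is a
  square.\<close>

lemma DERIV_max_0_power2: "((\<lambda>a. (max 0 a)\<^sup>2) has_real_derivative 2 * max 0 x) (at x)"
proof (rule DERIV_of_quadratic_bound[where K = 1])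
  fix y :: real
  show "\<bar>(max 0 y)\<^sup>2 - (max 0 x)\<^sup>2 - 2 * max 0 x * (y - x)\<bar> \<le> 1 * (y - x)\<^sup>2"
  proof (cases "0 \<le> x")
    case x: True
    show ?thesis
    proof (cases "0 \<le> y")
      case True
      have "y\<^sup>2 - x\<^sup>2 - 2 * x * (y - x) = (y - x)\<^sup>2" by (simp add: power2_eq_square algebra_simps)
      then show ?thesis using x True by simp
    next
      case False
      have "- x\<^sup>2 - 2 * x * (y - x) = x * (x - 2 * y)" by (simp add: power2_eq_square algebra_simps)
      moreover have "0 \<le> x * (x - 2 * y)" using x False by simp
      moreover have "x * (x - 2 * y) \<le> (y - x)\<^sup>2" by (simp add: power2_eq_square algebra_simps)
      ultimately show ?thesis using x False by simp
    qed
  next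
    case x: False
    show ?thesis
    proof (cases "0 \<le> y")
      case True
      have "y\<^sup>2 \<le> (y - x)\<^sup>2" using x True by (intro power_mono) auto
      then show ?thesis using x True by simp
    qed (use x in simp)
  qed
qed

text \<open>Unlike the distance itself, its square is differentiable across the boundary of a convex
  set.\<close>

definition sqdist :: "'a::euclidean_space set \<Rightarrow> 'a \<Rightarrow> real" where
  "sqdist M x = (norm (x - closest_point M x))\<^sup>2"

context
  fixes M :: "'a::euclidean_space set"
  assumes M: "compact M" "convex M" "M \<noteq> {}"
begin

private lemma Mc: "closed M" using M by (simp add: compact_imp_closed)

lemma sqdist_le: "z \<in> M \<Longrightarrow> sqdist M x \<le> (norm (x - z))\<^sup>2"
  using closest_point_le[OF Mc, of z x] by (auto simp: sqdist_def dist_norm intro: power_mono)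

text \<open>The closest point of \<open>x\<close> is a competitor in the minimization for
  \<open>y\<close>.\<close>

lemma sqdist_upper: "sqdist M y \<le> sqdist M x + 2 * ((x - closest_point M x) \<bullet> (y - x)) + (norm (y - x))\<^sup>2"
proof -
  have "sqdist M y \<le> (norm (y - closest_point M x))\<^sup>2"
    using closest_point_in_set[OF Mc M(3)] by (rule sqdist_le)
  also have "\<dots> = (norm ((x - closest_point M x) + (y - x)))\<^sup>2" by simp
  also have "\<dots> = sqdist M x + 2 * ((x - closest_point M x) \<bullet> (y - x)) + (norm (y - x))\<^sup>2"
    unfolding sqdist_def by (simp only: power2_norm_eq_inner inner_add_left inner_add_right inner_commute)
  finally show ?thesis .
qed

text \<open>Convexity of the squared distance: twice \<open>x - closest_point M x\<close> is a
  subgradient. This combines the obtuse angle at a closest point with the nonnegativity of the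
  square of \<open>v - u\<close>.\<close>

lemma sqdist_lower: "sqdist M x + 2 * ((x - closest_point M x) \<bullet> (y - x)) \<le> sqdist M y"
proof -
  define u where "u = x - closest_point M x"
  define v where "v = y - closest_point M y"
  have dot: "u \<bullet> (closest_point M y - closest_point M x) \<le> 0" unfolding u_def
    by (intro closest_point_dot M Mc closest_point_in_set)
  have "0 \<le> (norm (v - u))\<^sup>2" by simp
  then have "2 * (u \<bullet> v) - u \<bullet> u \<le> v \<bullet> v"
    unfolding power2_norm_eq_inner by (simp add: inner_diff_left inner_diff_right inner_commute)
  moreover have "y - x = (v - u) + (closest_point M y - closest_point M x)" by (simp add: u_def v_def)
  then have "u \<bullet> (y - x) = u \<bullet> v - u \<bullet> u + u \<bullet> (closest_point M y - closest_point M x)"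
    by (simp only: inner_add_right inner_diff_right)
  ultimately show ?thesis using dot
    unfolding sqdist_def power2_norm_eq_inner u_def[symmetric] v_def[symmetric] by linarith
qed

lemma DERIV_sqdist_line:
  assumes "norm \<theta> = 1"
  shows "((\<lambda>s. sqdist M (w + s *\<^sub>R \<theta>)) has_real_derivative
    2 * ((w + s *\<^sub>R \<theta> - closest_point M (w + s *\<^sub>R \<theta>)) \<bullet> \<theta>)) (at s)"
proof (rule DERIV_of_quadratic_bound[where K = 1])
  fix t
  have d: "w + t *\<^sub>R \<theta> - (w + s *\<^sub>R \<theta>) = (t - s) *\<^sub>R \<theta>" by (simp add: algebra_simps)
  show "\<bar>sqdist M (w + t *\<^sub>R \<theta>) - sqdist M (w + s *\<^sub>R \<theta>) -
      2 * ((w + s *\<^sub>R \<theta> - closest_point M (w + s *\<^sub>R \<theta>)) \<bullet> \<theta>) * (t - s)\<bar> \<le> 1 * (t - s)\<^sup>2"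
    using sqdist_upper[of "w + t *\<^sub>R \<theta>" "w + s *\<^sub>R \<theta>"] sqdist_lower[of "w + s *\<^sub>R \<theta>" "w + t *\<^sub>R \<theta>"] assms
    unfolding d by (simp add: abs_le_iff mult.commute mult.left_commute)
qed

lemma continuous_on_sqdist: "continuous_on UNIV (sqdist M)"
  unfolding sqdist_def using continuous_on_closest_point[OF M(2) Mc M(3)] by (intro continuous_intros)

lemma sqdist_eq_0: "x \<in> M \<Longrightarrow> sqdist M x = 0"
  by (simp add: sqdist_def closest_point_self)

lemma sqdist_less_imp_mem:
  assumes "sqdist M x < \<epsilon>\<^sup>2" "0 < \<epsilon>"
  shows "x \<in> M + cball 0 \<epsilon>"
proof -
  have "norm (x - closest_point M x) < \<epsilon>"
    using assms by (auto simp: sqdist_def dest: power2_less_imp_less)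
  then have "closest_point M x + (x - closest_point M x) \<in> M + cball 0 \<epsilon>"
    using closest_point_in_set[OF Mc M(3)] by (intro set_plus_intro) auto
  then show ?thesis by simp
qed

text \<open>\<open>cutoff_grad\<close> is, up to sign, the gradient of the cutoff \<open>(max 0 (1 - sqdist M x / \<epsilon>\<^sup>2))\<^sup>2\<close>,
  a \<open>C\<^sup>1\<close> function which is unimodal along every line.\<close>

definition cutoff_grad :: "real \<Rightarrow> 'a \<Rightarrow> 'a" where
  "cutoff_grad \<epsilon> x = (4 * max 0 (1 - sqdist M x / \<epsilon>\<^sup>2) / \<epsilon>\<^sup>2) *\<^sub>R (x - closest_point M x)"

lemma continuous_on_cutoff_grad: "continuous_on UNIV (cutoff_grad \<epsilon>)"
  unfolding cutoff_grad_def
  using continuous_on_closest_point[OF M(2) Mc M(3)] continuous_on_sqdist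
  by (cases "\<epsilon> = 0") (auto intro!: continuous_intros)

lemma cutoff_grad_eq_0: "0 < \<epsilon> \<Longrightarrow> x \<notin> M + cball 0 \<epsilon> \<Longrightarrow> cutoff_grad \<epsilon> x = 0"
proof -
  assume "0 < \<epsilon>" "x \<notin> M + cball 0 \<epsilon>"
  then have "\<not> sqdist M x < \<epsilon>\<^sup>2" using sqdist_less_imp_mem by blast
  then have "1 \<le> sqdist M x / \<epsilon>\<^sup>2" using \<open>0 < \<epsilon>\<close> by (simp add: not_less)
  then show ?thesis by (simp add: cutoff_grad_def)
qed

text \<open>The integral is the total variation of the cutoff along a line in direction
  \<open>\<theta>\<close>. The cutoff rises from 0 to its maximum \<open>c\<close> and falls back to
  0, so the variation is 2c; the maximum is 1 if the line meets \<open>M\<close> and 0 if it misses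
  \<open>M + cball 0 \<epsilon>\<close>.\<close>

lemma nn_integral_cutoff_grad_line:
  assumes \<theta>: "norm \<theta> = 1" and \<epsilon>: "0 < \<epsilon>" and R: "M + cball 0 \<epsilon> \<subseteq> cball 0 R" and w: "w \<bullet> \<theta> = 0"
  obtains c where "(\<integral>\<^sup>+s. ennreal \<bar>cutoff_grad \<epsilon> (w + s *\<^sub>R \<theta>) \<bullet> \<theta>\<bar> \<partial>lborel) = ennreal (2 * c)"
    "indicator (hyperplane_proj M \<theta>) w \<le> c" "c \<le> indicator (hyperplane_proj (M + cball 0 \<epsilon>) \<theta>) w"
proof -
  define x where "x = (\<lambda>s. w + s *\<^sub>R \<theta>)"
  define \<phi> where "\<phi> = (\<lambda>s. sqdist M (x s))"
  define \<phi>' where "\<phi>' = (\<lambda>s. 2 * ((x s - closest_point M (x s)) \<bullet> \<theta>))"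
  define F where "F = (\<lambda>s. (max 0 (1 - \<phi> s / \<epsilon>\<^sup>2))\<^sup>2)"
  define k where "k = (\<lambda>s. 2 * max 0 (1 - \<phi> s / \<epsilon>\<^sup>2) / \<epsilon>\<^sup>2)"
  have k0: "0 \<le> k s" for s by (simp add: k_def)
  have G: "cutoff_grad \<epsilon> (w + s *\<^sub>R \<theta>) \<bullet> \<theta> = k s * \<phi>' s" for s
    by (simp add: cutoff_grad_def k_def \<phi>'_def \<phi>_def x_def)
  have D\<phi>: "(\<phi> has_real_derivative \<phi>' s) (at s)" for s
    unfolding \<phi>_def \<phi>'_def x_def by (rule DERIV_sqdist_line[OF \<theta>])
  have DF: "(F has_real_derivative - (k s * \<phi>' s)) (at s)" for s
  proof -
    have "((\<lambda>s. 1 - \<phi> s / \<epsilon>\<^sup>2) has_real_derivative 0 - \<phi>' s / \<epsilon>\<^sup>2) (at s)"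
      by (intro DERIV_diff DERIV_const DERIV_cdivide D\<phi>)
    from DERIV_chain2[OF DERIV_max_0_power2 this]
    show ?thesis by (simp add: F_def k_def)
  qed
  have cx: "continuous_on UNIV x" unfolding x_def by (intro continuous_intros)
  have kphi_cont: "continuous_on UNIV (\<lambda>s. k s * \<phi>' s)"
    unfolding G[symmetric] x_def[symmetric]
    using continuous_on_compose2[OF continuous_on_cutoff_grad cx] by (auto intro!: continuous_intros simp: x_def)
  then have [measurable]: "(\<lambda>s. k s * \<phi>' s) \<in> borel_measurable borel" by (rule borel_measurable_continuous_onI)
  have far: "k s = 0 \<and> F s = 0 \<and> x s \<notin> M" if "R < \<bar>s\<bar>" for s
  proof -
    have "x s \<bullet> \<theta> = s" using w \<theta> by (simp add: x_def inner_add_left norm_eq_1)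
    then have "\<bar>s\<bar> \<le> norm (x s)" using Cauchy_Schwarz_ineq2[of "x s" \<theta>] \<theta> by simp
    then have nm: "x s \<notin> M + cball 0 \<epsilon>" using R that by auto
    then have "\<not> sqdist M (x s) < \<epsilon>\<^sup>2" using sqdist_less_imp_mem \<epsilon> by blast
    then have "1 \<le> \<phi> s / \<epsilon>\<^sup>2" using \<epsilon> by (simp add: \<phi>_def not_less)
    moreover have "x s \<notin> M" using nm subset_set_plus_right[of "cball 0 \<epsilon>" M] \<epsilon> by auto
    ultimately show ?thesis by (simp add: k_def F_def)
  qed
  \<comment> \<open>Strictly larger than \<open>R\<close>, so that \<open>far\<close> applies at
    both endpoints of the interval.\<close>
  define T where "T = \<bar>R\<bar> + 1"
  have T: "0 < T" "R < T" by (auto simp: T_def)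
  have "continuous_on {-T..T} \<phi>" using D\<phi> by (meson DERIV_isCont continuous_at_imp_continuous_on)
  then obtain s0 where s0: "-T \<le> s0" "s0 \<le> T" "\<And>s. -T \<le> s \<Longrightarrow> s \<le> T \<Longrightarrow> \<phi> s0 \<le> \<phi> s"
    using continuous_attains_inf[of "{-T..T}" \<phi>] T(1) by auto
  \<comment> \<open>Lying above its tangents, \<open>\<phi>\<close> decreases before its minimum
    point \<open>s0\<close> and increases after it, so the integrand changes sign only
    there.\<close>
  have tangent: "\<phi> s + \<phi>' s * (t - s) \<le> \<phi> t" for s t
    using sqdist_lower[of "x s" "x t"] unfolding \<phi>_def \<phi>'_def
    by (simp add: x_def scaleR_diff_left[symmetric] mult.commute mult.left_commute)
  have sign1: "\<phi>' s \<le> 0" if "-T \<le> s" "s < s0" for s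
  proof -
    have "\<phi>' s * (s0 - s) \<le> 0" using tangent[of s s0] s0(3)[of s] that s0(2) by linarith
    then show ?thesis using that by (simp add: mult_le_0_iff)
  qed
  have sign2: "0 \<le> \<phi>' s" if "s0 < s" "s \<le> T" for s
  proof -
    have "\<phi>' s * (s0 - s) \<le> 0" using tangent[of s s0] s0(3)[of s] that s0(1) by linarith
    then show ?thesis using that by (simp add: mult_le_0_iff)
  qed
  \<comment> \<open>Both closed intervals used below contain \<open>s0\<close>, so the integrand
    must vanish at it: either \<open>s0\<close> is an interior critical point, or it is an endpoint,
    where the factor \<open>k\<close> is 0.\<close>
  have \<phi>'0: "\<phi>' s0 = 0 \<or> k s0 = 0"
  proof (cases "s0 = T \<or> s0 = -T")
    case True
    then have "R < \<bar>s0\<bar>" using T by auto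
    then show ?thesis using far by blast
  next
    case False
    then have m: "0 < min (T - s0) (s0 + T)" using s0 by auto
    have "\<forall>y. \<bar>s0 - y\<bar> < min (T - s0) (s0 + T) \<longrightarrow> \<phi> s0 \<le> \<phi> y"
      by (intro allI impI s0(3)) linarith+
    then show ?thesis using DERIV_local_min[OF D\<phi>[of s0] m] by blast
  qed
  have s1: "0 \<le> - (k s * \<phi>' s)" if "s \<in> {-T..s0}" for s
  proof (cases "s = s0")
    case False
    then show ?thesis using sign1[of s] k0[of s] that by (simp add: mult_nonneg_nonpos)
  qed (use \<phi>'0 in auto)
  have s2: "0 \<le> k s * \<phi>' s" if "s \<in> {s0..T}" for s
  proof (cases "s = s0")
    case False
    then show ?thesis using sign2[of s] k0[of s] that by simp
  qed (use \<phi>'0 in auto)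
  have i1: "(\<integral>\<^sup>+s. ennreal (- (k s * \<phi>' s)) * indicator {-T..s0} s \<partial>lborel) = ennreal (F s0 - F (-T))"
    using s1 s0 DF by (intro nn_integral_FTC_Icc) auto
  have "((\<lambda>s. - F s) has_real_derivative k s * \<phi>' s) (at s)" for s
    using DERIV_minus[OF DF[of s]] by simp
  then have i2: "(\<integral>\<^sup>+s. ennreal (k s * \<phi>' s) * indicator {s0..T} s \<partial>lborel) = ennreal (- F T - - F s0)"
    using s2 s0 by (intro nn_integral_FTC_Icc) auto
  have FT: "F T = 0" "F (-T) = 0" using far[of T] far[of "-T"] T by auto
  have "(\<integral>\<^sup>+s. ennreal \<bar>cutoff_grad \<epsilon> (w + s *\<^sub>R \<theta>) \<bullet> \<theta>\<bar> \<partial>lborel) =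
    (\<integral>\<^sup>+s. ennreal (- (k s * \<phi>' s)) * indicator {-T..s0} s + ennreal (k s * \<phi>' s) * indicator {s0..T} s \<partial>lborel)"
  proof (rule nn_integral_cong)
    fix s :: real
    have "s = s0 \<Longrightarrow> k s * \<phi>' s = 0" using \<phi>'0 by auto
    moreover have "k s * \<phi>' s = 0" if "s < -T \<or> T < s" using far[of s] that T by auto
    ultimately show "ennreal \<bar>cutoff_grad \<epsilon> (w + s *\<^sub>R \<theta>) \<bullet> \<theta>\<bar> =
      ennreal (- (k s * \<phi>' s)) * indicator {-T..s0} s + ennreal (k s * \<phi>' s) * indicator {s0..T} s"
      unfolding G using s1[of s] s2[of s] s0
      by (cases "s < -T"; cases "T < s"; cases s s0 rule: linorder_cases) (auto simp: indicator_def)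
  qed
  also have "\<dots> = ennreal (F s0) + ennreal (F s0)"
    by (subst nn_integral_add) (auto simp: i1 i2 FT)
  also have "\<dots> = ennreal (2 * F s0)" by (subst ennreal_plus[symmetric]) (auto simp: F_def)
  finally have int: "(\<integral>\<^sup>+s. ennreal \<bar>cutoff_grad \<epsilon> (w + s *\<^sub>R \<theta>) \<bullet> \<theta>\<bar> \<partial>lborel) = ennreal (2 * F s0)" .
  have \<phi>0: "0 \<le> \<phi> s" for s by (simp add: \<phi>_def sqdist_def)
  show ?thesis
  proof (rule that[OF int])
    show "indicator (hyperplane_proj M \<theta>) w \<le> F s0"
    proof (cases "w \<in> hyperplane_proj M \<theta>")
      case True
      then obtain s where s: "x s \<in> M" using mem_hyperplane_proj_iff[OF \<theta> w] by (auto simp: x_def)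
      then have "\<bar>s\<bar> \<le> R" using far[of s] by force
      then have "-T \<le> s" "s \<le> T" using T by auto
      then have "\<phi> s0 = 0" using s0(3)[of s] \<phi>0[of s0] sqdist_eq_0[OF s] by (simp add: \<phi>_def)
      then show ?thesis by (simp add: F_def indicator_def)
    qed (simp add: F_def)
    show "F s0 \<le> indicator (hyperplane_proj (M + cball 0 \<epsilon>) \<theta>) w"
    proof (cases "w \<in> hyperplane_proj (M + cball 0 \<epsilon>) \<theta>")
      case True
      have "max 0 (1 - \<phi> s0 / \<epsilon>\<^sup>2) \<le> 1" using \<phi>0[of s0] by simp
      then show ?thesis using True by (simp add: F_def power_le_one)
    next
      case False
      then have "x s0 \<notin> M + cball 0 \<epsilon>" using mem_hyperplane_proj_iff[OF \<theta> w] by (auto simp: x_def)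
      then have "\<not> sqdist M (x s0) < \<epsilon>\<^sup>2" using sqdist_less_imp_mem \<epsilon> by blast
      then have "1 \<le> \<phi> s0 / \<epsilon>\<^sup>2" using \<epsilon> by (simp add: \<phi>_def not_less)
      then show ?thesis using False by (simp add: F_def)
    qed
  qed
qed

text \<open>An approximate form of Cauchy's projection formula, by integrating the variation over
  all lines in direction \<open>\<theta>\<close>. The factor 2 counts the way up and the way down on
  each line.\<close>

lemma nn_integral_cutoff_grad_bounds:
  assumes \<theta>: "norm \<theta> = 1" and \<epsilon>: "0 < \<epsilon>"
  shows "ennreal (2 * shadow \<theta> M) \<le> (\<integral>\<^sup>+x. ennreal \<bar>cutoff_grad \<epsilon> x \<bullet> \<theta>\<bar> \<partial>lborel)" (is "_ \<le> ?I")
    and "(\<integral>\<^sup>+x. ennreal \<bar>cutoff_grad \<epsilon> x \<bullet> \<theta>\<bar> \<partial>lborel) \<le> ennreal (2 * shadow \<theta> (M + cball 0 \<epsilon>))"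
proof -
  have cM: "compact (M + cball 0 \<epsilon>)" using M by (intro compact_set_plus) auto
  obtain R where R: "M + cball 0 \<epsilon> \<subseteq> cball 0 R"
    using compact_imp_bounded[OF cM] unfolding bounded_pos subset_iff mem_cball_0 by blast
  have [measurable]: "cutoff_grad \<epsilon> \<in> borel_measurable borel"
    by (rule borel_measurable_continuous_onI[OF continuous_on_cutoff_grad])
  have [measurable]: "hyperplane_proj M \<theta> \<in> sets borel" "hyperplane_proj (M + cball 0 \<epsilon>) \<theta> \<in> sets borel"
    using M cM by (auto intro!: borel_compact compact_hyperplane_proj)
  have I: "?I = (\<integral>\<^sup>+w. (\<integral>\<^sup>+s. ennreal \<bar>cutoff_grad \<epsilon> (w + s *\<^sub>R \<theta>) \<bullet> \<theta>\<bar> \<partial>lborel) \<partial>lborel_on ({\<theta>}\<^sup>\<bottom>))"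
    by (rule nn_integral_lborel_hyperplane[OF \<theta>]) measurable
  have line: "2 * indicator (hyperplane_proj M \<theta>) w \<le> (\<integral>\<^sup>+s. ennreal \<bar>cutoff_grad \<epsilon> (w + s *\<^sub>R \<theta>) \<bullet> \<theta>\<bar> \<partial>lborel)
     \<and> (\<integral>\<^sup>+s. ennreal \<bar>cutoff_grad \<epsilon> (w + s *\<^sub>R \<theta>) \<bullet> \<theta>\<bar> \<partial>lborel) \<le> 2 * indicator (hyperplane_proj (M + cball 0 \<epsilon>) \<theta>) w"
    if "w \<in> {\<theta>}\<^sup>\<bottom>" for w
  proof -
    have "w \<bullet> \<theta> = 0" using that by (simp add: mem_orthogonal_comp_singleton)
    then obtain c where c: "(\<integral>\<^sup>+s. ennreal \<bar>cutoff_grad \<epsilon> (w + s *\<^sub>R \<theta>) \<bullet> \<theta>\<bar> \<partial>lborel) = ennreal (2 * c)"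
      "indicator (hyperplane_proj M \<theta>) w \<le> c" "c \<le> indicator (hyperplane_proj (M + cball 0 \<epsilon>) \<theta>) w"
      using nn_integral_cutoff_grad_line[OF \<theta> \<epsilon> R] by blast
    have e: "2 * indicator S w = ennreal (2 * indicator S w)" for S by (simp add: indicator_def)
    show ?thesis unfolding c(1) e using c(2,3) by (auto intro!: ennreal_leI)
  qed
  have AE: "AE w in lborel_on ({\<theta>}\<^sup>\<bottom>). w \<in> {\<theta>}\<^sup>\<bottom>" by (rule AE_lborel_on[OF subspace_orthogonal_comp])
  have "ennreal (2 * shadow \<theta> M) = (\<integral>\<^sup>+w. 2 * indicator (hyperplane_proj M \<theta>) w \<partial>lborel_on ({\<theta>}\<^sup>\<bottom>))"
    using emeasure_hyperplane_proj[OF \<theta> M(1)] by (simp add: nn_integral_cmult ennreal_mult)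
  also have "\<dots> \<le> ?I" unfolding I
    using AE by (intro nn_integral_mono_AE) (auto elim!: eventually_mono dest: line)
  finally show "ennreal (2 * shadow \<theta> M) \<le> ?I" .
  have "?I \<le> (\<integral>\<^sup>+w. 2 * indicator (hyperplane_proj (M + cball 0 \<epsilon>) \<theta>) w \<partial>lborel_on ({\<theta>}\<^sup>\<bottom>))"
    unfolding I using AE by (intro nn_integral_mono_AE) (auto elim!: eventually_mono dest: line)
  also have "\<dots> = ennreal (2 * shadow \<theta> (M + cball 0 \<epsilon>))"
    using emeasure_hyperplane_proj[OF \<theta> cM] by (simp add: nn_integral_cmult ennreal_mult)
  finally show "?I \<le> ennreal (2 * shadow \<theta> (M + cball 0 \<epsilon>))" .
qed

end

section \<open>Projection bodies are zonoids\<close>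

text \<open>Approximate G in L^1 by a simple function. Each nonzero value, multiplied by the measure
  of its level set, gives one vector of the list, and the L^1 error bounds the error for all unit
  directions simultaneously.\<close>

lemma nn_integral_abs_inner_approx:
  fixes G :: "'a::euclidean_space \<Rightarrow> 'a"
  assumes [measurable]: "G \<in> borel_measurable borel"
    and fin: "(\<integral>\<^sup>+x. norm (G x) \<partial>lborel) < \<infinity>" and \<eta>: "0 < \<eta>"
  obtains vs where
    "\<And>\<theta>. norm \<theta> = 1 \<Longrightarrow> (\<integral>\<^sup>+x. ennreal \<bar>G x \<bullet> \<theta>\<bar> \<partial>lborel) \<le> ennreal ((\<Sum>v\<leftarrow>vs. \<bar>v \<bullet> \<theta>\<bar>) + \<eta>)"
    "\<And>\<theta>. norm \<theta> = 1 \<Longrightarrow> ennreal (\<Sum>v\<leftarrow>vs. \<bar>v \<bullet> \<theta>\<bar>) \<le> (\<integral>\<^sup>+x. ennreal \<bar>G x \<bullet> \<theta>\<bar> \<partial>lborel) + ennreal \<eta>"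
proof -
  have "G \<in> borel_measurable lborel" by simp
  from borel_measurable_implies_sequence_metric[OF this, of 0]
  obtain F where F: "\<And>i. simple_function lborel (F i)" "\<And>x. (\<lambda>i. F i x) \<longlonglongrightarrow> G x"
    "\<And>i x. norm (F i x) \<le> 2 * norm (G x)" by auto
  have Fm: "F i \<in> borel_measurable lborel" for i by (rule borel_measurable_simple_function[OF F(1)])
  have fin2: "(\<integral>\<^sup>+x. ennreal (2 * norm (G x)) \<partial>lborel) < \<infinity>"
    using fin by (simp add: ennreal_mult nn_integral_cmult ennreal_mult_less_top)
  have "(\<lambda>i. \<integral>\<^sup>+x. norm (G x - F i x) \<partial>lborel) \<longlonglongrightarrow> 0"
    using F fin2 Fm by (intro nn_integral_dominated_convergence_norm[where w = "\<lambda>x. 2 * norm (G x)"]) auto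
  then have "\<forall>\<^sub>F i in sequentially. (\<integral>\<^sup>+x. norm (G x - F i x) \<partial>lborel) < ennreal \<eta>"
    using \<eta> by (intro order_tendstoD(2)[of _ 0]) auto
  then obtain i where i: "(\<integral>\<^sup>+x. norm (G x - F i x) \<partial>lborel) < ennreal \<eta>"
    by (auto simp: eventually_sequentially)
  define s where "s = F i"
  have [measurable]: "s \<in> borel_measurable borel" using Fm[of i] by (simp add: s_def)
  have finr: "finite (range s)" using simple_functionD(1)[OF F(1)[of i]] by (simp add: s_def)
  define A where "A = (\<lambda>v. s -` {v})"
  have Am[measurable]: "A v \<in> sets borel" for v
    using measurable_sets[of s borel borel "{v}"] by (simp add: A_def)
  \<comment> \<open>Only nonzero values enter the list: there the bound of \<open>F i\<close> by
    twice \<open>G\<close> forces finite level sets.\<close>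
  have Afin: "emeasure lborel (A v) = ennreal (measure lborel (A v))" if "v \<noteq> 0" for v
  proof -
    have "ennreal (norm v) * emeasure lborel (A v) = (\<integral>\<^sup>+x. ennreal (norm v) * indicator (A v) x \<partial>lborel)"
      by (simp add: nn_integral_cmult)
    also have "\<dots> \<le> (\<integral>\<^sup>+x. ennreal (2 * norm (G x)) \<partial>lborel)"
      using F(3)[of i] by (intro nn_integral_mono) (auto simp: A_def s_def indicator_def intro!: ennreal_leI)
    finally have "ennreal (norm v) * emeasure lborel (A v) < \<infinity>" using fin2 by simp
    then have "emeasure lborel (A v) \<noteq> \<infinity>" using that by (auto simp: ennreal_mult_less_top)
    then show ?thesis by (intro emeasure_eq_ennreal_measure) simp
  qed
  obtain l where l: "set l = range s - {0}" "distinct l"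
    using finite_distinct_list[of "range s - {0}"] finr by auto
  define vs where "vs = map (\<lambda>v. measure lborel (A v) *\<^sub>R v) l"
  have int: "(\<integral>\<^sup>+x. ennreal \<bar>s x \<bullet> \<theta>\<bar> \<partial>lborel) = ennreal (\<Sum>v\<leftarrow>vs. \<bar>v \<bullet> \<theta>\<bar>)" for \<theta>
  proof -
    have "ennreal \<bar>s x \<bullet> \<theta>\<bar> = (\<Sum>v\<in>range s - {0}. ennreal \<bar>v \<bullet> \<theta>\<bar> * indicator (A v) x)" for x
    proof -
      have "(\<Sum>v\<in>range s - {0}. ennreal \<bar>v \<bullet> \<theta>\<bar> * indicator (A v) x) =
        (\<Sum>v\<in>range s - {0}. if v = s x then ennreal \<bar>v \<bullet> \<theta>\<bar> else 0)"
        by (intro sum.cong) (auto simp: A_def indicator_def)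
      also have "\<dots> = ennreal \<bar>s x \<bullet> \<theta>\<bar>" using finr by (subst sum.delta) auto
      finally show ?thesis ..
    qed
    then have "(\<integral>\<^sup>+x. ennreal \<bar>s x \<bullet> \<theta>\<bar> \<partial>lborel) =
      (\<Sum>v\<in>range s - {0}. \<integral>\<^sup>+x. ennreal \<bar>v \<bullet> \<theta>\<bar> * indicator (A v) x \<partial>lborel)"
      by (simp add: nn_integral_sum)
    also have "\<dots> = (\<Sum>v\<in>range s - {0}. ennreal \<bar>(measure lborel (A v) *\<^sub>R v) \<bullet> \<theta>\<bar>)"
    proof (rule sum.cong[OF refl])
      fix v assume "v \<in> range s - {0}"
      then have "v \<noteq> 0" by simp
      have "(\<integral>\<^sup>+x. ennreal \<bar>v \<bullet> \<theta>\<bar> * indicator (A v) x \<partial>lborel) = ennreal \<bar>v \<bullet> \<theta>\<bar> * emeasure lborel (A v)"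
        by (intro nn_integral_cmult_indicator) simp
      also have "\<dots> = ennreal \<bar>(measure lborel (A v) *\<^sub>R v) \<bullet> \<theta>\<bar>"
        unfolding Afin[OF \<open>v \<noteq> 0\<close>] by (simp add: abs_mult mult.commute flip: ennreal_mult)
      finally show "(\<integral>\<^sup>+x. ennreal \<bar>v \<bullet> \<theta>\<bar> * indicator (A v) x \<partial>lborel)
        = ennreal \<bar>(measure lborel (A v) *\<^sub>R v) \<bullet> \<theta>\<bar>" .
    qed
    also have "\<dots> = ennreal (\<Sum>v\<in>range s - {0}. \<bar>(measure lborel (A v) *\<^sub>R v) \<bullet> \<theta>\<bar>)"
      by (simp add: sum_ennreal)
    also have "(\<Sum>v\<in>range s - {0}. \<bar>(measure lborel (A v) *\<^sub>R v) \<bullet> \<theta>\<bar>) = (\<Sum>v\<leftarrow>vs. \<bar>v \<bullet> \<theta>\<bar>)"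
      unfolding vs_def map_map comp_def l(1)[symmetric] by (rule sum.distinct_set_conv_list[OF l(2)])
    finally show ?thesis .
  qed
  have diff: "(\<integral>\<^sup>+x. ennreal \<bar>u x \<bullet> \<theta>\<bar> \<partial>lborel) \<le> (\<integral>\<^sup>+x. ennreal \<bar>v x \<bullet> \<theta>\<bar> \<partial>lborel) + ennreal \<eta>"
    if [measurable]: "u \<in> borel_measurable borel" "v \<in> borel_measurable borel" and \<theta>: "norm \<theta> = 1"
      and uv: "\<And>x. norm (u x - v x) = norm (G x - s x)" for u v :: "'a \<Rightarrow> 'a" and \<theta>
  proof -
    have "\<bar>u x \<bullet> \<theta>\<bar> \<le> \<bar>v x \<bullet> \<theta>\<bar> + norm (G x - s x)" for x
      using Cauchy_Schwarz_ineq2[of "u x - v x" \<theta>] \<theta> uv[of x] by (simp add: inner_diff_left)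
    then have "(\<integral>\<^sup>+x. ennreal \<bar>u x \<bullet> \<theta>\<bar> \<partial>lborel) \<le> (\<integral>\<^sup>+x. ennreal \<bar>v x \<bullet> \<theta>\<bar> + ennreal (norm (G x - s x)) \<partial>lborel)"
      by (intro nn_integral_mono) (simp add: ennreal_leI flip: ennreal_plus)
    also have "\<dots> = (\<integral>\<^sup>+x. ennreal \<bar>v x \<bullet> \<theta>\<bar> \<partial>lborel) + (\<integral>\<^sup>+x. norm (G x - s x) \<partial>lborel)"
      by (intro nn_integral_add) auto
    also have "\<dots> \<le> (\<integral>\<^sup>+x. ennreal \<bar>v x \<bullet> \<theta>\<bar> \<partial>lborel) + ennreal \<eta>"
      using i by (intro add_left_mono) (simp add: s_def)
    finally show ?thesis .
  qed
  show ?thesis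
  proof (rule that[of vs])
    fix \<theta> :: 'a assume \<theta>: "norm \<theta> = 1"
    have nn: "0 \<le> (\<Sum>v\<leftarrow>vs. \<bar>v \<bullet> \<theta>\<bar>)" by (intro sum_list_nonneg) auto
    show "(\<integral>\<^sup>+x. ennreal \<bar>G x \<bullet> \<theta>\<bar> \<partial>lborel) \<le> ennreal ((\<Sum>v\<leftarrow>vs. \<bar>v \<bullet> \<theta>\<bar>) + \<eta>)"
      using diff[of G s \<theta>] \<theta> \<eta> nn unfolding int by (simp add: ennreal_plus)
    show "ennreal (\<Sum>v\<leftarrow>vs. \<bar>v \<bullet> \<theta>\<bar>) \<le> (\<integral>\<^sup>+x. ennreal \<bar>G x \<bullet> \<theta>\<bar> \<partial>lborel) + ennreal \<eta>"
      using diff[of s G \<theta>] \<theta> unfolding int by (simp add: norm_minus_commute)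
  qed
qed

text \<open>The added ball is a dilate, by \<epsilon>/\<rho>, of a ball inside \<open>M\<close>, so
  a thickening of \<open>M\<close> is absorbed by a dilation.\<close>

lemma set_plus_cball_subset_scaleR:
  fixes M :: "'a::euclidean_space set"
  assumes M: "convex M" "cball 0 \<rho> \<subseteq> M" and "0 < \<rho>" "0 < \<epsilon>"
  shows "M + cball 0 \<epsilon> \<subseteq> (*\<^sub>R) (1 + \<epsilon> / \<rho>) ` M"
proof -
  have "cball 0 \<epsilon> = (*\<^sub>R) (\<epsilon> / \<rho>) ` (cball 0 \<rho> :: 'a set)"
    using assms by (simp add: cball_scale)
  also have "\<dots> \<subseteq> (*\<^sub>R) (\<epsilon> / \<rho>) ` M" using M(2) by (rule scaleR_image_mono_set)
  finally have "M + cball 0 \<epsilon> \<subseteq> (*\<^sub>R) 1 ` M + (*\<^sub>R) (\<epsilon> / \<rho>) ` M" by (intro set_plus_mono2) auto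
  then show ?thesis using convex_scaleR_set_plus[OF M(1), of 1 "\<epsilon> / \<rho>"] assms by simp
qed

text \<open>Twice the support function of \<open>L\<close> is nearly the integral of |G . \<theta>|,
  hence nearly a finite sum of |v . \<theta>|, which is twice the support function of a zonotope.
  The inner ball of \<open>M\<close> makes the error of thickening relative; the inner ball of
  \<open>L\<close> bounds its support function below by \<open>r\<close>, which makes the L^1 error
  relative too.\<close>

lemma zonoid_of_support_fun_eq_shadow:
  fixes L M :: "'a::euclidean_space set"
  assumes L: "compact L" "convex L" and r: "0 < r" "cball 0 r \<subseteq> L"
    and M: "compact M" "convex M" and \<rho>: "0 < \<rho>" "cball 0 \<rho> \<subseteq> M"
    and eq: "\<And>\<theta>. norm \<theta> = 1 \<Longrightarrow> support_fun L \<theta> = shadow \<theta> M"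
  shows "zonoid L"
  unfolding zonoid_def
proof
  fix \<eta> :: real assume "\<eta> \<in> {0<..<1}"
  then have \<eta>: "0 < \<eta>" "\<eta> < 1" by auto
  have neM: "M \<noteq> {}" and neL: "L \<noteq> {}" using \<rho> r by auto
  have "((\<lambda>\<epsilon>. (1 + \<epsilon> / \<rho>) ^ (DIM('a) - 1)) \<longlongrightarrow> (1 + 0 / \<rho>) ^ (DIM('a) - 1)) (at_right 0)"
    using \<rho> by (intro tendsto_intros) auto
  \<comment> \<open>Half of \<eta> is spent here. The L^1 error \<eta> r, halved in the zonotope's
    support function, costs at most the other half.\<close>
  then have "\<forall>\<^sub>F \<epsilon> in at_right 0. (1 + \<epsilon> / \<rho>) ^ (DIM('a) - 1) < 1 + \<eta> / 2"
    using \<eta> by (intro order_tendstoD(2)) auto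
  then obtain \<epsilon> where \<epsilon>: "0 < \<epsilon>" "(1 + \<epsilon> / \<rho>) ^ (DIM('a) - 1) < 1 + \<eta> / 2"
    using eventually_happens'[OF trivial_limit_at_right_real eventually_conj[OF eventually_at_right_less[of 0]]] by blast
  define G where "G = cutoff_grad M \<epsilon>"
  have cG: "continuous_on UNIV G" unfolding G_def by (rule continuous_on_cutoff_grad[OF M neM])
  then have [measurable]: "G \<in> borel_measurable borel" by (rule borel_measurable_continuous_onI)
  have cM: "compact (M + cball 0 \<epsilon>)" using M by (intro compact_set_plus) auto
  have "(\<integral>\<^sup>+x. norm (G x) \<partial>lborel) < \<infinity>"
  proof -
    have "compact (G ` (M + cball 0 \<epsilon>))"
      using continuous_on_subset[OF cG] cM by (intro compact_continuous_image) auto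
    from compact_imp_bounded[OF this] obtain b where b: "\<And>x. x \<in> M + cball 0 \<epsilon> \<Longrightarrow> norm (G x) \<le> b"
      unfolding bounded_iff by blast
    have "(\<integral>\<^sup>+x. norm (G x) \<partial>lborel) \<le> (\<integral>\<^sup>+x. ennreal b * indicator (M + cball 0 \<epsilon>) x \<partial>lborel)"
      using b cutoff_grad_eq_0[OF M neM \<epsilon>(1)]
      by (intro nn_integral_mono) (auto simp: G_def indicator_def intro!: ennreal_leI)
    also have "\<dots> = ennreal b * ennreal (measure lebesgue (M + cball 0 \<epsilon>))"
      using emeasure_lborel_compact[OF cM] borel_compact[OF cM] by (simp add: nn_integral_cmult)
    also have "\<dots> < \<infinity>" by (simp add: ennreal_mult_less_top)
    finally show ?thesis .
  qed
  then obtain vs where vs: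
    "\<And>\<theta>. norm \<theta> = 1 \<Longrightarrow> (\<integral>\<^sup>+x. ennreal \<bar>G x \<bullet> \<theta>\<bar> \<partial>lborel) \<le> ennreal ((\<Sum>v\<leftarrow>vs. \<bar>v \<bullet> \<theta>\<bar>) + \<eta> * r)"
    "\<And>\<theta>. norm \<theta> = 1 \<Longrightarrow> ennreal (\<Sum>v\<leftarrow>vs. \<bar>v \<bullet> \<theta>\<bar>) \<le> (\<integral>\<^sup>+x. ennreal \<bar>G x \<bullet> \<theta>\<bar> \<partial>lborel) + ennreal (\<eta> * r)"
    using nn_integral_abs_inner_approx[of G "\<eta> * r"] \<eta> r by auto
  have bounds: "(1 - \<eta>) * support_fun L \<theta> \<le> support_fun (zonotope vs) \<theta> \<and>
      support_fun (zonotope vs) \<theta> \<le> (1 + \<eta>) * support_fun L \<theta>" if \<theta>: "norm \<theta> = 1" for \<theta>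
  proof -
    let ?h = "support_fun L \<theta>" and ?z = "\<Sum>v\<leftarrow>vs. \<bar>v \<bullet> \<theta>\<bar>"
    have z0: "0 \<le> ?z" by (intro sum_list_nonneg) auto
    have "r *\<^sub>R \<theta> \<in> L" using r \<theta> by (intro subsetD[OF r(2)]) simp
    then have h: "r \<le> ?h" using support_fun_ge[OF L(1), of "r *\<^sub>R \<theta>" \<theta>] \<theta> by (simp add: norm_eq_1)
    have "ennreal (2 * ?h) \<le> ennreal (?z + \<eta> * r)"
      using order_trans[OF nn_integral_cutoff_grad_bounds(1)[OF M neM \<theta> \<epsilon>(1)] vs(1)[OF \<theta>, unfolded G_def]]
      unfolding eq[OF \<theta>] by blast
    then have 1: "2 * ?h \<le> ?z + \<eta> * r" using z0 \<eta> r by (subst (asm) ennreal_le_iff) auto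
    have sub: "M + cball 0 \<epsilon> \<subseteq> (*\<^sub>R) (1 + \<epsilon> / \<rho>) ` M"
      using M \<rho> \<epsilon> by (intro set_plus_cball_subset_scaleR)
    have "shadow \<theta> (M + cball 0 \<epsilon>) \<le> shadow \<theta> ((*\<^sub>R) (1 + \<epsilon> / \<rho>) ` M)"
      using M by (intro shadow_mono \<theta> cM sub compact_scaling)
    also have "\<dots> = (1 + \<epsilon> / \<rho>) ^ (DIM('a) - 1) * ?h"
      using M \<rho> \<epsilon> unfolding eq[OF \<theta>] by (intro shadow_scaleR \<theta>) (auto simp: add_pos_pos)
    also have "\<dots> \<le> (1 + \<eta> / 2) * ?h" using \<epsilon> h r by (intro mult_right_mono) auto
    finally have up: "shadow \<theta> (M + cball 0 \<epsilon>) \<le> (1 + \<eta> / 2) * ?h" .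
    have "ennreal ?z \<le> ennreal (2 * shadow \<theta> (M + cball 0 \<epsilon>)) + ennreal (\<eta> * r)"
      using order_trans[OF vs(2)[OF \<theta>, unfolded G_def] add_right_mono[OF nn_integral_cutoff_grad_bounds(2)[OF M neM \<theta> \<epsilon>(1)]]]
      by blast
    also have "\<dots> = ennreal (2 * shadow \<theta> (M + cball 0 \<epsilon>) + \<eta> * r)"
      using \<eta> r by (simp add: ennreal_plus)
    finally have 2: "?z \<le> 2 * shadow \<theta> (M + cball 0 \<epsilon>) + \<eta> * r"
      using \<eta> r by (subst (asm) ennreal_le_iff) auto
    have "\<eta> * r \<le> \<eta> * ?h" using h \<eta> by (intro mult_left_mono) auto
    moreover have "0 \<le> \<eta> * ?h" using h r \<eta> by simp
    ultimately show ?thesis using 1 2 up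
      unfolding support_fun_zonotope by (simp add: algebra_simps)
  qed
  have "(*\<^sub>R) (1 - \<eta>) ` L \<subseteq> zonotope vs"
    using bounds \<eta> L neL zero_mem_zonotope[of vs]
    by (intro subset_of_support_fun_le compact_scaling compact_zonotope convex_zonotope)
       (auto simp: support_fun_scaleR)
  moreover have "zonotope vs \<subseteq> (*\<^sub>R) (1 + \<eta>) ` L"
    using bounds \<eta> L neL
    by (intro subset_of_support_fun_le compact_scaling compact_zonotope convex_scaling)
       (auto simp: support_fun_scaleR)
  ultimately show "\<exists>vs. (*\<^sub>R) (1 - \<eta>) ` L \<subseteq> zonotope vs \<and> zonotope vs \<subseteq> (*\<^sub>R) (1 + \<eta>) ` L" by blast
qed

lemma origin_symmetric_contains_cball:
  fixes K :: "'a::euclidean_space set"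
  assumes "convex_body K" "origin_symmetric K"
  obtains r where "0 < r" "cball 0 r \<subseteq> K"
proof -
  obtain x where x: "x \<in> interior K" using assms(1) by (auto simp: convex_body_def)
  have "- x \<in> interior K"
    using interior_negations[of K] x assms(2) by (auto simp: origin_symmetric_def)
  moreover have "convex (interior K)" using assms(1) by (simp add: convex_body_def convex_interior)
  ultimately have "(1/2) *\<^sub>R x + (1/2) *\<^sub>R (- x) \<in> interior K" using x by (intro convexD) auto
  then have "0 \<in> interior K" by simp
  then obtain r where "0 < r" "cball 0 r \<subseteq> K" by (auto simp: mem_interior_cball)
  then show ?thesis by (rule that)
qed

lemma zonoid_projection_body:
  fixes L :: "'a::euclidean_space set"
  assumes "projection_body L"
  shows "zonoid L"
proof -
  obtain M where M: "convex_body M" "origin_symmetric M" "is_projection_body_of L M"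
    using assms by (auto simp: projection_body_def)
  then have L: "convex_body L" "origin_symmetric L" by (auto simp: is_projection_body_of_def)
  obtain r where r: "0 < r" "cball 0 r \<subseteq> L" using origin_symmetric_contains_cball[OF L] .
  obtain \<rho> where \<rho>: "0 < \<rho>" "cball 0 \<rho> \<subseteq> M" using origin_symmetric_contains_cball[OF M(1,2)] .
  show ?thesis
    using L(1) M(1,3) by (intro zonoid_of_support_fun_eq_shadow[OF _ _ r _ _ \<rho>])
      (auto simp: convex_body_def is_projection_body_of_def)
qed

text \<open>All projections of a ball have the same volume, so the unit ball is the projection body
  of the ball of radius \<open>s\<close>, chosen with projections of volume 1. In dimension at least
  2 this volume depends on the radius and \<open>s\<close> exists.\<close>

lemma zonoid_unit_cball:
  assumes "2 \<le> DIM('a::euclidean_space)"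
  shows "zonoid (cball 0 1 :: 'a set)"
proof -
  define b where "b = unit_ball_vol (real DIM('a) - 1)"
  define s where "s = root (DIM('a) - 1) (1 / b)"
  have b: "0 < b" using real_DIM_ge_1[where 'a='a] by (simp add: b_def)
  have s: "0 < s" "s ^ (DIM('a) - 1) * b = 1"
    using b assms by (simp_all add: s_def)
  have "support_fun (cball 0 1) \<theta> = shadow \<theta> (cball 0 s)" if \<theta>: "norm \<theta> = 1" for \<theta> :: 'a
  proof -
    have "support_fun (cball 0 1) \<theta> = 1" unfolding support_fun_def
    proof (rule cSup_eq_maximum)
      have "\<theta> \<bullet> \<theta> = 1" using \<theta> by (simp add: norm_eq_1)
      then show "1 \<in> (\<bullet>) \<theta> ` cball 0 1" using \<theta> imageI[of \<theta> "cball 0 1" "(\<bullet>) \<theta>"] by simp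
      show "x \<le> 1" if "x \<in> (\<bullet>) \<theta> ` cball 0 1" for x
        using that \<theta> by (auto intro!: order_trans[OF norm_cauchy_schwarz])
    qed
    then show ?thesis using s \<theta> by (simp add: shadow_cball b_def)
  qed
  then show ?thesis
    using s(1) by (intro zonoid_of_support_fun_eq_shadow[where r = 1 and \<rho> = s and M = "cball 0 s"]) auto
qed

section \<open>The lower bound for the surface area\<close>

text \<open>The body \<open>\<rho>\<close> L + t B is the dilate by \<open>\<rho>\<close> of L +
  (t/\<rho>) B. The projected volume contributes \<rho>^(n-1), and one factor is lost to
  t/\<rho>.\<close>

lemma shadow_increment_scaleR:
  fixes L :: "'a::euclidean_space set"
  assumes L: "compact L" "convex L" and n: "2 \<le> DIM('a)" and \<xi>: "norm \<xi> = 1"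
    and le: "\<And>t. 0 < t \<Longrightarrow> shadow \<xi> L + t * m \<le> shadow \<xi> (L + cball 0 t)"
    and \<rho>: "0 < \<rho>" and t: "0 < t"
  shows "\<rho> ^ (DIM('a) - 2) * t * m \<le> shadow \<xi> ((*\<^sub>R) \<rho> ` L + cball 0 t) - shadow \<xi> ((*\<^sub>R) \<rho> ` L)"
proof -
  let ?n = "DIM('a)"
  have "(*\<^sub>R) \<rho> ` L + cball 0 t = (*\<^sub>R) \<rho> ` (L + cball 0 (t / \<rho>))"
    using \<rho> by (simp add: image_scaleR_set_plus cball_scale)
  then have "shadow \<xi> ((*\<^sub>R) \<rho> ` L + cball 0 t) - shadow \<xi> ((*\<^sub>R) \<rho> ` L)
    = \<rho> ^ (?n - 1) * (shadow \<xi> (L + cball 0 (t / \<rho>)) - shadow \<xi> L)"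
    using L \<rho> \<xi> by (simp add: shadow_scaleR cc_intros algebra_simps)
  moreover have "\<rho> ^ (?n - 1) * (t / \<rho> * m) \<le> \<rho> ^ (?n - 1) * (shadow \<xi> (L + cball 0 (t / \<rho>)) - shadow \<xi> L)"
    using le[of "t / \<rho>"] \<rho> t by (intro mult_left_mono) auto
  moreover have "?n - 1 = Suc (?n - 2)" using n by simp
  ultimately show ?thesis using \<rho> by simp
qed

text \<open>One growth step: by convexity the larger dilate is the sum of the \<open>\<rho>\<close>-
  and \<open>s\<close>-dilates of \<open>L\<close>. The second summand is replaced by a zonotope
  whose total length is at least s (1 - \<eta>) times \<open>?w\<close>, and \<eta> tends to
  0.\<close>

lemma vol_increment_zonoid:
  fixes L :: "'a::euclidean_space set"
  assumes L: "compact L" "convex L" "0 \<in> L" "zonoid L"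
    and A: "compact A" "convex A" "0 \<in> A" and c: "0 \<le> c"
    and shadow: "\<And>\<xi>. norm \<xi> = 1 \<Longrightarrow> c \<le> shadow \<xi> ((*\<^sub>R) \<rho> ` L + A) - shadow \<xi> ((*\<^sub>R) \<rho> ` L)"
    and \<rho>: "0 < \<rho>" and s: "0 < s"
  shows "measure lebesgue ((*\<^sub>R) \<rho> ` L + A) - measure lebesgue ((*\<^sub>R) \<rho> ` L)
      + s * c * (real DIM('a) * ball_const DIM('a) * measure lebesgue L powr (1 / real DIM('a)))
    \<le> measure lebesgue ((*\<^sub>R) (\<rho> + s) ` L + A) - measure lebesgue ((*\<^sub>R) (\<rho> + s) ` L)"
proof -
  let ?n = "DIM('a)"
  let ?w = "real ?n * ball_const ?n * measure lebesgue L powr (1 / real ?n)"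
  let ?V = "measure lebesgue ((*\<^sub>R) (\<rho> + s) ` L + A)" and ?U = "measure lebesgue ((*\<^sub>R) (\<rho> + s) ` L)"
  let ?D = "measure lebesgue ((*\<^sub>R) \<rho> ` L + A) - measure lebesgue ((*\<^sub>R) \<rho> ` L)"
  have sum: "(*\<^sub>R) \<rho> ` L + (*\<^sub>R) s ` L = (*\<^sub>R) (\<rho> + s) ` L"
    using L \<rho> s by (intro convex_scaleR_set_plus) auto
  have K: "compact ((*\<^sub>R) \<rho> ` L)" "convex ((*\<^sub>R) \<rho> ` L)" using L by (auto intro: cc_intros)
  have bound: "?D + s * c * ((1 - \<eta>) * ?w) \<le> (1 + \<eta>) ^ ?n * ?V - (1 - \<eta>) ^ ?n * ?U"
    if \<eta>: "0 < \<eta>" "\<eta> < 1" for \<eta>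
  proof -
    obtain vs where vs: "(*\<^sub>R) (1 - \<eta>) ` L \<subseteq> zonotope vs" "zonotope vs \<subseteq> (*\<^sub>R) (1 + \<eta>) ` L"
      by (rule zonoidE[OF L(4) \<eta>])
    have down: "(*\<^sub>R) (1 - \<eta>) ` S \<subseteq> S" and up: "S \<subseteq> (*\<^sub>R) (1 + \<eta>) ` S"
      if "convex S" "0 \<in> S" for S :: "'a set"
      using scaleR_image_mono[OF that, of "1 - \<eta>" 1] scaleR_image_mono[OF that, of 1 "1 + \<eta>"] \<eta> by auto
    have \<rho>L0: "0 \<in> (*\<^sub>R) \<rho> ` L" using L(3) by force
    have "?w * (1 - \<eta>) = real ?n * ball_const ?n * measure lebesgue ((*\<^sub>R) (1 - \<eta>) ` L) powr (1 / real ?n)"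
      using \<eta> by (simp add: measure_lebesgue_scaleR_image powr_mult powr_powr flip: powr_realpow)
    also have "\<dots> \<le> real ?n * ball_const ?n * measure lebesgue (zonotope vs) powr (1 / real ?n)"
    proof (intro mult_left_mono powr_mono2)
      show "measure lebesgue ((*\<^sub>R) (1 - \<eta>) ` L) \<le> measure lebesgue (zonotope vs)"
        using L vs by (intro measure_compact_mono cc_intros)
      show "0 \<le> real ?n * ball_const ?n" using real_DIM_ge_1[where 'a='a]
        by (auto simp: ball_const_def intro!: mult_nonneg_nonneg divide_nonneg_nonneg)
    qed auto
    also have "\<dots> \<le> total_length vs" by (rule total_length_lower_bound)
    finally have len: "(1 - \<eta>) * ?w \<le> total_length vs" by (simp only: mult.commute)
    have tl: "total_length (map ((*\<^sub>R) s) vs) = s * total_length vs"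
      using s by (simp add: comp_def sum_list_const_mult)
    have "s * c * ((1 - \<eta>) * ?w) \<le> c * total_length (map ((*\<^sub>R) s) vs)"
      unfolding tl using mult_left_mono[OF len, of "s * c"] s c by (simp add: mult_ac)
    then have 1: "?D + s * c * ((1 - \<eta>) * ?w) \<le>
      measure lebesgue ((*\<^sub>R) \<rho> ` L + (*\<^sub>R) s ` zonotope vs + A) - measure lebesgue ((*\<^sub>R) \<rho> ` L + (*\<^sub>R) s ` zonotope vs)"
      using vol_increment_add_zonotope[OF K A shadow, of "map ((*\<^sub>R) s) vs"]
      unfolding zonotope_scaleR by linarith
    have "(*\<^sub>R) \<rho> ` L + (*\<^sub>R) s ` zonotope vs + A
      \<subseteq> (*\<^sub>R) (1 + \<eta>) ` (*\<^sub>R) \<rho> ` L + (*\<^sub>R) (1 + \<eta>) ` (*\<^sub>R) s ` L + (*\<^sub>R) (1 + \<eta>) ` A"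
      using up[OF K(2) \<rho>L0] up[OF A(2,3)] scaleR_image_mono_set[OF vs(2), of s]
      by (intro set_plus_mono2) (simp_all only: scaleR_image_scaleR mult.commute)
    also have "\<dots> = (*\<^sub>R) (1 + \<eta>) ` ((*\<^sub>R) (\<rho> + s) ` L + A)"
      unfolding image_scaleR_set_plus[symmetric] sum ..
    finally have "measure lebesgue ((*\<^sub>R) \<rho> ` L + (*\<^sub>R) s ` zonotope vs + A) \<le> measure lebesgue ((*\<^sub>R) (1 + \<eta>) ` ((*\<^sub>R) (\<rho> + s) ` L + A))"
      using L A by (intro measure_compact_mono) (auto intro: cc_intros)
    then have 2: "measure lebesgue ((*\<^sub>R) \<rho> ` L + (*\<^sub>R) s ` zonotope vs + A) \<le> (1 + \<eta>) ^ ?n * ?V"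
      using \<eta> measure_lebesgue_scaleR_image[of "1 + \<eta>" "(*\<^sub>R) (\<rho> + s) ` L + A"] by simp
    have "(*\<^sub>R) (1 - \<eta>) ` (*\<^sub>R) (\<rho> + s) ` L = (*\<^sub>R) (1 - \<eta>) ` (*\<^sub>R) \<rho> ` L + (*\<^sub>R) (1 - \<eta>) ` (*\<^sub>R) s ` L"
      unfolding sum[symmetric] image_scaleR_set_plus ..
    also have "\<dots> \<subseteq> (*\<^sub>R) \<rho> ` L + (*\<^sub>R) s ` zonotope vs"
      using down[OF K(2) \<rho>L0] scaleR_image_mono_set[OF vs(1), of s]
      by (intro set_plus_mono2) (simp_all only: scaleR_image_scaleR mult.commute)
    finally have "measure lebesgue ((*\<^sub>R) (1 - \<eta>) ` (*\<^sub>R) (\<rho> + s) ` L) \<le> measure lebesgue ((*\<^sub>R) \<rho> ` L + (*\<^sub>R) s ` zonotope vs)"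
      using L by (intro measure_compact_mono) (auto intro: cc_intros)
    then have 3: "(1 - \<eta>) ^ ?n * ?U \<le> measure lebesgue ((*\<^sub>R) \<rho> ` L + (*\<^sub>R) s ` zonotope vs)"
      using \<eta> measure_lebesgue_scaleR_image[of "1 - \<eta>" "(*\<^sub>R) (\<rho> + s) ` L"] by simp
    show ?thesis using 1 2 3 by linarith
  qed
  have ev: "\<forall>\<^sub>F \<eta> in at_right 0. ?D + s * c * ((1 - \<eta>) * ?w) \<le> (1 + \<eta>) ^ ?n * ?V - (1 - \<eta>) ^ ?n * ?U"
    using eventually_at_right_real[OF zero_less_one] by (rule eventually_mono) (use bound in auto)
  have "((\<lambda>\<eta>. ?D + s * c * ((1 - \<eta>) * ?w)) \<longlongrightarrow> ?D + s * c * ((1 - 0) * ?w)) (at_right 0)"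
    by (intro tendsto_intros)
  moreover have "((\<lambda>\<eta>. (1 + \<eta>) ^ ?n * ?V - (1 - \<eta>) ^ ?n * ?U) \<longlongrightarrow> (1 + 0) ^ ?n * ?V - (1 - 0) ^ ?n * ?U) (at_right 0)"
    by (intro tendsto_intros)
  ultimately have "?D + s * c * ((1 - 0) * ?w) \<le> (1 + 0) ^ ?n * ?V - (1 - 0) ^ ?n * ?U"
    by (rule tendsto_le[OF trivial_limit_at_right_real _ _ ev, rotated])
  then show ?thesis by simp
qed

text \<open>Bernoulli's inequality gives x^(j+1) - (x-1)^(j+1) \<le> (j+1) x^j, which telescopes;
  this is the comparison of a sum with the integral of x^j.\<close>

lemma power_sum_lower_bound: "real N ^ Suc j \<le> (real j + 1) * (\<Sum>k=1..N. real k ^ j)"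
proof (induction N)
  case (Suc N)
  define x where "x = real N + 1"
  have x: "0 < x" by (simp add: x_def)
  have "1 + real (Suc j) * (- 1 / x) \<le> (1 + - 1 / x) ^ Suc j"
    using x by (intro Bernoulli_inequality) (simp add: x_def)
  then have "x ^ Suc j * (1 + real (Suc j) * (- 1 / x)) \<le> x ^ Suc j * (1 + - 1 / x) ^ Suc j"
    using x by (intro mult_left_mono) auto
  also have "\<dots> = (x - 1) ^ Suc j"
    unfolding power_mult_distrib[symmetric] using x by (simp add: algebra_simps)
  also have "x ^ Suc j * (1 + real (Suc j) * (- 1 / x)) = x ^ Suc j - (real j + 1) * x ^ j"
    using x by (simp add: field_simps)
  finally have "x ^ Suc j \<le> real N ^ Suc j + (real j + 1) * x ^ j" by (simp add: x_def)
  also have "\<dots> \<le> (real j + 1) * (\<Sum>k=1..Suc N. real k ^ j)"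
    using Suc.IH by (simp add: x_def algebra_simps)
  finally show ?case by (simp add: x_def add.commute)
qed simp

text \<open>Integration of the growth rate C \<rho>^j over [0,1] in steps of length 1/N. The
  increments are available only from positive \<open>\<rho>\<close>, so the walk starts at 1/N,
  where nonnegativity of \<open>\<phi>\<close> is enough.\<close>

lemma increments_power_bound:
  fixes \<phi> :: "real \<Rightarrow> real"
  assumes inc: "\<And>\<rho> s. 0 < \<rho> \<Longrightarrow> 0 < s \<Longrightarrow> \<phi> \<rho> + s * (C * \<rho> ^ j) \<le> \<phi> (\<rho> + s)"
    and pos: "\<And>\<rho>. 0 < \<rho> \<Longrightarrow> 0 \<le> \<phi> \<rho>" and C: "0 \<le> C"
  shows "C / (real j + 1) \<le> \<phi> 1"
proof -
  have step: "C * (1 / (real j + 1) - 1 / real N) \<le> \<phi> 1" if N: "1 \<le> N" for N :: nat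
  proof -
    have N0: "0 < real N" using N by simp
    have sum: "C / real N * (\<Sum>k=1..<K. (real k / real N) ^ j) \<le> \<phi> (real K / real N)" if "1 \<le> K" for K
      using that
    proof (induction K rule: nat_induct_at_least)
      case base
      then show ?case using pos[of "1 / real N"] N0 by simp
    next
      case (Suc K)
      have "\<phi> (real K / real N) + 1 / real N * (C * (real K / real N) ^ j) \<le> \<phi> (real K / real N + 1 / real N)"
        using Suc.hyps N0 by (intro inc) auto
      also have "real K / real N + 1 / real N = real (Suc K) / real N" by (simp add: add_divide_distrib)
      finally show ?case using Suc by (simp add: algebra_simps)
    qed
    \<comment> \<open>The last increment starts at N - 1. The missing term k = N costs C/N, which
      vanishes in the limit.\<close>
    have "(\<Sum>k=1..N. real k ^ j) = (\<Sum>k=1..<N. real k ^ j) + real N ^ j"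
      using N by (simp add: sum.last_plus[of 1 N] atLeastLessThanSuc_atLeastAtMost[symmetric])
    then have "real N ^ Suc j \<le> (real j + 1) * ((\<Sum>k=1..<N. real k ^ j) + real N ^ j)"
      using power_sum_lower_bound[of N j] by simp
    then have "real N ^ Suc j / (real j + 1) - real N ^ j \<le> (\<Sum>k=1..<N. real k ^ j)"
      by (simp add: field_simps)
    then have "(real N ^ Suc j / (real j + 1) - real N ^ j) / real N ^ Suc j \<le> (\<Sum>k=1..<N. real k ^ j) / real N ^ Suc j"
      using N0 by (intro divide_right_mono) auto
    moreover have "(real N ^ Suc j / (real j + 1) - real N ^ j) / real N ^ Suc j = 1 / (real j + 1) - 1 / real N"
      using N0 by (simp add: diff_divide_distrib)
    ultimately have "C * (1 / (real j + 1) - 1 / real N) \<le> C * ((\<Sum>k=1..<N. real k ^ j) / real N ^ Suc j)"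
      using C by (intro mult_left_mono) auto
    also have "\<dots> = C / real N * (\<Sum>k=1..<N. (real k / real N) ^ j)"
      by (simp add: power_divide sum_divide_distrib[symmetric])
    also have "\<dots> \<le> \<phi> 1" using sum[OF N] N0 by simp
    finally show ?thesis .
  qed
  have "(\<lambda>N. C * (1 / (real j + 1) - 1 / real N)) \<longlonglongrightarrow> C * (1 / (real j + 1) - 0)"
    by (intro tendsto_intros lim_1_over_n)
  then have "C * (1 / (real j + 1) - 0) \<le> \<phi> 1"
    by (rule LIMSEQ_le_const2) (use step in blast)
  then show ?thesis by simp
qed

text \<open>For fixed \<open>t\<close>, follow the increment due to t B along the dilates of
  \<open>L\<close>. Its growth rate at \<open>\<rho>\<close> is at least w t m \<rho>^(n-2), which
  integrates to w t m / (n - 1) at \<open>\<rho>\<close> = 1; dividing by \<open>t\<close> and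
  letting it tend to 0 gives the surface area.\<close>

theorem surface_area_zonoid_ge:
  fixes L :: "'a::euclidean_space set"
  assumes n: "2 \<le> DIM('a)" and L: "compact L" "convex L" "0 \<in> L" "zonoid L"
  shows "surface_area L \<ge>
    real DIM('a) / (real DIM('a) - 1) * ball_const DIM('a) *
    (INF \<xi>\<in>sphere 0 1. surface_area_on ({\<xi>}\<^sup>\<bottom>) (hyperplane_proj L \<xi>)) *
    measure lebesgue L powr (1 / real DIM('a))"
proof -
  let ?n = "DIM('a)"
  let ?S = "\<lambda>\<xi>. surface_area_on ({\<xi>}\<^sup>\<bottom>) (hyperplane_proj L \<xi>)"
  define m where "m = (INF \<xi>\<in>sphere 0 1. ?S \<xi>)"
  define w where "w = real ?n * ball_const ?n * measure lebesgue L powr (1 / real ?n)"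
  note B = zonoid_unit_cball[OF n]
  \<comment> \<open>Besides the sign of \<open>m\<close>, this gives the lower bound that makes the
    real \<open>INF\<close> a true infimum.\<close>
  have S0: "0 \<le> ?S \<xi>" if "norm \<xi> = 1" for \<xi> by (rule surface_area_on_shadow(1)[OF that L(1-3) B])
  have m0: "0 \<le> m" unfolding m_def using S0 by (intro cINF_greatest) auto
  have mS: "m \<le> ?S \<xi>" if "norm \<xi> = 1" for \<xi>
    unfolding m_def using S0 that by (intro cINF_lower bdd_belowI2[of _ 0]) auto
  have w0: "0 \<le> w" unfolding w_def using real_DIM_ge_1[where 'a='a]
    by (auto simp: ball_const_def intro!: mult_nonneg_nonneg divide_nonneg_nonneg)
  have "w * m / (real ?n - 1) \<le> surface_area L"
  proof (rule surface_area_lower_bound[OF L(1-3) B])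
    fix t :: real assume t: "0 < t"
    have shadow: "shadow \<xi> L + t * m \<le> shadow \<xi> (L + cball 0 t)" if "norm \<xi> = 1" "0 < t" for \<xi> t
      using surface_area_on_shadow(2)[OF that(1) L(1-3) B that(2)] mult_left_mono[OF mS[OF that(1)], of t] that(2)
      by linarith
    define \<phi> where "\<phi> = (\<lambda>\<rho>. measure lebesgue ((*\<^sub>R) \<rho> ` L + cball 0 t) - measure lebesgue ((*\<^sub>R) \<rho> ` L))"
    have "(w * t * m) / (real (?n - 2) + 1) \<le> \<phi> 1"
    proof (rule increments_power_bound)
      fix \<rho> :: real assume \<rho>: "0 < \<rho>"
      have "measure lebesgue ((*\<^sub>R) \<rho> ` L) \<le> measure lebesgue ((*\<^sub>R) \<rho> ` L + cball 0 t)"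
        using L t by (intro measure_compact_mono cc_intros subset_set_plus_right) auto
      then show "0 \<le> \<phi> \<rho>" by (simp add: \<phi>_def)
      fix s :: real assume s: "0 < s"
      have "\<phi> \<rho> + s * (\<rho> ^ (?n - 2) * t * m) * w \<le> \<phi> (\<rho> + s)"
        unfolding \<phi>_def w_def
      proof (rule vol_increment_zonoid[OF L])
        show "\<rho> ^ (?n - 2) * t * m \<le> shadow \<xi> ((*\<^sub>R) \<rho> ` L + cball 0 t) - shadow \<xi> ((*\<^sub>R) \<rho> ` L)"
          if "norm \<xi> = 1" for \<xi>
          using shadow[OF that] by (intro shadow_increment_scaleR L n that \<rho> t)
      qed (use \<rho> s t m0 in auto)
      then show "\<phi> \<rho> + s * (w * t * m * \<rho> ^ (?n - 2)) \<le> \<phi> (\<rho> + s)" by (simp add: mult_ac)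
    next
      show "0 \<le> w * t * m" using w0 m0 t by simp
    qed
    moreover have "real (?n - 2) + 1 = real ?n - 1" using n by simp
    ultimately show "measure lebesgue L + t * (w * m / (real ?n - 1)) \<le> measure lebesgue (L + cball 0 t)"
      by (simp add: \<phi>_def mult_ac)
  qed
  then show ?thesis by (simp add: w_def m_def mult_ac)
qed

theorem corollary2:
  fixes L :: "(real ^ 'n) set"
  assumes "CARD('n) \<ge> 2"
    and "projection_body L"
  shows "surface_area L \<ge>
           real CARD('n) / (real CARD('n) - 1) * ball_const CARD('n) *
           (INF \<xi>\<in>sphere 0 1. surface_area_on ({\<xi>}\<^sup>\<bottom>) (hyperplane_proj L \<xi>)) *
           measure lebesgue L powr (1 / real CARD('n))"
proof -
  have body: "convex_body L" "origin_symmetric L"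
    using assms(2) by (auto simp: projection_body_def is_projection_body_of_def)
  obtain r where "0 < r" "cball 0 r \<subseteq> L" using origin_symmetric_contains_cball[OF body] .
  then have "0 \<in> L" by auto
  moreover have "DIM(real ^ 'n) = CARD('n)" by simp
  ultimately show ?thesis
    using surface_area_zonoid_ge[of L] zonoid_projection_body[OF assms(2)] assms(1) body(1)
    by (simp add: convex_body_def)
qed

end
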